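(* Let $p\in(0,1)$ and $m=2p-1$. For each $N$ let $D=D_N=\mathrm{diag}(d_1,\dots,d_N)$ be a deterministic diagonal matrix with $d_i\in\{-1,+1\}$ such that $\frac1N\sum_{i=1}^N\delta_{d_i}$ converges weakly to $p\,\delta_1+(1-p)\,\delta_{-1}$ as $N\to\infty$, and let $O$ be Haar distributed on the orthogonal group $O(N)$. Then there exists $\beta_m>0$ such that for all $0<\beta<\beta_m$, $$\frac1N\log Z_N(\beta,O,D)\longrightarrow\frac12\int_0^{2\beta}\frac{\sqrt{1+4z(m+z)}-1}{2z}\,dz\qquad\text{in probability as }N\to\infty .$$
   Context: For $\beta\ge0$, $O\in O(N)$ and a diagonal matrix $D$, $Z_N(\beta,O,D)=\frac1{2^N}\sum_{\sigma\in\{-1,+1\}^N}\exp\big(\beta\,\sigma^TODO^T\sigma\big)$. This is the Random Orthogonal Model (ROM) with parameter $p$. *)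

theory Defs
  imports "HOL-Probability.Probability" "Jordan_Normal_Form.Matrix"
begin

(* O(N), not to be confused with orthogonal_mat of Jordan_Normal_Form, which only asks for
   nonzero, pairwise orthogonal columns *)
definition orthogonal_group :: "nat \<Rightarrow> real mat set" where
  "orthogonal_group N = {A \<in> carrier_mat N N. transpose_mat A * A = 1\<^sub>m N}"

(* Borel sets of O(N) as a subspace of R^(N x N), with coordinates the matrix entries *)
definition orthogonal_borel :: "nat \<Rightarrow> real mat measure" where
  "orthogonal_borel N =
     vimage_algebra (orthogonal_group N)
       (\<lambda>A. \<lambda>ij\<in>{..<N} \<times> {..<N}. A $$ ij)
       (\<Pi>\<^sub>M ij\<in>{..<N} \<times> {..<N}. borel)"

(* The left-invariant Borel probability measure on the compact group O(N). It is unique, so this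
   predicate describes the law of a Haar distributed orthogonal matrix. *)
definition is_haar :: "nat \<Rightarrow> real mat measure \<Rightarrow> bool" where
  "is_haar N \<mu> \<longleftrightarrow>
     prob_space \<mu> \<and> sets \<mu> = sets (orthogonal_borel N) \<and>
     (\<forall>U\<in>orthogonal_group N. distr \<mu> \<mu> (\<lambda>A. U * A) = \<mu>)"

definition spin_configs :: "nat \<Rightarrow> real Matrix.vec set" where
  "spin_configs N = {\<sigma> \<in> carrier_vec N. \<forall>i<N. vec_index \<sigma> i \<in> {-1, 1}}"

definition Z_ROM :: "nat \<Rightarrow> real \<Rightarrow> real mat \<Rightarrow> real mat \<Rightarrow> real" where
  "Z_ROM N \<beta> U D =
     (1 / 2 ^ N) * (\<Sum>\<sigma>\<in>spin_configs N.
        exp (\<beta> * scalar_prod \<sigma> ((U * D * transpose_mat U) *\<^sub>v \<sigma>)))"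

(* (1/N) * sum of the Dirac masses at x 0, ..., x (N - 1) *)
definition empirical_measure :: "nat \<Rightarrow> (nat \<Rightarrow> real) \<Rightarrow> real measure" where
  "empirical_measure N x = distr (uniform_count_measure {..<N}) borel x"

(* p * delta_1 + (1 - p) * delta_(-1) *)
definition two_point_measure :: "real \<Rightarrow> real measure" where
  "two_point_measure p =
     distr (measure_pmf (bernoulli_pmf p)) borel (\<lambda>b. if b then 1 else - 1)"

(* Convergence in probability to a constant; each X N lives on its own probability space \<mu> N *)
definition tendsto_in_probability ::
  "(nat \<Rightarrow> 'a measure) \<Rightarrow> (nat \<Rightarrow> 'a \<Rightarrow> real) \<Rightarrow> real \<Rightarrow> bool" where
  "tendsto_in_probability \<mu> X c \<longleftrightarrow>
     (\<forall>\<epsilon>>0. (\<lambda>N. measure (\<mu> N) {\<omega> \<in> space (\<mu> N). \<bar>X N \<omega> - c\<bar> > \<epsilon>}) \<longlonglongrightarrow> 0)"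

end

theory Submission
  imports Defs "Jordan_Normal_Form.Determinant" "HOL-Probability.Hoeffding"
begin

text \<open>
  For fixed spins \<open>x, y\<close> the matrix \<open>J = U D U\<^sup>T\<close> enters \<open>Z\<close> only through \<open>x \<bullet> J x\<close>, and the invariance
  of the Haar measure under rotations in a coordinate plane yields exact differential identities for the
  exponential moments. Since \<open>J\<^sup>2 = 1\<close>, the identity for one configuration is a Riccati equation for the
  mean of \<open>x \<bullet> J x / N\<close> under the tilted law; its stable root is the \<open>R\<close>-transform of the limit law, so
  \<open>ln (E Z)\<close> is \<open>N\<close> times the claimed integral up to a bounded error. For two configurations,
  \<open>x + y\<close> and \<open>x - y\<close> are orthogonal and the analogous identity gives a differential inequality, whence
  \<open>E (Z\<^sup>2) \<le> C (E Z)\<^sup>2\<close> for small \<open>\<beta>\<close>.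

  This only shows that \<open>Z \<ge> E Z / 2\<close> has probability bounded away from \<open>0\<close>. The variance of \<open>ln Z\<close> is
  estimated along the chain of orthogonal groups of the last \<open>n\<close> coordinates: one step of this martingale
  changes \<open>U\<close> by a single reflection, which moves \<open>ln Z\<close> by a Gibbs average that is of order \<open>1\<close> in mean
  square. Hence \<open>Var (ln Z) = O(N ln N)\<close>, and Chebyshev's inequality finishes the proof.
\<close>

section \<open>Quadratic forms of orthogonal matrices\<close>

text \<open>The bound on \<beta> comes from one place. On [-1, 1] the polynomial
  \<open>2 * b * r\<^sup>2 + r - m - 2 * b\<close> has slope at least 1/2 as long as b is at most
  1/8, so a defect in the Riccati equation becomes at most twice that error in the mean. Two
  configurations with overlap S are tilted by \<open>\<beta> * (1 + S / N)\<close> and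
  \<open>\<beta> * (1 - S / N)\<close>, which reach 2\<beta>; hence the threshold 1/16, the same for
  every p. All estimates hold at fixed N with the exact mean of the signs; weak convergence enters
  only at the end, through the Lipschitz dependence of \<open>Lam\<close> on m. The obstacle in the
  variance is that a single reflection can change \<open>x \<bullet> J x\<close> by order N. The
  worst case over x, summed over N steps, would be of order N^3, too much for Chebyshev at scale N.
  In mean square under the Gibbs measure the change is small: J is orthogonal, so the squares of the
  fields (J x)_i sum to N, and the normal at stage n is built from a random unit vector in n
  coordinates. Stage n costs a constant plus N/n plus one squared field, whence the harmonic
  sum.\<close>

definition ip :: "nat \<Rightarrow> (nat \<Rightarrow> real) \<Rightarrow> (nat \<Rightarrow> real) \<Rightarrow> real" where
  "ip N x y = (\<Sum>i<N. x i * y i)"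

definition mv :: "nat \<Rightarrow> real mat \<Rightarrow> (nat \<Rightarrow> real) \<Rightarrow> nat \<Rightarrow> real" where
  "mv N A x i = (\<Sum>k<N. A $$ (i, k) * x k)"

definition unit_fun :: "nat \<Rightarrow> nat \<Rightarrow> real" where
  "unit_fun j i = (if i = j then 1 else 0)"

text \<open>The Householder reflection 1 - 2 w w^T, orthogonal when \<open>w\<close> is a unit
  vector. Families of these reflections also do the work of rotations in a coordinate plane.\<close>

definition refl_mat :: "nat \<Rightarrow> (nat \<Rightarrow> real) \<Rightarrow> real mat" where
  "refl_mat N w = mat N N (\<lambda>(i, k). (if i = k then 1 else 0) - 2 * w i * w k)"

text \<open>The bilinear form x^T J y of J = U D U^T, expressed in the coordinates of U^T x. Vectors
  are functions of which only the values below \<open>N\<close> matter, so linearity is pointwise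
  algebra.\<close>

definition qf :: "nat \<Rightarrow> (nat \<Rightarrow> real) \<Rightarrow> real mat \<Rightarrow> (nat \<Rightarrow> real) \<Rightarrow> (nat \<Rightarrow> real) \<Rightarrow> real" where
  "qf N d U x y = (\<Sum>i<N. d i * (mv N (transpose_mat U) x i * mv N (transpose_mat U) y i))"

lemma ip_commute: "ip N x y = ip N y x"
  by (simp add: ip_def mult.commute)

lemma ip_add_left: "ip N (\<lambda>i. x i + y i) z = ip N x z + ip N y z"
  by (simp add: ip_def sum.distrib algebra_simps)

lemma ip_diff_left: "ip N (\<lambda>i. x i - y i) z = ip N x z - ip N y z"
  by (simp add: ip_def sum_subtractf algebra_simps)

lemma ip_scale_left: "ip N (\<lambda>i. c * x i) z = c * ip N x z"
  by (simp add: ip_def sum_distrib_left algebra_simps)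

lemma ip_add_right: "ip N z (\<lambda>i. x i + y i) = ip N z x + ip N z y"
  by (simp add: ip_def sum.distrib algebra_simps)

lemma ip_diff_right: "ip N z (\<lambda>i. x i - y i) = ip N z x - ip N z y"
  by (simp add: ip_def sum_subtractf algebra_simps)

lemma ip_scale_right: "ip N z (\<lambda>i. c * x i) = c * ip N z x"
  by (simp add: ip_def sum_distrib_left algebra_simps)

lemmas ip_linear = ip_add_left ip_diff_left ip_scale_left ip_add_right ip_diff_right ip_scale_right

lemma ip_nonneg: "0 \<le> ip N x x"
  by (simp add: ip_def sum_nonneg)

lemma ip_cong: "(\<And>i. i < N \<Longrightarrow> x i = x' i) \<Longrightarrow> (\<And>i. i < N \<Longrightarrow> y i = y' i) \<Longrightarrow> ip N x y = ip N x' y'"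
  by (simp add: ip_def)

lemma ip_eq_0_iff: "ip N x x = 0 \<longleftrightarrow> (\<forall>i<N. x i = 0)"
  unfolding ip_def by (subst sum_nonneg_eq_0_iff) auto

lemma ip_unit_fun_left: "j < N \<Longrightarrow> ip N (unit_fun j) x = x j"
proof -
  assume j: "j < N"
  have "ip N (unit_fun j) x = (\<Sum>i<N. if i = j then x i else 0)"
    unfolding ip_def unit_fun_def by (intro sum.cong) auto
  then show ?thesis using j by (simp add: sum.delta)
qed

lemma ip_unit_fun_right: "j < N \<Longrightarrow> ip N x (unit_fun j) = x j"
  by (simp add: ip_commute[of N x] ip_unit_fun_left)

lemma mv_cong: "(\<And>k. k < N \<Longrightarrow> x k = x' k) \<Longrightarrow> mv N A x i = mv N A x' i"
  by (simp add: mv_def)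

lemma mv_add: "mv N A (\<lambda>k. x k + y k) i = mv N A x i + mv N A y i"
  by (simp add: mv_def sum.distrib algebra_simps)

lemma mv_diff: "mv N A (\<lambda>k. x k - y k) i = mv N A x i - mv N A y i"
  by (simp add: mv_def sum_subtractf algebra_simps)

lemma mv_scale: "mv N A (\<lambda>k. c * x k) i = c * mv N A x i"
  by (simp add: mv_def sum_distrib_left algebra_simps)

lemma mv_unit_fun: "j < N \<Longrightarrow> mv N A (unit_fun j) i = A $$ (i, j)"
proof -
  assume j: "j < N"
  have "mv N A (unit_fun j) i = (\<Sum>k<N. if k = j then A $$ (i, k) else 0)"
    unfolding mv_def unit_fun_def by (intro sum.cong) auto
  then show ?thesis using j by (simp add: sum.delta)
qed

lemma mult_mat_index:
  assumes "A \<in> carrier_mat N N" "B \<in> carrier_mat N N" "i < N" "j < N"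
  shows "(A * B) $$ (i, j) = (\<Sum>k<N. A $$ (i, k) * B $$ (k, j))"
  using assms by (auto simp: scalar_prod_def atLeast0LessThan intro!: sum.cong)

lemma mv_mult:
  assumes "A \<in> carrier_mat N N" "B \<in> carrier_mat N N" "i < N"
  shows "mv N (A * B) x i = mv N A (mv N B x) i"
proof -
  have "mv N (A * B) x i = (\<Sum>k<N. \<Sum>l<N. A $$ (i, l) * B $$ (l, k) * x k)"
    unfolding mv_def using assms
    by (intro sum.cong refl) (simp add: mult_mat_index[of A N B] sum_distrib_right del: index_mult_mat)
  also have "\<dots> = (\<Sum>l<N. \<Sum>k<N. A $$ (i, l) * B $$ (l, k) * x k)"
    by (rule sum.swap)
  also have "\<dots> = mv N A (mv N B x) i"
    unfolding mv_def by (intro sum.cong refl) (simp add: sum_distrib_left algebra_simps)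
  finally show ?thesis .
qed

lemma mv_one: "i < N \<Longrightarrow> mv N (1\<^sub>m N) x i = x i"
proof -
  assume i: "i < N"
  have "mv N (1\<^sub>m N) x i = (\<Sum>k<N. if k = i then x k else 0)"
    unfolding mv_def using i by (intro sum.cong) auto
  then show ?thesis using i by (simp add: sum.delta)
qed

lemma ip_mv_left:
  assumes "A \<in> carrier_mat N N"
  shows "ip N (mv N A x) y = ip N x (mv N (transpose_mat A) y)"
proof -
  have "ip N (mv N A x) y = (\<Sum>i<N. \<Sum>k<N. A $$ (i, k) * x k * y i)"
    unfolding ip_def mv_def by (simp add: sum_distrib_right)
  also have "\<dots> = (\<Sum>k<N. \<Sum>i<N. A $$ (i, k) * x k * y i)"
    by (rule sum.swap)
  also have "\<dots> = ip N x (mv N (transpose_mat A) y)"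
    unfolding ip_def mv_def using assms by (auto simp: sum_distrib_left algebra_simps intro!: sum.cong)
  finally show ?thesis .
qed

lemma orthogonal_groupD:
  assumes "A \<in> orthogonal_group N"
  shows "A \<in> carrier_mat N N" "transpose_mat A * A = 1\<^sub>m N" "A * transpose_mat A = 1\<^sub>m N"
proof -
  show 1: "A \<in> carrier_mat N N" and 2: "transpose_mat A * A = 1\<^sub>m N"
    using assms unfolding orthogonal_group_def by blast+
  have "transpose_mat A \<in> carrier_mat N N" using 1 by simp
  from mat_mult_left_right_inverse[OF this 1 2]
  show "A * transpose_mat A = 1\<^sub>m N" .
qed

lemma orthogonal_group_one: "1\<^sub>m N \<in> orthogonal_group N"
  by (simp add: orthogonal_group_def)

lemma orthogonal_groupI: "A \<in> carrier_mat N N \<Longrightarrow> transpose_mat A * A = 1\<^sub>m N \<Longrightarrow> A \<in> orthogonal_group N"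
  by (simp add: orthogonal_group_def)

lemma orthogonal_group_transpose:
  assumes "A \<in> orthogonal_group N"
  shows "transpose_mat A \<in> orthogonal_group N"
  by (rule orthogonal_groupI) (simp_all only: transpose_carrier_mat transpose_transpose orthogonal_groupD[OF assms])

lemma orthogonal_group_mult:
  assumes A: "A \<in> orthogonal_group N" and B: "B \<in> orthogonal_group N"
  shows "A * B \<in> orthogonal_group N"
proof -
  note a = orthogonal_groupD[OF A] and b = orthogonal_groupD[OF B]
  have "transpose_mat (A * B) * (A * B) = transpose_mat B * (transpose_mat A * (A * B))"
    unfolding transpose_mult[OF a(1) b(1)]
    by (rule assoc_mult_mat[of _ N N _ N _ N]) (use a(1) b(1) in auto)
  also have "transpose_mat A * (A * B) = (transpose_mat A * A) * B"
    by (rule assoc_mult_mat[of _ N N _ N _ N, symmetric]) (use a(1) b(1) in auto)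
  also have "\<dots> = B" unfolding a(2) using b(1) by (rule left_mult_one_mat)
  finally show ?thesis using a(1) b(1,2) by (intro orthogonal_groupI) auto
qed

lemma orthogonal_cancel:
  assumes A: "A \<in> orthogonal_group N" and B: "B \<in> carrier_mat N N"
  shows "transpose_mat A * (A * B) = B" "A * (transpose_mat A * B) = B"
    "B * transpose_mat A * A = B" "B * A * transpose_mat A = B"
proof -
  note a = orthogonal_groupD[OF A]
  have at: "transpose_mat A \<in> carrier_mat N N" using a by simp
  show "transpose_mat A * (A * B) = B"
    unfolding assoc_mult_mat[OF at a(1) B, symmetric] a(2) using B by (rule left_mult_one_mat)
  show "A * (transpose_mat A * B) = B"
    unfolding assoc_mult_mat[OF a(1) at B, symmetric] a(3) using B by (rule left_mult_one_mat)
  show "B * transpose_mat A * A = B"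
    unfolding assoc_mult_mat[OF B at a(1)] a(2) using B by (rule right_mult_one_mat)
  show "B * A * transpose_mat A = B"
    unfolding assoc_mult_mat[OF B a(1) at] a(3) using B by (rule right_mult_one_mat)
qed

lemma mv_transpose_cancel:
  assumes A: "A \<in> orthogonal_group N" and i: "i < N"
  shows "mv N (transpose_mat A) (mv N A x) i = x i" "mv N A (mv N (transpose_mat A) x) i = x i"
proof -
  note a = orthogonal_groupD[OF A]
  have at: "transpose_mat A \<in> carrier_mat N N" using a(1) by simp
  show "mv N (transpose_mat A) (mv N A x) i = x i"
    unfolding mv_mult[OF at a(1) i, symmetric] a(2) using i by (rule mv_one)
  show "mv N A (mv N (transpose_mat A) x) i = x i"
    unfolding mv_mult[OF a(1) at i, symmetric] a(3) using i by (rule mv_one)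
qed

lemma ip_mv_mv:
  assumes A: "A \<in> orthogonal_group N"
  shows "ip N (mv N A x) (mv N A y) = ip N x y"
proof -
  have "ip N (mv N A x) (mv N A y) = ip N x (mv N (transpose_mat A) (mv N A y))"
    using ip_mv_left orthogonal_groupD(1)[OF A] by blast
  also have "\<dots> = ip N x y" by (intro ip_cong) (simp_all add: mv_transpose_cancel[OF A])
  finally show ?thesis .
qed

section \<open>Householder reflections\<close>

lemma refl_mat_carrier [simp]: "refl_mat N w \<in> carrier_mat N N"
  by (simp add: refl_mat_def)

lemma refl_mat_transpose [simp]: "transpose_mat (refl_mat N w) = refl_mat N w"
  by (rule eq_matI) (auto simp: refl_mat_def)

lemma mv_refl: "i < N \<Longrightarrow> mv N (refl_mat N w) x i = x i - 2 * ip N w x * w i"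
proof -
  assume i: "i < N"
  have "mv N (refl_mat N w) x i = (\<Sum>k<N. (if k = i then x k else 0) - 2 * w i * (w k * x k))"
    unfolding mv_def refl_mat_def using i by (intro sum.cong) (auto simp: algebra_simps)
  also have "\<dots> = x i - 2 * w i * ip N w x"
    using i by (simp add: sum_subtractf sum.delta ip_def sum_distrib_left)
  finally show ?thesis by simp
qed

lemma mat_eq_mvI:
  assumes "A \<in> carrier_mat N N" "B \<in> carrier_mat N N"
    and "\<And>i j. i < N \<Longrightarrow> j < N \<Longrightarrow> mv N A (unit_fun j) i = mv N B (unit_fun j) i"
  shows "A = B"
  using assms by (intro eq_matI) (auto simp: mv_unit_fun)

lemma refl_mat_orthogonal:
  assumes "ip N w w = 1"
  shows "refl_mat N w \<in> orthogonal_group N" "refl_mat N w * refl_mat N w = 1\<^sub>m N"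
proof -
  show "refl_mat N w * refl_mat N w = 1\<^sub>m N"
  proof (rule mat_eq_mvI[of _ N])
    show "refl_mat N w * refl_mat N w \<in> carrier_mat N N"
      using mult_carrier_mat[OF refl_mat_carrier refl_mat_carrier] .
    fix i j assume i: "i < N"
    let ?u = "unit_fun j"
    have "mv N (refl_mat N w * refl_mat N w) ?u i = mv N (refl_mat N w) (mv N (refl_mat N w) ?u) i"
      using i by (simp add: mv_mult)
    also have "\<dots> = mv N (refl_mat N w) (\<lambda>i. ?u i - 2 * ip N w ?u * w i) i"
      by (intro mv_cong) (simp add: mv_refl)
    also have "\<dots> = ?u i"
      using i assms by (simp only: mv_refl ip_diff_right ip_scale_right) simp
    also have "\<dots> = mv N (1\<^sub>m N) ?u i" using i by (simp add: mv_one)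
    finally show "mv N (refl_mat N w * refl_mat N w) ?u i = mv N (1\<^sub>m N) ?u i" .
  qed simp
  then show "refl_mat N w \<in> orthogonal_group N"
    by (simp add: orthogonal_group_def)
qed

text \<open>The reflection with normal x - y; equal norms put the midpoint of x and y on the mirror.
  The clause on fixed vectors lets a second vector be moved without disturbing a first one.\<close>

lemma householder:
  assumes "ip N x x = ip N y y"
  shows "\<exists>V\<in>orthogonal_group N. (\<forall>i<N. mv N V x i = y i) \<and>
    (\<forall>z. ip N z x = 0 \<longrightarrow> ip N z y = 0 \<longrightarrow> (\<forall>i<N. mv N V z i = z i))"
proof (cases "\<forall>i<N. x i = y i")
  case True
  then show ?thesis
    by (intro bexI[of _ "1\<^sub>m N"]) (auto simp: mv_one orthogonal_group_one)
next
  case False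
  define q where "q = ip N (\<lambda>i. x i - y i) (\<lambda>i. x i - y i)"
  have q: "q > 0"
  proof -
    have "q \<noteq> 0" using False unfolding q_def ip_eq_0_iff by auto
    then show ?thesis using ip_nonneg[of N "\<lambda>i. x i - y i"] unfolding q_def by linarith
  qed
  have qq: "q = 2 * (ip N x x - ip N x y)"
    using assms unfolding q_def by (simp add: ip_linear ip_commute[of N y x])
  define w where "w = (\<lambda>i. (1 / sqrt q) * (x i - y i))"
  have ww: "ip N w w = 1"
    unfolding w_def ip_scale_left ip_scale_right using q by (simp add: q_def[symmetric])
  have wx: "ip N w z = (1 / sqrt q) * (ip N x z - ip N y z)" for z
    unfolding w_def ip_scale_left by (simp add: ip_linear)
  show ?thesis
  proof (intro bexI[of _ "refl_mat N w"] conjI allI impI)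
    show "refl_mat N w \<in> orthogonal_group N" using refl_mat_orthogonal ww by blast
    fix i assume i: "i < N"
    have "2 * ip N w x * w i = 2 * (1 / sqrt q * (1 / sqrt q)) * (ip N x x - ip N x y) * (x i - y i)"
      unfolding wx by (simp add: w_def ip_commute[of N y x])
    also have "\<dots> = x i - y i" using q qq by (simp add: divide_simps) 
    finally show "mv N (refl_mat N w) x i = y i" using i by (simp add: mv_refl)
  next
    fix z i assume "ip N z x = 0" "ip N z y = 0" "i < N"
    then show "mv N (refl_mat N w) z i = z i"
      by (simp add: mv_refl wx ip_commute[of N x z] ip_commute[of N y z])
  qed
qed

section \<open>The bilinear form of U D U^T\<close>

lemma qf_commute: "qf N d U x y = qf N d U y x"
  by (simp add: qf_def mult.commute)

lemma qf_cong:
  "(\<And>i. i < N \<Longrightarrow> x i = x' i) \<Longrightarrow> (\<And>i. i < N \<Longrightarrow> y i = y' i) \<Longrightarrow> qf N d U x y = qf N d U x' y'"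
  unfolding qf_def using mv_cong[of N x x'] mv_cong[of N y y'] by simp

lemma qf_add_left: "qf N d U (\<lambda>i. x i + y i) z = qf N d U x z + qf N d U y z"
  by (simp add: qf_def mv_add sum.distrib algebra_simps)

lemma qf_diff_left: "qf N d U (\<lambda>i. x i - y i) z = qf N d U x z - qf N d U y z"
  by (simp add: qf_def mv_diff sum_subtractf algebra_simps)

lemma qf_scale_left: "qf N d U (\<lambda>i. c * x i) z = c * qf N d U x z"
  by (simp add: qf_def mv_scale sum_distrib_left algebra_simps)

lemma qf_add_right: "qf N d U z (\<lambda>i. x i + y i) = qf N d U z x + qf N d U z y"
  by (simp only: qf_commute[of N d U z] qf_add_left)

lemma qf_diff_right: "qf N d U z (\<lambda>i. x i - y i) = qf N d U z x - qf N d U z y"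
  by (simp only: qf_commute[of N d U z] qf_diff_left)

lemma qf_scale_right: "qf N d U z (\<lambda>i. c * x i) = c * qf N d U z x"
  by (simp only: qf_commute[of N d U z] qf_scale_left)

lemmas qf_linear = qf_add_left qf_diff_left qf_scale_left qf_add_right qf_diff_right qf_scale_right

lemma qf_mult:
  assumes V: "V \<in> carrier_mat N N" and U: "U \<in> carrier_mat N N"
  shows "qf N d (V * U) x y = qf N d U (mv N (transpose_mat V) x) (mv N (transpose_mat V) y)"
  unfolding qf_def using V U by (simp add: transpose_mult[OF V U] mv_mult)

lemma qf_mult_mv:
  assumes V: "V \<in> orthogonal_group N" and U: "U \<in> carrier_mat N N"
  shows "qf N d (V * U) (mv N V x) (mv N V y) = qf N d U x y"
  unfolding qf_mult[OF orthogonal_groupD(1)[OF V] U]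
  by (intro qf_cong) (simp_all add: mv_transpose_cancel[OF V])

lemma qf_eq_ip: "qf N d U x y =
    ip N (\<lambda>i. d i * mv N (transpose_mat U) x i) (mv N (transpose_mat U) y)"
  by (simp add: qf_def ip_def algebra_simps)

text \<open>The symmetric matrix of the form is an involution, because the entries of \<open>d\<close> are signs.\<close>
lemma sum_qf_unit_square:
  assumes U: "U \<in> orthogonal_group N" and d: "\<And>i. i < N \<Longrightarrow> d i \<in> {-1, 1}"
  shows "(\<Sum>j<N. (qf N d U (unit_fun j) x)\<^sup>2) = ip N x x"
proof -
  note Ut = orthogonal_group_transpose[OF U] and Uc = orthogonal_groupD(1)[OF U]
  define z where "z = (\<lambda>i. d i * mv N (transpose_mat U) x i)"
  have "qf N d U (unit_fun j) x = mv N U z j" if "j < N" for j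
    using that Uc unfolding qf_def mv_def[of N U] z_def
    by (intro sum.cong) (auto simp: mv_unit_fun)
  then have "(\<Sum>j<N. (qf N d U (unit_fun j) x)\<^sup>2) = ip N (mv N U z) (mv N U z)"
    by (simp add: ip_def power2_eq_square)
  also have "\<dots> = ip N z z" using ip_mv_mv[OF U] .
  also have "\<dots> = ip N (mv N (transpose_mat U) x) (mv N (transpose_mat U) x)"
  proof -
    have "d i * a * (d i * a) = a * a" if "i < N" for i a using d[OF that] by auto
    then show ?thesis unfolding ip_def z_def by (intro sum.cong refl) (simp only: lessThan_iff)
  qed
  also have "\<dots> = ip N x x" using ip_mv_mv[OF Ut] .
  finally show ?thesis .
qed

text \<open>Conjugation preserves the trace. Together with \<open>sum_qf_unit_square\<close> this
  makes the sums over a row of J and over its diagonal explicit, which is what closes the rotation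
  identities.\<close>

lemma sum_qf_unit_unit:
  assumes U: "U \<in> orthogonal_group N"
  shows "(\<Sum>j<N. qf N d U (unit_fun j) (unit_fun j)) = (\<Sum>i<N. d i)"
proof -
  have "(\<Sum>j<N. qf N d U (unit_fun j) (unit_fun j)) = (\<Sum>j<N. \<Sum>i<N. d i * (U $$ (j, i) * U $$ (j, i)))"
    unfolding qf_def using orthogonal_groupD(1)[OF U] by (intro sum.cong refl) (auto simp: mv_unit_fun)
  also have "\<dots> = (\<Sum>i<N. d i * (\<Sum>j<N. U $$ (j, i) * U $$ (j, i)))"
    by (subst sum.swap) (simp add: sum_distrib_left)
  also have "\<dots> = (\<Sum>i<N. d i)"
  proof (intro sum.cong refl)
    fix i assume i: "i \<in> {..<N}"
    have "(\<Sum>j<N. U $$ (j, i) * U $$ (j, i)) = ip N (mv N U (unit_fun i)) (mv N U (unit_fun i))"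
      unfolding ip_def using i by (intro sum.cong) (auto simp: mv_unit_fun)
    also have "\<dots> = 1" unfolding ip_mv_mv[OF U] using i by (simp add: ip_unit_fun_left unit_fun_def)
    finally show "d i * (\<Sum>j<N. U $$ (j, i) * U $$ (j, i)) = d i" by simp
  qed
  finally show ?thesis .
qed

text \<open>J has operator norm 1. The arithmetic mean takes the place of the Cauchy-Schwarz bound,
  with no loss for the pairs of equal norm to which it is applied.\<close>

lemma abs_qf_le:
  assumes U: "U \<in> orthogonal_group N" and d: "\<And>i. i < N \<Longrightarrow> d i \<in> {-1, 1}"
  shows "\<bar>qf N d U x y\<bar> \<le> (ip N x x + ip N y y) / 2"
proof -
  let ?a = "mv N (transpose_mat U) x" and ?b = "mv N (transpose_mat U) y"
  have "\<bar>qf N d U x y\<bar> \<le> (\<Sum>i<N. (?a i * ?a i + ?b i * ?b i) / 2)"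
    unfolding qf_def
  proof (rule order_trans[OF sum_abs], rule sum_mono)
    fix i assume "i \<in> {..<N}"
    then have "\<bar>d i * (?a i * ?b i)\<bar> = \<bar>?a i * ?b i\<bar>" using d[of i] by auto
    also have "\<dots> \<le> (?a i * ?a i + ?b i * ?b i) / 2"
      using sum_squares_bound[of "\<bar>?a i\<bar>" "\<bar>?b i\<bar>"] by (simp add: power2_eq_square abs_mult)
    finally show "\<bar>d i * (?a i * ?b i)\<bar> \<le> (?a i * ?a i + ?b i * ?b i) / 2" .
  qed
  also have "\<dots> = (ip N ?a ?a + ip N ?b ?b) / 2"
    by (simp add: ip_def sum.distrib sum_divide_distrib[symmetric])
  also have "\<dots> = (ip N x x + ip N y y) / 2"
    using ip_mv_mv[OF orthogonal_group_transpose[OF U]] by simp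
  finally show ?thesis .
qed

lemma qf_refl:
  assumes U: "U \<in> carrier_mat N N"
  shows "qf N d (refl_mat N w * U) x y =
    qf N d U (\<lambda>i. x i - 2 * ip N w x * w i) (\<lambda>i. y i - 2 * ip N w y * w i)"
  unfolding qf_mult[OF refl_mat_carrier U] refl_mat_transpose
  by (intro qf_cong) (simp_all add: mv_refl)

lemma orthogonal_frame:
  assumes N: "2 \<le> N" and uv: "ip N u v = 0"
  shows "\<exists>V\<in>orthogonal_group N. (\<forall>i<N. mv N V u i = sqrt (ip N u u) * unit_fun 0 i) \<and>
    (\<forall>i<N. mv N V v i = sqrt (ip N v v) * unit_fun 1 i)"
proof -
  define a where "a = (\<lambda>i. sqrt (ip N u u) * unit_fun 0 i)"
  define b where "b = (\<lambda>i. sqrt (ip N v v) * unit_fun 1 i)"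
  have aa: "ip N u u = ip N a a" unfolding a_def ip_linear using N ip_nonneg[of N u]
    by (simp add: ip_unit_fun_left unit_fun_def)
  have bb: "ip N v v = ip N b b" unfolding b_def ip_linear using N ip_nonneg[of N v]
    by (simp add: ip_unit_fun_left unit_fun_def)
  have ab: "ip N a b = 0" unfolding a_def b_def ip_linear using N
    by (simp add: ip_unit_fun_left unit_fun_def)
  obtain V1 where V1: "V1 \<in> orthogonal_group N" "\<And>i. i < N \<Longrightarrow> mv N V1 u i = a i"
    using householder[OF aa] by blast
  define v' where "v' = mv N V1 v"
  have "ip N v' v' = ip N b b" unfolding v'_def ip_mv_mv[OF V1(1)] by (rule bb)
  from householder[OF this] obtain V2 where V2: "V2 \<in> orthogonal_group N"
    "\<And>i. i < N \<Longrightarrow> mv N V2 v' i = b i"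
    "\<And>z i. ip N z v' = 0 \<Longrightarrow> ip N z b = 0 \<Longrightarrow> i < N \<Longrightarrow> mv N V2 z i = z i" by blast
  have "ip N a v' = ip N (mv N V1 u) (mv N V1 v)" unfolding v'_def
    by (intro ip_cong) (simp_all add: V1(2))
  then have av: "ip N a v' = 0" using uv by (simp add: ip_mv_mv[OF V1(1)])
  show ?thesis
  proof (intro bexI[of _ "V2 * V1"] conjI allI impI)
    show "V2 * V1 \<in> orthogonal_group N" using V1 V2 orthogonal_group_mult by blast
    fix i assume i: "i < N"
    note m = mv_mult[OF orthogonal_groupD(1)[OF V2(1)] orthogonal_groupD(1)[OF V1(1)] i]
    show "mv N (V2 * V1) v i = sqrt (ip N v v) * unit_fun 1 i"
      using V2(2)[OF i] unfolding m v'_def b_def by simp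
    have "mv N (V2 * V1) u i = mv N V2 a i" unfolding m by (intro mv_cong) (simp add: V1(2))
    also have "\<dots> = a i" using V2(3)[OF av ab i] .
    finally show "mv N (V2 * V1) u i = sqrt (ip N u u) * unit_fun 0 i" by (simp add: a_def)
  qed
qed

section \<open>Haar measure on the orthogonal group\<close>

lemma space_orthogonal_borel [simp]: "space (orthogonal_borel N) = orthogonal_group N"
  by (simp add: orthogonal_borel_def)

lemma measurable_orthogonal_borelI:
  assumes "\<And>x. x \<in> space M \<Longrightarrow> f x \<in> orthogonal_group N"
    and "\<And>i j. i < N \<Longrightarrow> j < N \<Longrightarrow> (\<lambda>x. f x $$ (i, j)) \<in> borel_measurable M"
  shows "f \<in> measurable M (orthogonal_borel N)"
  unfolding orthogonal_borel_def
proof (rule measurable_vimage_algebra2)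
  show "f \<in> space M \<rightarrow> orthogonal_group N" using assms(1) by auto
  show "(\<lambda>x. \<lambda>ij\<in>{..<N} \<times> {..<N}. f x $$ ij) \<in> M \<rightarrow>\<^sub>M (\<Pi>\<^sub>M ij\<in>{..<N} \<times> {..<N}. borel)"
    using assms(2) by (intro measurable_restrict) auto
qed

lemma measurable_entry:
  assumes "i < N" "j < N" "f \<in> measurable M (orthogonal_borel N)"
  shows "(\<lambda>x. f x $$ (i, j)) \<in> borel_measurable M"
proof -
  let ?S = "{..<N} \<times> {..<N}"
  have "(\<lambda>A. \<lambda>ij\<in>?S. A $$ ij) \<in> orthogonal_borel N \<rightarrow>\<^sub>M (\<Pi>\<^sub>M ij\<in>?S. (borel :: real measure))"
    unfolding orthogonal_borel_def by (rule measurable_vimage_algebra1) (auto simp: space_PiM)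
  then have "(\<lambda>A. (\<lambda>ij\<in>?S. A $$ ij) (i, j)) \<in> borel_measurable (orthogonal_borel N)"
    by (rule measurable_compose[OF _ measurable_component_singleton]) (use assms in auto)
  then have "(\<lambda>A. A $$ (i, j)) \<in> borel_measurable (orthogonal_borel N)"
    using assms by simp
  then show ?thesis using measurable_compose[OF assms(3)] by blast
qed

lemma measurable_orthogonal_in:
  "f \<in> measurable M (orthogonal_borel N) \<Longrightarrow> x \<in> space M \<Longrightarrow> f x \<in> orthogonal_group N"
  by (drule (1) measurable_space) simp

lemma measurable_mat_mult [measurable (raw)]:
  assumes f: "f \<in> measurable M (orthogonal_borel N)" and g: "g \<in> measurable M (orthogonal_borel N)"
  shows "(\<lambda>x. f x * g x) \<in> measurable M (orthogonal_borel N)"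
proof (rule measurable_orthogonal_borelI)
  note fx = measurable_orthogonal_in[OF f] and gx = measurable_orthogonal_in[OF g]
  show "f x * g x \<in> orthogonal_group N" if "x \<in> space M" for x
    using that fx gx orthogonal_group_mult by blast
  fix i j assume ij: "i < N" "j < N"
  have "(\<lambda>x. \<Sum>k<N. f x $$ (i, k) * g x $$ (k, j)) \<in> borel_measurable M"
    using ij f g by (intro borel_measurable_sum borel_measurable_times measurable_entry) auto
  then show "(\<lambda>x. (f x * g x) $$ (i, j)) \<in> borel_measurable M"
    by (rule measurable_cong[THEN iffD1, rotated])
      (use fx gx ij in \<open>auto intro!: mult_mat_index[symmetric] orthogonal_groupD(1)\<close>)
qed

lemma measurable_mat_transpose [measurable (raw)]:
  assumes f: "f \<in> measurable M (orthogonal_borel N)"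
  shows "(\<lambda>x. transpose_mat (f x)) \<in> measurable M (orthogonal_borel N)"
proof (rule measurable_orthogonal_borelI)
  note fx = measurable_orthogonal_in[OF f]
  show "transpose_mat (f x) \<in> orthogonal_group N" if "x \<in> space M" for x
    using that fx orthogonal_group_transpose by blast
  fix i j assume ij: "i < N" "j < N"
  have "f x $$ (j, i) = transpose_mat (f x) $$ (i, j)" if "x \<in> space M" for x
    using orthogonal_groupD(1)[OF fx[OF that]] ij by simp
  then show "(\<lambda>x. transpose_mat (f x) $$ (i, j)) \<in> borel_measurable M"
    by (rule measurable_cong[THEN iffD1, OF _ measurable_entry[OF ij(2,1) f]])
qed

lemma measurable_qf:
  assumes f: "f \<in> measurable M (orthogonal_borel N)"
    and x: "\<And>i. i < N \<Longrightarrow> (\<lambda>t. x t i) \<in> borel_measurable M"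
    and y: "\<And>i. i < N \<Longrightarrow> (\<lambda>t. y t i) \<in> borel_measurable M"
  shows "(\<lambda>t. qf N d (f t) (x t) (y t)) \<in> borel_measurable M"
  unfolding qf_def mv_def using assms
  by (intro borel_measurable_sum borel_measurable_times borel_measurable_const
        measurable_entry measurable_mat_transpose) auto

section \<open>Bounded functions on probability spaces\<close>

lemma bounded_integrable:
  fixes f :: "'a \<Rightarrow> real"
  assumes "prob_space M" "f \<in> borel_measurable M" "\<And>x. x \<in> space M \<Longrightarrow> \<bar>f x\<bar> \<le> B"
  shows "integrable M f"
proof -
  interpret prob_space M by fact
  show ?thesis by (rule integrable_const_bound[of _ B]) (use assms in \<open>auto intro: AE_I2\<close>)
qed

lemma abs_integral_le:
  fixes f :: "'a \<Rightarrow> real"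
  assumes "prob_space M" "f \<in> borel_measurable M" "\<And>x. x \<in> space M \<Longrightarrow> \<bar>f x\<bar> \<le> B"
  shows "\<bar>\<integral>x. f x \<partial>M\<bar> \<le> B"
proof -
  interpret prob_space M by fact
  note i = bounded_integrable[OF assms]
  have "\<bar>\<integral>x. f x \<partial>M\<bar> \<le> (\<integral>x. \<bar>f x\<bar> \<partial>M)" by (rule integral_abs_bound)
  also have "\<dots> \<le> (\<integral>x. B \<partial>M)" using i assms(3) by (intro integral_mono) auto
  finally show ?thesis using prob_space by simp
qed

lemma bounded_Fubini:
  fixes f :: "'a \<Rightarrow> 'b \<Rightarrow> real"
  assumes "prob_space M1" "prob_space M2"
    and f: "(\<lambda>(x, y). f x y) \<in> borel_measurable (M1 \<Otimes>\<^sub>M M2)"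
    and B: "\<And>x y. x \<in> space M1 \<Longrightarrow> y \<in> space M2 \<Longrightarrow> \<bar>f x y\<bar> \<le> B"
  shows "(\<integral>x. (\<integral>y. f x y \<partial>M2) \<partial>M1) = (\<integral>y. (\<integral>x. f x y \<partial>M1) \<partial>M2)"
    and "(\<lambda>x. \<integral>y. f x y \<partial>M2) \<in> borel_measurable M1"
    and "(\<lambda>y. \<integral>x. f x y \<partial>M1) \<in> borel_measurable M2"
proof -
  interpret M1: prob_space M1 by fact
  interpret M2: prob_space M2 by fact
  interpret pair_prob_space M1 M2 ..
  have "integrable (M1 \<Otimes>\<^sub>M M2) (\<lambda>(x, y). f x y)"
    using f B by (intro bounded_integrable[of _ _ B]) (auto simp: space_pair_measure prob_space_axioms)
  from Fubini_integral[OF this]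
  show "(\<integral>x. (\<integral>y. f x y \<partial>M2) \<partial>M1) = (\<integral>y. (\<integral>x. f x y \<partial>M1) \<partial>M2)" by simp
  show "(\<lambda>x. \<integral>y. f x y \<partial>M2) \<in> borel_measurable M1"
    using f by (rule M2.borel_measurable_lebesgue_integral)
  have "(\<lambda>(y, x). f x y) \<in> borel_measurable (M2 \<Otimes>\<^sub>M M1)"
    using measurable_compose[OF measurable_pair_swap' f] by (simp add: split_def)
  then show "(\<lambda>y. \<integral>x. f x y \<partial>M1) \<in> borel_measurable M2"
    by (rule M1.borel_measurable_lebesgue_integral)
qed

section \<open>Left, right and transposition invariance\<close>

locale haar = prob_space \<mu> for \<mu> :: "real mat measure" +
  fixes N :: nat
  assumes is_haar: "is_haar N \<mu>"
begin

lemma sets_haar [measurable_cong]: "sets \<mu> = sets (orthogonal_borel N)"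
  using is_haar by (simp add: is_haar_def)

lemma space_haar [simp]: "space \<mu> = orthogonal_group N"
  using sets_eq_imp_space_eq[OF sets_haar] by simp

lemma measurable_haar: "measurable \<mu> M = measurable (orthogonal_borel N) M"
  "measurable M \<mu> = measurable M (orthogonal_borel N)"
  by (rule measurable_cong_sets[OF sets_haar refl], rule measurable_cong_sets[OF refl sets_haar])

lemma measurable_mult_const:
  "U \<in> orthogonal_group N \<Longrightarrow> (\<lambda>A. U * A) \<in> measurable \<mu> (orthogonal_borel N)"
  "U \<in> orthogonal_group N \<Longrightarrow> (\<lambda>A. A * U) \<in> measurable \<mu> (orthogonal_borel N)"
  unfolding measurable_haar
  by (intro measurable_mat_mult measurable_const measurable_ident; simp)+

lemma integral_left:
  fixes f :: "real mat \<Rightarrow> real"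
  assumes U: "U \<in> orthogonal_group N" and f: "f \<in> borel_measurable (orthogonal_borel N)"
  shows "(\<integral>A. f (U * A) \<partial>\<mu>) = (\<integral>A. f A \<partial>\<mu>)"
proof -
  have "distr \<mu> \<mu> (\<lambda>A. U * A) = \<mu>" using U is_haar by (simp add: is_haar_def)
  then have "(\<integral>A. f A \<partial>\<mu>) = (\<integral>A. f A \<partial>(distr \<mu> \<mu> (\<lambda>A. U * A)))" by simp
  also have "\<dots> = (\<integral>A. f (U * A) \<partial>\<mu>)"
    by (rule integral_distr) (use f measurable_mult_const[OF U] in \<open>simp_all add: measurable_haar\<close>)
  finally show ?thesis by simp
qed

text \<open>Both sides are the two iterated integrals of \<open>f (y\<^sup>T x)\<close>.\<close>
lemma integral_transpose:
  fixes f :: "real mat \<Rightarrow> real"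
  assumes f: "f \<in> borel_measurable (orthogonal_borel N)"
    and B: "\<And>A. A \<in> orthogonal_group N \<Longrightarrow> \<bar>f A\<bar> \<le> B"
  shows "(\<integral>A. f (transpose_mat A) \<partial>\<mu>) = (\<integral>A. f A \<partial>\<mu>)"
proof -
  have m: "(\<lambda>(y, x). f (transpose_mat y * x)) \<in> borel_measurable (\<mu> \<Otimes>\<^sub>M \<mu>)"
    using f by measurable
  have ft: "(\<lambda>A. f (transpose_mat A)) \<in> borel_measurable (orthogonal_borel N)"
    using f by measurable
  have "(\<integral>A. f A \<partial>\<mu>) = (\<integral>y. (\<integral>x. f (transpose_mat y * x) \<partial>\<mu>) \<partial>\<mu>)"
  proof -
    have "(\<integral>y. (\<integral>x. f (transpose_mat y * x) \<partial>\<mu>) \<partial>\<mu>) = (\<integral>y. (\<integral>A. f A \<partial>\<mu>) \<partial>\<mu>)"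
      by (intro Bochner_Integration.integral_cong refl integral_left[OF _ f]) (simp add: orthogonal_group_transpose)
    then show ?thesis using prob_space by simp
  qed
  also have "\<dots> = (\<integral>x. (\<integral>y. f (transpose_mat y * x) \<partial>\<mu>) \<partial>\<mu>)"
    by (rule bounded_Fubini(1)[OF prob_space_axioms prob_space_axioms m, of B])
      (auto intro!: B orthogonal_group_mult orthogonal_group_transpose)
  also have "\<dots> = (\<integral>x. (\<integral>A. f (transpose_mat A) \<partial>\<mu>) \<partial>\<mu>)"
  proof (rule Bochner_Integration.integral_cong[OF refl])
    fix x assume "x \<in> space \<mu>"
    then have x: "x \<in> orthogonal_group N" by simp
    have "(\<integral>y. f (transpose_mat y * x) \<partial>\<mu>) = (\<integral>y. f (transpose_mat (transpose_mat x * y)) \<partial>\<mu>)"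
    proof (rule Bochner_Integration.integral_cong[OF refl])
      fix y assume "y \<in> space \<mu>"
      then have "y \<in> carrier_mat N N" using orthogonal_groupD by simp
      then show "f (transpose_mat y * x) = f (transpose_mat (transpose_mat x * y))"
        using orthogonal_groupD(1)[OF x] by (simp add: transpose_mult[of _ N N _ N])
    qed
    also have "\<dots> = (\<integral>A. f (transpose_mat A) \<partial>\<mu>)"
      by (rule integral_left[OF orthogonal_group_transpose[OF x] ft])
    finally show "(\<integral>y. f (transpose_mat y * x) \<partial>\<mu>) = (\<integral>A. f (transpose_mat A) \<partial>\<mu>)" .
  qed
  also have "\<dots> = (\<integral>A. f (transpose_mat A) \<partial>\<mu>)" using prob_space by simp
  finally show ?thesis by simp
qed

text \<open>\<open>is_haar\<close> speaks of left translations only; invariance under transposition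
  turns right multiplication by \<open>V\<close> into left multiplication by its transpose.\<close>

lemma integral_right:
  fixes f :: "real mat \<Rightarrow> real"
  assumes V: "V \<in> orthogonal_group N" and f: "f \<in> borel_measurable (orthogonal_borel N)"
    and B: "\<And>A. A \<in> orthogonal_group N \<Longrightarrow> \<bar>f A\<bar> \<le> B"
  shows "(\<integral>A. f (A * V) \<partial>\<mu>) = (\<integral>A. f A \<partial>\<mu>)"
proof -
  have ft: "(\<lambda>A. f (transpose_mat A)) \<in> borel_measurable (orthogonal_borel N)"
    using f by measurable
  have ftV: "(\<lambda>A. f (A * V)) \<in> borel_measurable (orthogonal_borel N)"
    using measurable_compose[OF measurable_mult_const(2)[OF V] f] by (simp add: measurable_haar)
  have "(\<integral>A. f (A * V) \<partial>\<mu>) = (\<integral>A. f (transpose_mat A * V) \<partial>\<mu>)"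
    using V B by (intro integral_transpose[symmetric, OF ftV, of B]) (auto intro: orthogonal_group_mult)
  also have "\<dots> = (\<integral>A. f (transpose_mat (transpose_mat V * A)) \<partial>\<mu>)"
  proof (rule Bochner_Integration.integral_cong[OF refl])
    fix y assume "y \<in> space \<mu>"
    then have "y \<in> carrier_mat N N" using orthogonal_groupD by simp
    then show "f (transpose_mat y * V) = f (transpose_mat (transpose_mat V * y))"
      using orthogonal_groupD(1)[OF V] by (simp add: transpose_mult[of _ N N _ N])
  qed
  also have "\<dots> = (\<integral>A. f (transpose_mat A) \<partial>\<mu>)"
    by (rule integral_left[OF orthogonal_group_transpose[OF V] ft])
  also have "\<dots> = (\<integral>A. f A \<partial>\<mu>)" by (rule integral_transpose[OF f B])
  finally show ?thesis .
qed

end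

lemma haarI: "is_haar N \<mu> \<Longrightarrow> haar \<mu> N"
  by (simp add: haar_def haar_axioms_def is_haar_def)

section \<open>Rotation identities\<close>

lemma DERIV_integral:
  fixes f f' :: "real \<Rightarrow> 'a \<Rightarrow> real"
  assumes M: "prob_space M"
    and int: "\<And>t. integrable M (f t)"
    and f': "f' t0 \<in> borel_measurable M"
    and D: "\<And>t x. x \<in> space M \<Longrightarrow> ((\<lambda>t. f t x) has_real_derivative f' t x) (at t)"
    and K: "\<And>t x. x \<in> space M \<Longrightarrow> \<bar>t - t0\<bar> \<le> 1 \<Longrightarrow> \<bar>f' t x\<bar> \<le> K"
  shows "((\<lambda>t. \<integral>x. f t x \<partial>M) has_real_derivative (\<integral>x. f' t0 x \<partial>M)) (at t0)"
  unfolding DERIV_def tendsto_at_iff_sequentially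
proof (intro allI impI)
  interpret prob_space M by fact
  fix h :: "nat \<Rightarrow> real"
  assume h0: "\<forall>i. h i \<in> UNIV - {0}" and h: "h \<longlonglongrightarrow> 0"
  have "eventually (\<lambda>n. \<bar>h n\<bar> < 1) sequentially"
    using tendstoD[OF h, of 1] by simp
  then obtain n0 where n0: "\<And>n. n \<ge> n0 \<Longrightarrow> \<bar>h n\<bar> < 1" by (auto simp: eventually_sequentially)
  \<comment> \<open>Dropping finitely many terms keeps every increment in [-1, 1], where the
    constant \<open>K\<close> dominates the difference quotients.\<close>
  define g where "g = (\<lambda>n. h (n + n0))"
  have g: "g \<longlonglongrightarrow> 0" and g0: "\<And>n. g n \<noteq> 0" and g1: "\<And>n. \<bar>g n\<bar> \<le> 1"
    using h h0 n0 unfolding g_def by (auto intro: LIMSEQ_ignore_initial_segment less_imp_le)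
  have "(\<lambda>n. \<integral>x. (f (t0 + g n) x - f t0 x) / g n \<partial>M) \<longlonglongrightarrow> (\<integral>x. f' t0 x \<partial>M)"
  proof (rule integral_dominated_convergence[where w = "\<lambda>_. K"])
    show "(\<lambda>x. (f (t0 + g n) x - f t0 x) / g n) \<in> borel_measurable M" for n
      using int by (intro borel_measurable_divide borel_measurable_diff) auto
    show "AE x in M. (\<lambda>n. (f (t0 + g n) x - f t0 x) / g n) \<longlonglongrightarrow> f' t0 x"
    proof (rule AE_I2)
      fix x assume "x \<in> space M"
      from D[OF this, of t0, unfolded DERIV_def tendsto_at_iff_sequentially] g g0
      show "(\<lambda>n. (f (t0 + g n) x - f t0 x) / g n) \<longlonglongrightarrow> f' t0 x"
        by (auto simp: comp_def)
    qed
    show "AE x in M. norm ((f (t0 + g n) x - f t0 x) / g n) \<le> K" for n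
    proof (rule AE_I2)
      fix x assume x: "x \<in> space M"
      have "norm (f (t0 + g n) x - f t0 x) \<le> K * norm ((t0 + g n) - t0)"
      proof (rule field_differentiable_bound[of "{t0 - 1..t0 + 1}" "\<lambda>t. f t x" "\<lambda>t. f' t x"])
        show "((\<lambda>t. f t x) has_real_derivative f' z x) (at z within {t0 - 1..t0 + 1})" for z
          using D[OF x] by (rule has_field_derivative_at_within)
        show "norm (f' z x) \<le> K" if "z \<in> {t0 - 1..t0 + 1}" for z
          using that K[OF x, of z] by (simp add: abs_le_iff)
      qed (use g1[of n] in auto)
      then show "norm ((f (t0 + g n) x - f t0 x) / g n) \<le> K"
        using g0[of n] by (simp add: divide_simps)
    qed
  qed (use f' in auto)
  moreover have "(\<integral>x. (f (t0 + g n) x - f t0 x) / g n \<partial>M) =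
      ((\<integral>x. f (t0 + g n) x \<partial>M) - (\<integral>x. f t0 x \<partial>M)) / g n" for n
    using int by (simp add: Bochner_Integration.integral_diff)
  ultimately have "(\<lambda>n. ((\<integral>x. f (t0 + g n) x \<partial>M) - (\<integral>x. f t0 x \<partial>M)) / g n) \<longlonglongrightarrow> (\<integral>x. f' t0 x \<partial>M)"
    by (simp only:)
  then show "((\<lambda>h. ((\<integral>x. f (t0 + h) x \<partial>M) - (\<integral>x. f t0 x \<partial>M)) / h) \<circ> h) \<longlonglongrightarrow> (\<integral>x. f' t0 x \<partial>M)"
    unfolding g_def comp_def by (rule LIMSEQ_offset)
qed

lemma ip_unit_unit: "i < N \<Longrightarrow> ip N (unit_fun i) (unit_fun j) = (if i = j then 1 else 0)"
  by (simp add: ip_unit_fun_left unit_fun_def)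

section \<open>The entries of U D U^T under motions of a coordinate plane\<close>

locale haar_signs = haar +
  fixes d :: "nat \<Rightarrow> real"
  assumes signs: "\<And>i. i < N \<Longrightarrow> d i \<in> {-1, 1}"
begin

definition q :: "nat \<Rightarrow> nat \<Rightarrow> real mat \<Rightarrow> real" where
  "q i j U = qf N d U (unit_fun i) (unit_fun j)"

lemma q_measurable [measurable]: "q i j \<in> borel_measurable (orthogonal_borel N)"
  unfolding q_def by (rule measurable_qf) simp_all

lemma abs_q_le:
  assumes "U \<in> orthogonal_group N" "i < N" "j < N"
  shows "\<bar>q i j U\<bar> \<le> 1"
  using abs_qf_le[OF assms(1) signs, where x = "unit_fun i" and y = "unit_fun j"] assms
  by (simp add: q_def ip_unit_fun_left unit_fun_def)

text \<open>Haar invariance covers all of O(N), so a circle of reflections serves as well as a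
  circle of rotations. A normal at angle \<theta>/4 gives a reflection matrix with entries in
  \<theta>/2, and conjugating J by it doubles the angle once more, to \<theta>.\<close>

lemma q_rotate:
  assumes U: "U \<in> orthogonal_group N" and ij: "i < N" "j < N" "i \<noteq> j"
  defines "w \<equiv> (\<lambda>\<theta> l. cos (\<theta> / 4) * unit_fun j l - sin (\<theta> / 4) * unit_fun i l)"
  shows "refl_mat N (w \<theta>) \<in> orthogonal_group N"
    and "q i i (refl_mat N (w \<theta>) * U) =
      (q i i U + q j j U) / 2 + (q i i U - q j j U) / 2 * cos \<theta> + q i j U * sin \<theta>"
    and "q i j (refl_mat N (w \<theta>) * U) = (q i i U - q j j U) / 2 * sin \<theta> - q i j U * cos \<theta>"
    and "\<And>k. k < N \<Longrightarrow> k \<noteq> i \<Longrightarrow> k \<noteq> j \<Longrightarrow> q k k (refl_mat N (w \<theta>) * U) = q k k U"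
proof -
  define c where "c = cos (\<theta> / 4)"
  define s where "s = sin (\<theta> / 4)"
  define c2 where "c2 = cos (\<theta> / 2)"
  define s2 where "s2 = sin (\<theta> / 2)"
  have cs: "c\<^sup>2 + s\<^sup>2 = 1" unfolding c_def s_def by simp
  have cs2: "c2\<^sup>2 + s2\<^sup>2 = 1" unfolding c2_def s2_def by simp
  have w: "w \<theta> = (\<lambda>l. c * unit_fun j l - s * unit_fun i l)" by (simp add: w_def c_def s_def)
  have c2: "c2 = c\<^sup>2 - s\<^sup>2" using cos_double[of "\<theta> / 4"] by (simp add: c_def s_def c2_def)
  have s2: "s2 = 2 * s * c" using sin_double[of "\<theta> / 4"] by (simp add: c_def s_def s2_def)
  have cos: "cos \<theta> = c2\<^sup>2 - s2\<^sup>2" using cos_double[of "\<theta> / 2"] by (simp add: c2_def s2_def)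
  have sin: "sin \<theta> = 2 * s2 * c2" using sin_double[of "\<theta> / 2"] by (simp add: c2_def s2_def)
  have wi: "ip N (w \<theta>) (unit_fun i) = - s" and wj: "ip N (w \<theta>) (unit_fun j) = c"
    unfolding w ip_linear using ij by (simp_all add: ip_unit_unit)
  have "ip N (w \<theta>) (w \<theta>) = c\<^sup>2 + s\<^sup>2"
    unfolding w ip_linear using ij by (simp add: ip_unit_unit power2_eq_square)
  then have ww: "ip N (w \<theta>) (w \<theta>) = 1" using cs by simp
  show "refl_mat N (w \<theta>) \<in> orthogonal_group N" using refl_mat_orthogonal[OF ww] by simp
  note r = qf_refl[OF orthogonal_groupD(1)[OF U], of d "w \<theta>"]
  have ei: "unit_fun i l - 2 * - s * w \<theta> l = c2 * unit_fun i l + s2 * unit_fun j l" for l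
  proof -
    have "unit_fun i l - 2 * - s * w \<theta> l = (1 - 2 * s\<^sup>2) * unit_fun i l + 2 * s * c * unit_fun j l"
      unfolding w by (simp add: algebra_simps power2_eq_square)
    also have "1 - 2 * s\<^sup>2 = c2" using cs c2 by simp
    finally show ?thesis using s2 by simp
  qed
  have ej: "unit_fun j l - 2 * c * w \<theta> l = s2 * unit_fun i l - c2 * unit_fun j l" for l
  proof -
    have "unit_fun j l - 2 * c * w \<theta> l = 2 * s * c * unit_fun i l - (2 * c\<^sup>2 - 1) * unit_fun j l"
      unfolding w by (simp add: algebra_simps power2_eq_square)
    also have "2 * c\<^sup>2 - 1 = c2" using cs c2 by simp
    finally show ?thesis using s2 by simp
  qed
  let ?A = "q i i U" and ?B = "q j j U" and ?C = "q i j U"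
  have c22: "c2\<^sup>2 = (1 + cos \<theta>) / 2" "s2\<^sup>2 = (1 - cos \<theta>) / 2" using cs2 cos by simp_all
  have "q i i (refl_mat N (w \<theta>) * U) = c2\<^sup>2 * ?A + 2 * s2 * c2 * ?C + s2\<^sup>2 * ?B"
    unfolding q_def r wi ei
    by (simp add: qf_linear qf_commute[of N d U "unit_fun j" "unit_fun i"] power2_eq_square algebra_simps)
  also have "\<dots> = (1 + cos \<theta>) / 2 * ?A + sin \<theta> * ?C + (1 - cos \<theta>) / 2 * ?B"
    unfolding c22 sin ..
  finally show "q i i (refl_mat N (w \<theta>) * U) =
      (q i i U + q j j U) / 2 + (q i i U - q j j U) / 2 * cos \<theta> + q i j U * sin \<theta>"
    by (simp add: field_simps)
  have "q i j (refl_mat N (w \<theta>) * U) = s2 * c2 * (?A - ?B) - (c2\<^sup>2 - s2\<^sup>2) * ?C"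
    unfolding q_def r wi wj ei ej
    by (simp add: qf_linear qf_commute[of N d U "unit_fun j" "unit_fun i"] power2_eq_square algebra_simps)
  then show "q i j (refl_mat N (w \<theta>) * U) = (q i i U - q j j U) / 2 * sin \<theta> - q i j U * cos \<theta>"
    unfolding cos sin by (simp add: field_simps)
  fix k assume k: "k < N" "k \<noteq> i" "k \<noteq> j"
  have wk: "ip N (w \<theta>) (unit_fun k) = 0"
    unfolding w ip_linear using ij k by (simp add: ip_unit_unit)
  show "q k k (refl_mat N (w \<theta>) * U) = q k k U" unfolding q_def r wk by simp
qed

text \<open>The derivative at angle \<open>0\<close> of the constant function \<open>\<theta> \<mapsto> E (q i j exp (s q k k + t q i i)) (R\<^sub>\<theta> U)\<close>.\<close>
lemma rotation_identity:
  assumes ij: "i < N" "j < N" "i \<noteq> j" and k: "k < N" "s = 0 \<or> k \<noteq> i \<and> k \<noteq> j"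
  shows "(\<integral>U. ((q i i U - q j j U) / 2 - t * (q i j U)\<^sup>2) * exp (s * q k k U + t * q i i U) \<partial>\<mu>) = 0"
proof -
  define p where "p = (\<lambda>U. (q i i U - q j j U) / 2)"
  define r where "r = (\<lambda>U. (q i i U + q j j U) / 2)"
  define e where "e = (\<lambda>\<theta> U. exp (s * q k k U + t * (r U + p U * cos \<theta> + q i j U * sin \<theta>)))"
  define f where "f = (\<lambda>\<theta> U. (p U * sin \<theta> - q i j U * cos \<theta>) * e \<theta> U)"
  define f' where "f' = (\<lambda>\<theta> U. (p U * cos \<theta> + q i j U * sin \<theta>) * e \<theta> U
    - t * (p U * sin \<theta> - q i j U * cos \<theta>)\<^sup>2 * e \<theta> U)"
  define g where "g = (\<lambda>U. q i j U * exp (s * q k k U + t * q i i U))"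
  have meas: "p \<in> borel_measurable \<mu>" "r \<in> borel_measurable \<mu>" "e \<theta> \<in> borel_measurable \<mu>"
    "f \<theta> \<in> borel_measurable \<mu>" "f' \<theta> \<in> borel_measurable \<mu>" for \<theta>
    unfolding p_def r_def e_def f_def f'_def by measurable
  have g: "g \<in> borel_measurable (orthogonal_borel N)" unfolding g_def by measurable
  have P: "\<bar>p U\<bar> \<le> 1" "\<bar>r U\<bar> \<le> 1" "\<bar>q i j U\<bar> \<le> 1" "\<bar>q k k U\<bar> \<le> 1" if "U \<in> space \<mu>" for U
  proof -
    have U: "U \<in> orthogonal_group N" using that by simp
    show "\<bar>p U\<bar> \<le> 1" "\<bar>r U\<bar> \<le> 1" "\<bar>q i j U\<bar> \<le> 1" "\<bar>q k k U\<bar> \<le> 1"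
      using abs_q_le[OF U ij(1) ij(1)] abs_q_le[OF U ij(2) ij(2)] abs_q_le[OF U ij(1) ij(2)]
        abs_q_le[OF U k(1) k(1)] unfolding p_def r_def by (simp_all add: abs_le_iff)
  qed
  define E where "E = exp (\<bar>s\<bar> + \<bar>t\<bar> * 3)"
  have pc: "\<bar>p U * x\<bar> \<le> 1" "\<bar>q i j U * x\<bar> \<le> 1" if "U \<in> space \<mu>" "\<bar>x\<bar> \<le> 1" for U x
    using P[OF that(1)] that(2) by (simp_all add: abs_mult mult_le_one)
  have e: "\<bar>e \<theta> U\<bar> \<le> E" if U: "U \<in> space \<mu>" for \<theta> U
  proof -
    have "\<bar>r U + p U * cos \<theta> + q i j U * sin \<theta>\<bar> \<le> 3"
      using P(2)[OF U] pc(1)[OF U, of "cos \<theta>"] pc(2)[OF U, of "sin \<theta>"] by simp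
    then have "\<bar>t * (r U + p U * cos \<theta> + q i j U * sin \<theta>)\<bar> \<le> \<bar>t\<bar> * 3"
      unfolding abs_mult by (intro mult_left_mono) auto
    moreover have "\<bar>s * q k k U\<bar> \<le> \<bar>s\<bar>" using P(4)[OF U] by (simp add: abs_mult mult_left_le)
    ultimately have "s * q k k U + t * (r U + p U * cos \<theta> + q i j U * sin \<theta>) \<le> \<bar>s\<bar> + \<bar>t\<bar> * 3"
      by linarith
    then show ?thesis by (simp add: e_def E_def)
  qed
  have E0: "E \<ge> 0" by (simp add: E_def)
  have ps: "\<bar>p U * sin \<theta> - q i j U * cos \<theta>\<bar> \<le> 2" "\<bar>p U * cos \<theta> + q i j U * sin \<theta>\<bar> \<le> 2"
    if U: "U \<in> space \<mu>" for \<theta> U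
    using pc(1)[OF U, of "cos \<theta>"] pc(2)[OF U, of "sin \<theta>"] pc(1)[OF U, of "sin \<theta>"] pc(2)[OF U, of "cos \<theta>"]
    by simp_all
  have D: "((\<lambda>\<theta>. f \<theta> U) has_real_derivative f' \<theta> U) (at \<theta>)" for \<theta> U
    unfolding f_def f'_def e_def
    by (rule derivative_eq_intros refl | simp add: algebra_simps power2_eq_square)+
  have "((\<lambda>\<theta>. \<integral>U. f \<theta> U \<partial>\<mu>) has_real_derivative (\<integral>U. f' 0 U \<partial>\<mu>)) (at 0)"
  proof (rule DERIV_integral[OF prob_space_axioms _ meas(5) D])
    fix \<theta>
    show "integrable \<mu> (f \<theta>)"
    proof (rule bounded_integrable[OF prob_space_axioms meas(4)])
      fix U assume U: "U \<in> space \<mu>"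
      show "\<bar>f \<theta> U\<bar> \<le> 2 * E" unfolding f_def abs_mult
        using ps(1)[OF U] e[OF U] E0 by (intro mult_mono) auto
    qed
    fix U assume U: "U \<in> space \<mu>"
    have "\<bar>(p U * cos \<theta> + q i j U * sin \<theta>) * e \<theta> U\<bar> \<le> 2 * E" unfolding abs_mult
      using ps(2)[OF U] e[OF U] E0 by (intro mult_mono) auto
    moreover have "\<bar>p U * sin \<theta> - q i j U * cos \<theta>\<bar>\<^sup>2 \<le> 2\<^sup>2"
      by (rule power_mono[OF ps(1)[OF U]]) simp
    then have "\<bar>t * (p U * sin \<theta> - q i j U * cos \<theta>)\<^sup>2 * e \<theta> U\<bar> \<le> \<bar>t\<bar> * 2\<^sup>2 * E"
      unfolding abs_mult power_abs
      using e[OF U] E0 by (intro mult_mono mult_nonneg_nonneg) auto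
    ultimately show "\<bar>f' \<theta> U\<bar> \<le> 2 * E + \<bar>t\<bar> * 2\<^sup>2 * E" unfolding f'_def by linarith
  qed
  moreover have "(\<integral>U. f \<theta> U \<partial>\<mu>) = (\<integral>U. g U \<partial>\<mu>)" for \<theta>
  proof -
    let ?w = "\<lambda>l. cos (\<theta> / 4) * unit_fun j l - sin (\<theta> / 4) * unit_fun i l"
    have "(\<integral>U. f \<theta> U \<partial>\<mu>) = (\<integral>U. g (refl_mat N ?w * U) \<partial>\<mu>)"
    proof (rule Bochner_Integration.integral_cong[OF refl])
      fix U assume "U \<in> space \<mu>"
      then have U: "U \<in> orthogonal_group N" by simp
      \<comment> \<open>Either the motion leaves coordinate \<open>k\<close> alone, or its weight
        \<open>s\<close> is 0.\<close>
      have sk: "s * q k k (refl_mat N ?w * U) = s * q k k U" using q_rotate(4)[OF U ij] k by auto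
      then show "f \<theta> U = g (refl_mat N ?w * U)"
        unfolding f_def g_def e_def p_def r_def q_rotate(2,3)[OF U ij] sk by simp
    qed
    also have "\<dots> = (\<integral>U. g U \<partial>\<mu>)"
    proof -
      have "1\<^sub>m N \<in> orthogonal_group N" by (rule orthogonal_group_one)
      from integral_left[OF q_rotate(1)[OF this ij] g] show ?thesis .
    qed
    finally show ?thesis .
  qed
  ultimately have "((\<lambda>\<theta>. \<integral>U. g U \<partial>\<mu>) has_real_derivative (\<integral>U. f' 0 U \<partial>\<mu>)) (at (0::real))" by simp
  then have "(\<integral>U. f' 0 U \<partial>\<mu>) = 0" using DERIV_unique[OF _ DERIV_const] by blast
  moreover have "f' 0 U = ((q i i U - q j j U) / 2 - t * (q i j U)\<^sup>2) * exp (s * q k k U + t * q i i U)" for U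
  proof -
    have "r U + p U = q i i U" by (simp add: r_def p_def field_simps)
    then show ?thesis by (simp add: f'_def e_def p_def left_diff_distrib)
  qed
  ultimately show ?thesis by simp
qed

text \<open>\<open>S\<close> collects the partners of \<open>i\<close> over whose planes the
  identity is summed. Taking all coordinates except \<open>i\<close>, or except \<open>i\<close> and
  \<open>k\<close>, turns the sums into a trace and a row norm, both known.\<close>

lemma sum_rotation_identity:
  assumes i: "i < N" and S: "S \<subseteq> {..<N} - {i}" and k: "k < N" "s = 0 \<or> k \<noteq> i \<and> k \<notin> S"
  shows "(\<integral>U. (real (card S) * q i i U - (\<Sum>j\<in>S. q j j U) - 2 * t * (\<Sum>j\<in>S. (q i j U)\<^sup>2)) *
    exp (s * q k k U + t * q i i U) \<partial>\<mu>) = 0"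
proof -
  let ?f = "\<lambda>j U. ((q i i U - q j j U) / 2 - t * (q i j U)\<^sup>2) * exp (s * q k k U + t * q i i U)"
  have int: "integrable \<mu> (?f j)" if "j \<in> S" for j
  proof (rule bounded_integrable[OF prob_space_axioms])
    have j: "j < N" using that S by auto
    show "?f j \<in> borel_measurable \<mu>" by measurable
    fix U assume "U \<in> space \<mu>"
    then have U: "U \<in> orthogonal_group N" by simp
    note b = abs_q_le[OF U i i] abs_q_le[OF U j j] abs_q_le[OF U i j] abs_q_le[OF U k(1) k(1)]
    have "\<bar>(q i i U - q j j U) / 2\<bar> \<le> 1" using b(1,2) by (simp add: abs_le_iff)
    moreover have "\<bar>t * (q i j U)\<^sup>2\<bar> \<le> \<bar>t\<bar> * 1"
      unfolding abs_mult using b(3) by (intro mult_left_mono) (auto simp: abs_square_le_1)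
    ultimately have 1: "\<bar>(q i i U - q j j U) / 2 - t * (q i j U)\<^sup>2\<bar> \<le> 1 + \<bar>t\<bar>" by linarith
    have "\<bar>s * q k k U\<bar> \<le> \<bar>s\<bar>" "\<bar>t * q i i U\<bar> \<le> \<bar>t\<bar>" using b by (simp_all add: abs_mult mult_left_le)
    then have 2: "s * q k k U + t * q i i U \<le> \<bar>s\<bar> + \<bar>t\<bar>" by linarith
    show "\<bar>?f j U\<bar> \<le> (1 + \<bar>t\<bar>) * exp (\<bar>s\<bar> + \<bar>t\<bar>)"
      unfolding abs_mult using 1 2 by (intro mult_mono) auto
  qed
  have "(\<integral>U. (\<Sum>j\<in>S. 2 * ?f j U) \<partial>\<mu>) = (\<Sum>j\<in>S. 2 * (\<integral>U. ?f j U \<partial>\<mu>))"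
    by (subst Bochner_Integration.integral_sum) (use int in auto)
  also have "\<dots> = 0"
  proof (intro sum.neutral ballI)
    fix j assume "j \<in> S"
    then have "(\<integral>U. ?f j U \<partial>\<mu>) = 0" by (intro rotation_identity) (use i S k in auto)
    then show "2 * (\<integral>U. ?f j U \<partial>\<mu>) = 0" by simp
  qed
  also have "(\<lambda>U. \<Sum>j\<in>S. 2 * ?f j U) = (\<lambda>U. (real (card S) * q i i U - (\<Sum>j\<in>S. q j j U)
      - 2 * t * (\<Sum>j\<in>S. (q i j U)\<^sup>2)) * exp (s * q k k U + t * q i i U))"
  proof
    fix U
    have "(\<Sum>j\<in>S. 2 * ?f j U) = (\<Sum>j\<in>S. (q i i U - q j j U - 2 * t * (q i j U)\<^sup>2) * exp (s * q k k U + t * q i i U))"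
      by (intro sum.cong refl) (simp add: field_simps)
    also have "\<dots> = (\<Sum>j\<in>S. q i i U - q j j U - 2 * t * (q i j U)\<^sup>2) * exp (s * q k k U + t * q i i U)"
      by (simp only: sum_distrib_right)
    also have "(\<Sum>j\<in>S. q i i U - q j j U - 2 * t * (q i j U)\<^sup>2) =
      real (card S) * q i i U - (\<Sum>j\<in>S. q j j U) - 2 * t * (\<Sum>j\<in>S. (q i j U)\<^sup>2)"
      by (simp add: sum_subtractf sum_distrib_left)
    finally show "(\<Sum>j\<in>S. 2 * ?f j U) = (real (card S) * q i i U - (\<Sum>j\<in>S. q j j U)
      - 2 * t * (\<Sum>j\<in>S. (q i j U)\<^sup>2)) * exp (s * q k k U + t * q i i U)" .
  qed
  finally show ?thesis .
qed

lemma sum_q_diag: "U \<in> orthogonal_group N \<Longrightarrow> (\<Sum>j<N. q j j U) = (\<Sum>i<N. d i)"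
  unfolding q_def by (rule sum_qf_unit_unit)

lemma sum_q_square:
  assumes "U \<in> orthogonal_group N" "i < N"
  shows "(\<Sum>j<N. (q i j U)\<^sup>2) = 1"
  using sum_qf_unit_square[OF assms(1) signs, where x = "unit_fun i"] assms(2)
  by (simp add: q_def qf_commute[of N d U "unit_fun i"] ip_unit_fun_left) (simp add: unit_fun_def)

text \<open>For t = N b, division by N gives m + 2b = <q> + 2b <q^2> for the tilted averages of q =
  J_ii, with m the mean of the signs. Up to the variance of q this is the quadratic equation whose
  root is \<open>rho\<close>.\<close>

lemma one_replica_identity:
  assumes i: "i < N"
  shows "(\<integral>U. ((\<Sum>l<N. d l) - N * q i i U + 2 * t * (1 - (q i i U)\<^sup>2)) * exp (t * q i i U) \<partial>\<mu>) = 0"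
proof -
  \<comment> \<open>The second weight is switched off by \<open>s = 0\<close>, and its coordinate is
    then filled with \<open>i\<close>.\<close>
  have "(\<integral>U. (real (card ({..<N} - {i})) * q i i U - (\<Sum>j\<in>{..<N} - {i}. q j j U)
      - 2 * t * (\<Sum>j\<in>{..<N} - {i}. (q i j U)\<^sup>2)) * exp (0 * q i i U + t * q i i U) \<partial>\<mu>) = 0"
    by (rule sum_rotation_identity) (use i in auto)
  also have "(\<integral>U. (real (card ({..<N} - {i})) * q i i U - (\<Sum>j\<in>{..<N} - {i}. q j j U)
      - 2 * t * (\<Sum>j\<in>{..<N} - {i}. (q i j U)\<^sup>2)) * exp (0 * q i i U + t * q i i U) \<partial>\<mu>) =
    (\<integral>U. - (((\<Sum>l<N. d l) - N * q i i U + 2 * t * (1 - (q i i U)\<^sup>2)) * exp (t * q i i U)) \<partial>\<mu>)"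
  proof (rule Bochner_Integration.integral_cong[OF refl])
    fix U assume "U \<in> space \<mu>"
    then have U: "U \<in> orthogonal_group N" by simp
    have 1: "(\<Sum>j\<in>{..<N} - {i}. q j j U) = (\<Sum>l<N. d l) - q i i U"
      using sum_q_diag[OF U] i by (simp add: sum_diff1)
    have 2: "(\<Sum>j\<in>{..<N} - {i}. (q i j U)\<^sup>2) = 1 - (q i i U)\<^sup>2"
      using sum_q_square[OF U i] i by (simp add: sum_diff1)
    have 3: "real (card ({..<N} - {i})) = real N - 1" using i by (simp add: of_nat_diff)
    show "(real (card ({..<N} - {i})) * q i i U - (\<Sum>j\<in>{..<N} - {i}. q j j U)
      - 2 * t * (\<Sum>j\<in>{..<N} - {i}. (q i j U)\<^sup>2)) * exp (0 * q i i U + t * q i i U) =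
      - (((\<Sum>l<N. d l) - N * q i i U + 2 * t * (1 - (q i i U)\<^sup>2)) * exp (t * q i i U))"
      unfolding 1 2 3 by (simp add: algebra_simps)
  qed
  finally show ?thesis by simp
qed

text \<open>The plane of \<open>i\<close> and \<open>k\<close> is left out, since moving in it would
  change the second weight. The price is one bounded term \<open>q k k\<close> against N, and the
  term in \<open>(q i k U)\<^sup>2\<close>, whose sign is favourable for an upper bound.\<close>

lemma two_replica_identity:
  assumes ik: "i < N" "k < N" "i \<noteq> k"
  shows "(\<integral>U. ((\<Sum>l<N. d l) - q k k U - (real N - 1) * q i i U + 2 * t * (1 - (q i k U)\<^sup>2 - (q i i U)\<^sup>2)) *
    exp (s * q k k U + t * q i i U) \<partial>\<mu>) = 0"
proof -
  let ?S = "{..<N} - {i} - {k}"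
  have "(\<integral>U. (real (card ?S) * q i i U - (\<Sum>j\<in>?S. q j j U)
      - 2 * t * (\<Sum>j\<in>?S. (q i j U)\<^sup>2)) * exp (s * q k k U + t * q i i U) \<partial>\<mu>) = 0"
    by (rule sum_rotation_identity) (use ik in auto)
  also have "(\<integral>U. (real (card ?S) * q i i U - (\<Sum>j\<in>?S. q j j U)
      - 2 * t * (\<Sum>j\<in>?S. (q i j U)\<^sup>2)) * exp (s * q k k U + t * q i i U) \<partial>\<mu>) =
    (\<integral>U. - (((\<Sum>l<N. d l) - q k k U - (real N - 1) * q i i U + 2 * t * (1 - (q i k U)\<^sup>2 - (q i i U)\<^sup>2)) *
      exp (s * q k k U + t * q i i U)) \<partial>\<mu>)"
  proof (rule Bochner_Integration.integral_cong[OF refl])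
    fix U assume "U \<in> space \<mu>"
    then have U: "U \<in> orthogonal_group N" by simp
    have 1: "(\<Sum>j\<in>?S. q j j U) = (\<Sum>l<N. d l) - q i i U - q k k U"
      using sum_q_diag[OF U] ik by (simp add: sum_diff1)
    have 2: "(\<Sum>j\<in>?S. (q i j U)\<^sup>2) = 1 - (q i i U)\<^sup>2 - (q i k U)\<^sup>2"
      using sum_q_square[OF U ik(1)] ik by (simp add: sum_diff1)
    have 3: "real (card ?S) = real N - 2" using ik by (simp add: of_nat_diff)
    show "(real (card ?S) * q i i U - (\<Sum>j\<in>?S. q j j U)
      - 2 * t * (\<Sum>j\<in>?S. (q i j U)\<^sup>2)) * exp (s * q k k U + t * q i i U) =
      - (((\<Sum>l<N. d l) - q k k U - (real N - 1) * q i i U + 2 * t * (1 - (q i k U)\<^sup>2 - (q i i U)\<^sup>2)) *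
        exp (s * q k k U + t * q i i U))"
      unfolding 1 2 3 by (simp add: algebra_simps)
  qed
  finally show ?thesis by simp
qed

end

section \<open>The Riccati equation for the annealed free energy\<close>

text \<open>The root (sqrt(1 + 8b(m + 2b)) - 1) / (4b) of 2b r^2 + r = m + 2b, rationalised so that
  b = 0 needs no separate treatment. With z = 2b it is the R-transform of the limiting two-point
  law.\<close>

definition rho :: "real \<Rightarrow> real \<Rightarrow> real" where
  "rho m b = 2 * (m + 2 * b) / (1 + sqrt (1 + 8 * b * (m + 2 * b)))"

definition Lam :: "real \<Rightarrow> real \<Rightarrow> real" where
  "Lam m b = integral {0..b} (rho m)"

text \<open>The worst case m = -1 gives the square (1 - 4b)^2.\<close>

lemma rho_disc_nonneg:
  fixes m b :: real
  assumes "\<bar>m\<bar> \<le> 1" "0 \<le> b"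
  shows "0 \<le> 1 + 8 * b * (m + 2 * b)"
proof -
  have "b * (- 1) \<le> b * m" using assms by (intro mult_left_mono) auto
  then have "(1 - 4 * b)\<^sup>2 \<le> 1 + 8 * b * (m + 2 * b)"
    by (simp add: power2_eq_square algebra_simps)
  then show ?thesis using zero_le_power2[of "1 - 4 * b"] by linarith
qed

lemma rho_root:
  assumes "\<bar>m\<bar> \<le> 1" "0 \<le> b"
  shows "2 * b * (rho m b)\<^sup>2 + rho m b = m + 2 * b"
proof -
  define x where "x = m + 2 * b"
  define s where "s = sqrt (1 + 8 * b * x)"
  have s2: "s\<^sup>2 = 1 + 8 * b * x" and s0: "s \<ge> 0"
    using rho_disc_nonneg[OF assms] by (simp_all add: s_def x_def)
  have r: "rho m b = 2 * x / (1 + s)" by (simp add: rho_def s_def x_def)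
  have "2 * b * (2 * x / (1 + s))\<^sup>2 + 2 * x / (1 + s) = (8 * b * x * x + 2 * x * (1 + s)) / (1 + s)\<^sup>2"
    using s0 by (simp add: divide_simps power2_eq_square)
  also have "8 * b * x * x + 2 * x * (1 + s) = x * (1 + s)\<^sup>2"
  proof -
    have "8 * b * x = s\<^sup>2 - 1" using s2 by simp
    then have "8 * b * x * x + 2 * x * (1 + s) = (s\<^sup>2 - 1) * x + 2 * x * (1 + s)" by simp
    then show ?thesis by (simp add: power2_eq_square algebra_simps)
  qed
  also have "x * (1 + s)\<^sup>2 / (1 + s)\<^sup>2 = x" using s0 by simp
  finally show ?thesis by (simp add: r x_def)
qed

lemma abs_rho_le:
  assumes "\<bar>m\<bar> \<le> 1" "0 \<le> b"
  shows "\<bar>rho m b\<bar> \<le> 1"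
proof -
  define x where "x = m + 2 * b"
  define s where "s = sqrt (1 + 8 * b * x)"
  have d: "0 \<le> 1 + 8 * b * x" using rho_disc_nonneg[OF assms] by (simp add: x_def)
  have s0: "s \<ge> 0" using d by (simp add: s_def)
  have "2 * \<bar>x\<bar> - 1 \<le> s" unfolding s_def
  proof (rule real_le_rsqrt)
    \<comment> \<open>This is the squared claim after cancellation; it holds because x lies between
      2b - 1 and 2b + 1.\<close>
    have "\<bar>x\<bar> * \<bar>x\<bar> \<le> \<bar>x\<bar> + 2 * b * x"
    proof (cases "x \<ge> 0")
      case True
      then have "x * x \<le> x * (1 + 2 * b)" using assms by (intro mult_left_mono) (auto simp: x_def)
      then show ?thesis using True by (simp add: algebra_simps)
    next
      case False
      then have "- x * - x \<le> - x * (1 - 2 * b)" using assms by (intro mult_left_mono) (auto simp: x_def)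
      then show ?thesis using False by (simp add: algebra_simps)
    qed
    then show "(2 * \<bar>x\<bar> - 1)\<^sup>2 \<le> 1 + 8 * b * x"
      by (simp add: power2_eq_square algebra_simps)
  qed
  then have "2 * \<bar>x\<bar> \<le> 1 + s" by simp
  then have "\<bar>2 * x / (1 + s)\<bar> \<le> 1" using s0 by (simp add: abs_mult)
  then show ?thesis by (simp add: rho_def s_def x_def)
qed

text \<open>Stability of the root: the defect of \<open>f\<close> factors as f - rho times 1 + 2b(f
  + rho). Since \<open>f\<close> and \<open>rho\<close> are at least -1, the second factor is at
  least 1/2 for b up to 1/8, which is where that bound originates.\<close>

lemma rho_compare:
  assumes m: "\<bar>m\<bar> \<le> 1" and b: "0 \<le> b" "b \<le> 1 / 8" and f: "\<bar>f\<bar> \<le> 1" and \<delta>: "0 \<le> \<delta>"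
  shows "2 * b * f\<^sup>2 + f - m - 2 * b \<le> \<delta> \<Longrightarrow> f - rho m b \<le> 2 * \<delta>"
    and "- \<delta> \<le> 2 * b * f\<^sup>2 + f - m - 2 * b \<Longrightarrow> rho m b - f \<le> 2 * \<delta>"
proof -
  define k where "k = 1 + 2 * b * (f + rho m b)"
  have "b * (f + rho m b) \<ge> b * (- 2)"
    using f abs_rho_le[OF m b(1)] b by (intro mult_left_mono) auto
  then have k: "k \<ge> 1 / 2" unfolding k_def using b by simp
  have e: "2 * b * f\<^sup>2 + f - m - 2 * b = (f - rho m b) * k"
    using rho_root[OF m b(1)] unfolding k_def by (simp add: power2_eq_square algebra_simps)
  have lower: "x \<le> 2 * \<delta>" if "x * k \<le> \<delta>" for x
  proof (cases "x \<le> 0")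
    case False
    then have "x * (1 / 2) \<le> x * k" using k by (intro mult_left_mono) auto
    then show ?thesis using that by simp
  qed (use \<delta> in simp)
  show "f - rho m b \<le> 2 * \<delta>" if "2 * b * f\<^sup>2 + f - m - 2 * b \<le> \<delta>"
    using that lower unfolding e by blast
  show "rho m b - f \<le> 2 * \<delta>" if "- \<delta> \<le> 2 * b * f\<^sup>2 + f - m - 2 * b"
    using that unfolding e by (intro lower) (simp add: left_diff_distrib)
qed

text \<open>The root for m', b' solves the equation for m, b up to an error linear in the
  differences, and \<open>rho_compare\<close> doubles it. One side suffices, since the two points
  may be exchanged.\<close>

lemma rho_Lipschitz:
  assumes m: "\<bar>m\<bar> \<le> 1" "\<bar>m'\<bar> \<le> 1" and b: "0 \<le> b" "b \<le> 1 / 8" "0 \<le> b'" "b' \<le> 1 / 8"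
  shows "rho m' b' - rho m b \<le> 4 * \<bar>b' - b\<bar> + 2 * \<bar>m' - m\<bar>"
proof -
  let ?r = "rho m' b'"
  have r: "\<bar>?r\<bar> \<le> 1" using abs_rho_le m b by blast
  then have r2: "\<bar>?r\<^sup>2 - 1\<bar> \<le> 1" using zero_le_power2[of ?r] by (simp add: abs_square_le_1 abs_le_iff)
  have "2 * b * ?r\<^sup>2 + ?r - m - 2 * b = 2 * ((b - b') * (?r\<^sup>2 - 1)) + (m' - m)"
    using rho_root[OF m(2) b(3)] by (simp add: algebra_simps)
  also have "\<dots> \<le> 2 * \<bar>b' - b\<bar> + \<bar>m' - m\<bar>"
  proof -
    have "(b - b') * (?r\<^sup>2 - 1) \<le> \<bar>b - b'\<bar> * \<bar>?r\<^sup>2 - 1\<bar>" by (metis abs_ge_self abs_mult)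
    also have "\<dots> \<le> \<bar>b - b'\<bar> * 1" using r2 by (intro mult_left_mono) auto
    finally have "(b - b') * (?r\<^sup>2 - 1) \<le> \<bar>b' - b\<bar>" by (simp add: abs_minus_commute)
    then show ?thesis by (intro add_mono mult_left_mono) auto
  qed
  finally show ?thesis
    using rho_compare(1)[OF m(1) b(1,2) r, of "2 * \<bar>b' - b\<bar> + \<bar>m' - m\<bar>"] by simp
qed

lemma continuous_on_rho:
  assumes "\<bar>m\<bar> \<le> 1"
  shows "continuous_on {0..} (rho m)"
proof -
  have "1 + sqrt (1 + 8 * b * (m + 2 * b)) \<noteq> 0" if "0 \<le> b" for b
    using real_sqrt_ge_zero[OF rho_disc_nonneg[OF assms that]] by linarith
  then show ?thesis unfolding rho_def by (intro continuous_intros) auto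
qed

lemma rho_integrable:
  "\<bar>m\<bar> \<le> 1 \<Longrightarrow> 0 \<le> a \<Longrightarrow> rho m integrable_on {a..b}"
  by (rule integrable_continuous_real) (rule continuous_on_subset[OF continuous_on_rho], auto)

lemma rho_has_integral:
  "\<bar>m\<bar> \<le> 1 \<Longrightarrow> (rho m has_integral Lam m b) {0..b}"
  unfolding Lam_def by (intro integrable_integral rho_integrable) auto

lemma Lam_diff:
  assumes "\<bar>m\<bar> \<le> 1" "0 \<le> a" "a \<le> b"
  shows "Lam m b - Lam m a = integral {a..b} (rho m)"
  unfolding Lam_def
  using Henstock_Kurzweil_Integration.integral_combine[OF assms(2,3) rho_integrable[OF assms(1)]] by simp

text \<open>\<open>rho\<close> is the derivative of \<open>Lam\<close> and is 4-Lipschitz in b, so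
  each of the two one-sided differences deviates from s rho(b) by at most 4 s^2. The bound 1/16 on b
  keeps b + s within 1/8.\<close>

lemma Lam_second_difference:
  assumes m: "\<bar>m\<bar> \<le> 1" and b: "0 \<le> s" "s \<le> b" "b \<le> 1 / 16"
  shows "Lam m (b + s) + Lam m (b - s) - 2 * Lam m b \<le> 8 * s\<^sup>2"
proof -
  have "Lam m (b + s) - Lam m b = integral {b..b + s} (rho m)"
    using m b by (intro Lam_diff) auto
  also have "\<dots> \<le> integral {b..b + s} (\<lambda>_. rho m b + 4 * s)"
  proof (rule integral_le)
    show "rho m integrable_on {b..b + s}" using m b by (intro rho_integrable) auto
    show "rho m x \<le> rho m b + 4 * s" if "x \<in> {b..b + s}" for x
      using rho_Lipschitz[OF m m, of b x] that b by simp
  qed auto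
  also have "\<dots> = s * (rho m b + 4 * s)" using b by simp
  finally have 1: "Lam m (b + s) - Lam m b \<le> s * (rho m b + 4 * s)" .
  have "s * (rho m b - 4 * s) = integral {b - s..b} (\<lambda>_. rho m b - 4 * s)" using b by simp
  also have "\<dots> \<le> integral {b - s..b} (rho m)"
  proof (rule integral_le)
    show "rho m integrable_on {b - s..b}" using m b by (intro rho_integrable) auto
    show "rho m b - 4 * s \<le> rho m x" if "x \<in> {b - s..b}" for x
      using rho_Lipschitz[OF m m, of x b] that b by simp
  qed auto
  also have "\<dots> = Lam m b - Lam m (b - s)" using m b by (intro Lam_diff[symmetric]) auto
  finally show ?thesis using 1 by (simp add: power2_eq_square algebra_simps)
qed

text \<open>Allows the mean of the signs at finite N to be replaced by its limit.\<close>

lemma Lam_Lipschitz_m: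
  assumes "\<bar>m\<bar> \<le> 1" "\<bar>m'\<bar> \<le> 1" "0 \<le> b" "b \<le> 1 / 8"
  shows "\<bar>Lam m' b - Lam m b\<bar> \<le> \<bar>m' - m\<bar>"
proof -
  have *: "Lam m2 b - Lam m1 b \<le> \<bar>m' - m\<bar>"
    if "\<bar>m1\<bar> \<le> 1" "\<bar>m2\<bar> \<le> 1" "\<bar>m2 - m1\<bar> = \<bar>m' - m\<bar>" for m1 m2
  proof -
    have "((\<lambda>x. rho m2 x - rho m1 x) has_integral (Lam m2 b - Lam m1 b)) {0..b}"
      using that by (intro has_integral_diff rho_has_integral)
    moreover have "((\<lambda>x. 2 * \<bar>m' - m\<bar>) has_integral (b * (2 * \<bar>m' - m\<bar>))) {0..b}"
      using has_integral_const_real[of "2 * \<bar>m' - m\<bar>" 0 b] assms by simp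
    ultimately have "Lam m2 b - Lam m1 b \<le> b * (2 * \<bar>m' - m\<bar>)"
    proof (rule has_integral_le)
      fix x assume "x \<in> {0..b}"
      then show "rho m2 x - rho m1 x \<le> 2 * \<bar>m' - m\<bar>"
        using rho_Lipschitz[OF that(1,2), of x x] assms that(3) by simp
    qed
    also have "\<dots> \<le> (1 / 2) * (2 * \<bar>m' - m\<bar>)" using assms by (intro mult_right_mono) auto
    finally show ?thesis by simp
  qed
  show ?thesis using *[of m m'] *[of m' m] assms by (simp add: abs_le_iff abs_minus_commute)
qed

section \<open>Tilted means of a bounded random variable\<close>

definition tilt :: "'a measure \<Rightarrow> ('a \<Rightarrow> real) \<Rightarrow> ('a \<Rightarrow> real) \<Rightarrow> real \<Rightarrow> nat \<Rightarrow> real \<Rightarrow> real" where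
  "tilt M X Y c k t = (\<integral>x. X x ^ k * exp (Y x + c * t * X x) \<partial>M)"

locale tilted = prob_space M for M :: "'a measure" +
  fixes X Y :: "'a \<Rightarrow> real" and c C :: real
  assumes X [measurable]: "X \<in> borel_measurable M" and Y [measurable]: "Y \<in> borel_measurable M"
    and X1: "\<And>x. x \<in> space M \<Longrightarrow> \<bar>X x\<bar> \<le> 1" and YC: "\<And>x. x \<in> space M \<Longrightarrow> \<bar>Y x\<bar> \<le> C"
begin

lemma weight_le: "x \<in> space M \<Longrightarrow> exp (Y x + c * t * X x) \<le> exp (C + \<bar>c\<bar> * \<bar>t\<bar>)"
proof -
  assume x: "x \<in> space M"
  have "c * t * X x \<le> \<bar>c * t * X x\<bar>" by simp
  also have "\<dots> \<le> \<bar>c\<bar> * \<bar>t\<bar> * 1" unfolding abs_mult using X1[OF x] by (intro mult_left_mono) auto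
  finally show ?thesis using YC[OF x] by simp
qed

lemma weighted_integrable:
  assumes g: "g \<in> borel_measurable M" "\<And>x. x \<in> space M \<Longrightarrow> \<bar>g x\<bar> \<le> B"
  shows "integrable M (\<lambda>x. g x * exp (Y x + c * t * X x))"
proof (rule bounded_integrable[OF prob_space_axioms])
  show "(\<lambda>x. g x * exp (Y x + c * t * X x)) \<in> borel_measurable M" using g(1) by measurable
  fix x assume x: "x \<in> space M"
  show "\<bar>g x * exp (Y x + c * t * X x)\<bar> \<le> B * exp (C + \<bar>c\<bar> * \<bar>t\<bar>)"
    unfolding abs_mult using weight_le[OF x, of t] g(2)[OF x] abs_ge_zero[of "g x"]
    by (intro mult_mono) (auto intro: order_trans)
qed

lemma abs_power_X_le: "x \<in> space M \<Longrightarrow> \<bar>X x ^ k\<bar> \<le> 1"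
  using X1 by (simp add: power_abs power_le_one)

lemma tilt_integrable: "integrable M (\<lambda>x. X x ^ k * exp (Y x + c * t * X x))"
  by (rule weighted_integrable[of _ 1]) (use abs_power_X_le in auto)

lemma tilt_DERIV: "(tilt M X Y c k has_real_derivative c * tilt M X Y c (Suc k) t) (at t)"
proof -
  let ?f' = "\<lambda>t x. c * (X x ^ Suc k * exp (Y x + c * t * X x))"
  have "((\<lambda>t. \<integral>x. X x ^ k * exp (Y x + c * t * X x) \<partial>M) has_real_derivative (\<integral>x. ?f' t x \<partial>M)) (at t)"
  proof (rule DERIV_integral[OF prob_space_axioms])
    show "integrable M (\<lambda>x. X x ^ k * exp (Y x + c * s * X x))" for s by (rule tilt_integrable)
    show "?f' t \<in> borel_measurable M" by measurable
    show "((\<lambda>t. X x ^ k * exp (Y x + c * t * X x)) has_real_derivative ?f' s x) (at s)" for s x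
      by (auto intro!: derivative_eq_intros)
    fix s x assume x: "x \<in> space M" and s: "\<bar>s - t\<bar> \<le> 1"
    have "\<bar>X x ^ Suc k * exp (Y x + c * s * X x)\<bar> \<le> 1 * exp (C + \<bar>c\<bar> * (\<bar>t\<bar> + 1))"
      unfolding abs_mult
    proof (intro mult_mono)
      have "\<bar>c\<bar> * \<bar>s\<bar> \<le> \<bar>c\<bar> * (\<bar>t\<bar> + 1)" using s by (intro mult_left_mono) auto
      then have "exp (C + \<bar>c\<bar> * \<bar>s\<bar>) \<le> exp (C + \<bar>c\<bar> * (\<bar>t\<bar> + 1))" by simp
      then show "\<bar>exp (Y x + c * s * X x)\<bar> \<le> exp (C + \<bar>c\<bar> * (\<bar>t\<bar> + 1))"
        unfolding abs_exp_cancel by (rule order_trans[OF weight_le[OF x]])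
    qed (use abs_power_X_le[OF x, of "Suc k"] in auto)
    then show "\<bar>?f' s x\<bar> \<le> \<bar>c\<bar> * (1 * exp (C + \<bar>c\<bar> * (\<bar>t\<bar> + 1)))"
      unfolding abs_mult[of c] by (rule mult_left_mono) simp
  qed
  then show ?thesis unfolding tilt_def by simp
qed

lemma tilt_0_pos: "tilt M X Y c 0 t > 0"
proof -
  have "(\<integral>x. exp (- C - \<bar>c\<bar> * \<bar>t\<bar>) \<partial>M) \<le> tilt M X Y c 0 t" unfolding tilt_def
  proof (rule integral_mono[OF _ tilt_integrable])
    fix x assume x: "x \<in> space M"
    have "- (c * t * X x) \<le> \<bar>c * t * X x\<bar>" by simp
    also have "\<dots> \<le> \<bar>c\<bar> * \<bar>t\<bar> * 1" unfolding abs_mult using X1[OF x] by (intro mult_left_mono) auto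
    finally show "exp (- C - \<bar>c\<bar> * \<bar>t\<bar>) \<le> X x ^ 0 * exp (Y x + c * t * X x)" using YC[OF x] by simp
  qed simp
  then have "exp (- C - \<bar>c\<bar> * \<bar>t\<bar>) \<le> tilt M X Y c 0 t" using prob_space by simp
  then show ?thesis by (rule less_le_trans[OF exp_gt_zero])
qed

lemma tilt_mean_le:
  assumes g: "g \<in> borel_measurable M" "\<And>x. x \<in> space M \<Longrightarrow> \<bar>g x\<bar> \<le> 1"
  shows "\<bar>(\<integral>x. g x * exp (Y x + c * t * X x) \<partial>M) / tilt M X Y c 0 t\<bar> \<le> 1"
proof -
  have "\<bar>\<integral>x. g x * exp (Y x + c * t * X x) \<partial>M\<bar> \<le> (\<integral>x. \<bar>g x * exp (Y x + c * t * X x)\<bar> \<partial>M)"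
    by (rule integral_abs_bound)
  also have "\<dots> \<le> tilt M X Y c 0 t" unfolding tilt_def
  proof (rule integral_mono[OF _ tilt_integrable])
    show "integrable M (\<lambda>x. \<bar>g x * exp (Y x + c * t * X x)\<bar>)"
      using weighted_integrable[OF g] by (rule integrable_abs)
    fix x assume x: "x \<in> space M"
    show "\<bar>g x * exp (Y x + c * t * X x)\<bar> \<le> X x ^ 0 * exp (Y x + c * t * X x)"
      unfolding abs_mult using g(2)[OF x] by (intro mult_mono) auto
  qed
  finally show ?thesis using tilt_0_pos[of t] by simp
qed

definition mean :: "real \<Rightarrow> real" where "mean t = tilt M X Y c 1 t / tilt M X Y c 0 t"

definition second :: "real \<Rightarrow> real" where "second t = tilt M X Y c 2 t / tilt M X Y c 0 t"

lemma abs_mean_le: "\<bar>mean t\<bar> \<le> 1"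
  using tilt_mean_le[of X t] X1 by (simp add: mean_def tilt_def)

lemma mean_square_le: "(mean t)\<^sup>2 \<le> second t"
proof -
  let ?Z = "tilt M X Y c 0 t" and ?W = "tilt M X Y c 1 t" and ?V = "tilt M X Y c 2 t"
  have "0 \<le> (\<integral>x. (X x - mean t)\<^sup>2 * exp (Y x + c * t * X x) \<partial>M)" by (rule Bochner_Integration.integral_nonneg) simp
  also have "\<dots> = (\<integral>x. X x ^ 2 * exp (Y x + c * t * X x) - 2 * mean t * (X x ^ 1 * exp (Y x + c * t * X x))
      + (mean t)\<^sup>2 * (X x ^ 0 * exp (Y x + c * t * X x)) \<partial>M)"
    by (intro Bochner_Integration.integral_cong refl) (simp add: power2_eq_square algebra_simps)
  also have "\<dots> = ?V - 2 * mean t * ?W + (mean t)\<^sup>2 * ?Z"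
    unfolding tilt_def using tilt_integrable[of 0 t] tilt_integrable[of 1 t] tilt_integrable[of 2 t]
    by (simp add: Bochner_Integration.integral_add Bochner_Integration.integral_diff)
  finally have "0 \<le> (?V - 2 * mean t * ?W + (mean t)\<^sup>2 * ?Z) / ?Z"
    using tilt_0_pos[of t] by simp
  also have "\<dots> = second t - (mean t)\<^sup>2"
    using tilt_0_pos[of t]
    by (simp add: add_divide_distrib diff_divide_distrib second_def) (simp add: mean_def power2_eq_square)
  finally show ?thesis by simp
qed

lemma ln_tilt_DERIV: "((\<lambda>t. ln (tilt M X Y c 0 t)) has_real_derivative c * mean t) (at t)"
  using DERIV_chain2[OF DERIV_ln[OF tilt_0_pos] tilt_DERIV[of 0 t]]
  by (simp add: mean_def field_simps)

text \<open>The mean moves at \<open>c\<close> times the variance but stays in [-1, 1], so the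
  variance integrated over t is only of order 1/c. This keeps the variance term of the Riccati
  equation harmless.\<close>

lemma mean_DERIV: "(mean has_real_derivative c * (second t - (mean t)\<^sup>2)) (at t)"
proof -
  have "(mean has_real_derivative ((c * tilt M X Y c 2 t * tilt M X Y c 0 t -
      tilt M X Y c 1 t * (c * tilt M X Y c 1 t)) / (tilt M X Y c 0 t * tilt M X Y c 0 t))) (at t)"
    unfolding mean_def
    using DERIV_divide[OF tilt_DERIV[of 1 t] tilt_DERIV[of 0 t]] tilt_0_pos[of t]
    by (simp add: numeral_2_eq_2)
  also have "(c * tilt M X Y c 2 t * tilt M X Y c 0 t -
      tilt M X Y c 1 t * (c * tilt M X Y c 1 t)) / (tilt M X Y c 0 t * tilt M X Y c 0 t) =
      c * (second t - (mean t)\<^sup>2)"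
    using tilt_0_pos[of t] by (simp add: second_def mean_def field_simps power2_eq_square)
  finally show ?thesis .
qed

lemma ln_tilt_has_integral:
  "0 \<le> b \<Longrightarrow> ((\<lambda>t. c * mean t) has_integral (ln (tilt M X Y c 0 b) - ln (tilt M X Y c 0 0))) {0..b}"
  by (rule fundamental_theorem_of_calculus)
    (auto simp flip: has_real_derivative_iff_has_vector_derivative intro: has_field_derivative_at_within ln_tilt_DERIV)

lemma mean_has_integral:
  "0 \<le> b \<Longrightarrow> ((\<lambda>t. c * (second t - (mean t)\<^sup>2)) has_integral (mean b - mean 0)) {0..b}"
  by (rule fundamental_theorem_of_calculus)
    (auto simp flip: has_real_derivative_iff_has_vector_derivative intro: has_field_derivative_at_within mean_DERIV)

end

section \<open>Exponential moments of one and of two diagonal entries\<close>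

context haar_signs
begin

lemma prob_group: "measure \<mu> (orthogonal_group N) = 1"
  using prob_space by simp

definition sign_mean :: real where "sign_mean = (\<Sum>i<N. d i) / N"

lemma abs_sign_mean_le: "\<bar>sign_mean\<bar> \<le> 1"
proof (cases "N = 0")
  case False
  have "\<bar>\<Sum>i<N. d i\<bar> \<le> (\<Sum>i<N. 1)"
    by (rule order_trans[OF sum_abs], rule sum_mono) (use signs in force)
  then show ?thesis using False by (simp add: sign_mean_def)
next
  case True
  have "sign_mean = 0" unfolding sign_mean_def using True by simp
  then show ?thesis by simp
qed

text \<open>The tilted mean is the derivative of the logarithm divided by N. By the one-replica
  identity its defect in the equation of \<open>rho\<close> is -2t times the variance: the sign
  gives the upper bound at once, and the size, integrated by \<open>mean_has_integral\<close>, costs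
  only a factor exp(-1) in the lower bound.\<close>

lemma one_replica_bounds:
  fixes b :: real
  assumes k: "k < N" and b: "0 \<le> b" "b \<le> 1 / 8"
  shows "(\<integral>U. exp (N * b * q k k U) \<partial>\<mu>) \<le> exp (N * Lam sign_mean b)"
    and "exp (N * Lam sign_mean b - 1) \<le> (\<integral>U. exp (N * b * q k k U) \<partial>\<mu>)"
proof -
  have N: "0 < N" using k by simp
  interpret T: tilted \<mu> "q k k" "\<lambda>_. 0" "real N" 0
    by unfold_locales (use abs_q_le k in \<open>auto simp: measurable_haar\<close>)
  let ?Z = "tilt \<mu> (q k k) (\<lambda>_. 0) (real N) 0"
  have Z: "?Z t = (\<integral>U. exp (N * t * q k k U) \<partial>\<mu>)" for t :: real by (simp add: tilt_def)
  have Z0: "?Z 0 = 1" by (simp add: tilt_def prob_group)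
  have id: "2 * t * (T.mean t)\<^sup>2 + T.mean t - sign_mean - 2 * t = - (2 * t * (T.second t - (T.mean t)\<^sup>2))" for t
  proof -
    let ?e = "\<lambda>U. exp (0 + N * t * q k k U)"
    have S: "(\<Sum>i<N. d i) = N * sign_mean" using N by (simp add: sign_mean_def)
    have "0 = (\<integral>U. N * ((sign_mean + 2 * t) * (q k k U ^ 0 * ?e U) - (q k k U ^ 1 * ?e U) - 2 * t * (q k k U ^ 2 * ?e U)) \<partial>\<mu>)"
      using one_replica_identity[OF k, of "N * t"] unfolding S by (simp add: algebra_simps)
    also have "\<dots> = N * ((sign_mean + 2 * t) * ?Z t - tilt \<mu> (q k k) (\<lambda>_. 0) (real N) 1 t
        - 2 * t * tilt \<mu> (q k k) (\<lambda>_. 0) (real N) 2 t)"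
      unfolding tilt_def using T.tilt_integrable[of 0 t] T.tilt_integrable[of 1 t] T.tilt_integrable[of 2 t]
      by (simp add: Bochner_Integration.integral_diff)
    finally have "((sign_mean + 2 * t) * ?Z t - tilt \<mu> (q k k) (\<lambda>_. 0) (real N) 1 t
        - 2 * t * tilt \<mu> (q k k) (\<lambda>_. 0) (real N) 2 t) / ?Z t = 0" using N by simp
    then have "sign_mean + 2 * t - T.mean t - 2 * t * T.second t = 0"
      using T.tilt_0_pos[of t] by (simp add: diff_divide_distrib T.mean_def T.second_def del: One_nat_def)
    then show ?thesis by (simp add: algebra_simps)
  qed
  have "ln (?Z b) - ln (?Z 0) \<le> N * Lam sign_mean b"
  proof (rule has_integral_le[OF T.ln_tilt_has_integral[OF b(1)]])
    show "((\<lambda>t. N * rho sign_mean t) has_integral N * Lam sign_mean b) {0..b}"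
      by (rule has_integral_mult_right[OF rho_has_integral[OF abs_sign_mean_le]])
    fix t assume t: "t \<in> {0..b}"
    then have "2 * t * (T.mean t)\<^sup>2 + T.mean t - sign_mean - 2 * t \<le> 0"
      unfolding id using T.mean_square_le[of t] by simp
    then have "T.mean t - rho sign_mean t \<le> 2 * 0"
      by (rule rho_compare(1)[OF abs_sign_mean_le _ _ T.abs_mean_le, rotated -1]) (use t b in auto)
    then show "N * T.mean t \<le> N * rho sign_mean t" by (simp add: mult_left_mono)
  qed
  then have "ln (?Z b) \<le> N * Lam sign_mean b" by (simp add: Z0)
  then have "exp (ln (?Z b)) \<le> exp (N * Lam sign_mean b)" by simp
  then show "(\<integral>U. exp (N * b * q k k U) \<partial>\<mu>) \<le> exp (N * Lam sign_mean b)"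
    using T.tilt_0_pos[of b] unfolding Z by simp
  \<comment> \<open>For t up to 1/8 the mean falls short of \<open>rho\<close> by at most 4t, hence
    1/2, times the variance; N times the variance is the derivative of the mean.\<close>
  have "N * Lam sign_mean b - (ln (?Z b) - ln (?Z 0)) \<le> (1 / 2) * (T.mean b - T.mean 0)"
  proof (rule has_integral_le)
    show "((\<lambda>t. N * rho sign_mean t - N * T.mean t) has_integral (N * Lam sign_mean b - (ln (?Z b) - ln (?Z 0)))) {0..b}"
      by (intro has_integral_diff has_integral_mult_right rho_has_integral abs_sign_mean_le
          T.ln_tilt_has_integral b(1))
    show "((\<lambda>t. (1 / 2) * (N * (T.second t - (T.mean t)\<^sup>2))) has_integral (1 / 2) * (T.mean b - T.mean 0)) {0..b}"
      by (intro has_integral_mult_right T.mean_has_integral b(1))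
    fix t assume t: "t \<in> {0..b}"
    let ?v = "T.second t - (T.mean t)\<^sup>2"
    have v: "0 \<le> ?v" using T.mean_square_le[of t] by simp
    have "rho sign_mean t - T.mean t \<le> 2 * (2 * t * ?v)"
      by (rule rho_compare(2)[OF abs_sign_mean_le _ _ T.abs_mean_le]) (use t b v id[of t] in auto)
    also have "\<dots> = (4 * t) * ?v" by simp
    also have "\<dots> \<le> (1 / 2) * ?v" using t b v by (intro mult_right_mono) auto
    finally have "N * (rho sign_mean t - T.mean t) \<le> N * ((1 / 2) * ?v)" by (rule mult_left_mono) simp
    then show "N * rho sign_mean t - N * T.mean t \<le> (1 / 2) * (N * ?v)" by (simp add: algebra_simps)
  qed
  also have "\<dots> \<le> 1" using T.abs_mean_le[of b] T.abs_mean_le[of 0] by (simp add: abs_le_iff)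
  finally have "N * Lam sign_mean b - 1 \<le> ln (?Z b)" by (simp add: Z0)
  then have "exp (N * Lam sign_mean b - 1) \<le> exp (ln (?Z b))" by simp
  then show "exp (N * Lam sign_mean b - 1) \<le> (\<integral>U. exp (N * b * q k k U) \<partial>\<mu>)"
    using T.tilt_0_pos[of b] unfolding Z by simp
qed

text \<open>The first replica is frozen at weight \<open>a\<close> and the second is switched on
  from 0 to \<open>b\<close>, starting from the one-replica bound. The terms coming from the omitted
  plane spoil the Riccati inequality by 2/N only, which adds at most 4b to the logarithm.\<close>

lemma two_replica_bound:
  fixes a b :: real
  assumes ik: "i < N" "k < N" "i \<noteq> k" and a: "0 \<le> a" "a \<le> 1 / 8" and b: "0 \<le> b" "b \<le> 1 / 8"
  shows "(\<integral>U. exp (real N * (a * q k k U + b * q i i U)) \<partial>\<mu>) \<le> exp (real N * (Lam sign_mean a + Lam sign_mean b) + 1)"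
proof -
  have N: "0 < N" using ik by simp
  let ?Y = "\<lambda>U. real N * a * q k k U"
  interpret T: tilted \<mu> "q i i" ?Y "real N" "real N * a"
  proof unfold_locales
    show "?Y \<in> borel_measurable \<mu>" "q i i \<in> borel_measurable \<mu>" by measurable
    fix U assume "U \<in> space \<mu>"
    then have U: "U \<in> orthogonal_group N" by simp
    show "\<bar>q i i U\<bar> \<le> 1" using abs_q_le[OF U ik(1) ik(1)] by simp
    have "\<bar>real N * a\<bar> * \<bar>q k k U\<bar> \<le> \<bar>real N * a\<bar> * 1"
      using abs_q_le[OF U ik(2) ik(2)] by (intro mult_left_mono) auto
    then show "\<bar>?Y U\<bar> \<le> real N * a" using a by (simp add: abs_mult)
  qed
  let ?I = "tilt \<mu> (q i i) ?Y (real N)"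
  let ?Z = "?I 0"
  have Z: "?Z t = (\<integral>U. exp (real N * (a * q k k U + t * q i i U)) \<partial>\<mu>)" for t
    by (simp add: tilt_def algebra_simps)
  have Z0: "?Z 0 \<le> exp (real N * Lam sign_mean a)"
    using one_replica_bounds(1)[OF ik(2) a] unfolding Z by (simp add: mult.assoc)
  have ineq: "2 * t * (T.mean t)\<^sup>2 + T.mean t - sign_mean - 2 * t \<le> 2 / N" if t: "0 \<le> t" for t
  proof -
    let ?e = "\<lambda>U. exp (?Y U + real N * t * q i i U)"
    let ?A = "\<integral>U. q k k U * ?e U \<partial>\<mu>" and ?C = "\<integral>U. (q i k U)\<^sup>2 * ?e U \<partial>\<mu>"
    have S: "(\<Sum>i<N. d i) = real N * sign_mean" using N by (simp add: sign_mean_def)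
    have qA: "q k k \<in> borel_measurable \<mu>" "\<And>U. U \<in> space \<mu> \<Longrightarrow> \<bar>q k k U\<bar> \<le> 1"
      using abs_q_le[of _ k k] ik by (simp_all add: measurable_haar q_measurable)
    have qC: "(\<lambda>U. (q i k U)\<^sup>2) \<in> borel_measurable \<mu>" "\<And>U. U \<in> space \<mu> \<Longrightarrow> \<bar>(q i k U)\<^sup>2\<bar> \<le> 1"
      using abs_q_le[of _ i k] ik by (measurable, simp add: abs_square_le_1)
    note iA = T.weighted_integrable[OF qA, of t] and iC = T.weighted_integrable[OF qC, of t]
    have "0 = (\<integral>U. real N * (sign_mean + 2 * t) * (q i i U ^ 0 * ?e U) - q k k U * ?e U - (real N - 1) * (q i i U ^ 1 * ?e U)
        - 2 * real N * t * ((q i k U)\<^sup>2 * ?e U) - 2 * real N * t * (q i i U ^ 2 * ?e U) \<partial>\<mu>)"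
      using two_replica_identity[OF ik, of "real N * t" "real N * a"] N unfolding S by (simp add: algebra_simps)
    also have "\<dots> = real N * (sign_mean + 2 * t) * ?Z t - ?A - (real N - 1) * ?I 1 t - 2 * real N * t * ?C - 2 * real N * t * ?I 2 t"
      unfolding tilt_def using T.tilt_integrable[of 0 t] T.tilt_integrable[of 1 t] T.tilt_integrable[of 2 t] iA iC
      by (simp add: Bochner_Integration.integral_diff)
    finally have "0 = (real N * (sign_mean + 2 * t) * ?Z t - ?A - (real N - 1) * ?I 1 t - 2 * real N * t * ?C - 2 * real N * t * ?I 2 t) / ?Z t"
      by simp
    then have e: "0 = real N * (sign_mean + 2 * t) - ?A / ?Z t - (real N - 1) * T.mean t - 2 * real N * t * (?C / ?Z t) - 2 * real N * t * T.second t"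
      using T.tilt_0_pos[of t] by (simp add: diff_divide_distrib T.mean_def T.second_def del: One_nat_def)
    have "0 \<le> ?C" by (rule Bochner_Integration.integral_nonneg) simp
    then have C: "0 \<le> 2 * real N * t * (?C / ?Z t)" using t T.tilt_0_pos[of t] by simp
    have "2 * real N * t * (T.mean t)\<^sup>2 \<le> 2 * real N * t * T.second t"
      using t T.mean_square_le[of t] by (intro mult_left_mono) auto
    moreover have "- 1 \<le> ?A / ?Z t" using abs_le_D2[OF T.tilt_mean_le[OF qA, of t]] by linarith
    moreover have "T.mean t \<le> 1" using T.abs_mean_le[of t] by (simp add: abs_le_iff)
    ultimately have "real N * (2 * t * (T.mean t)\<^sup>2 + T.mean t - sign_mean - 2 * t) \<le> 2"
      using e C by (simp add: algebra_simps)
    then show ?thesis using N by (simp add: field_simps)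
  qed
  have "ln (?Z b) - ln (?Z 0) \<le> real N * Lam sign_mean b + 4 * b"
  proof (rule has_integral_le[OF T.ln_tilt_has_integral[OF b(1)]])
    show "((\<lambda>t. real N * rho sign_mean t + 4) has_integral (real N * Lam sign_mean b + 4 * b)) {0..b}"
      using has_integral_const_real[of "4 :: real" 0 b] b
      by (intro has_integral_add has_integral_mult_right rho_has_integral abs_sign_mean_le) (simp add: mult.commute)
    fix t assume t: "t \<in> {0..b}"
    have "T.mean t - rho sign_mean t \<le> 2 * (2 / N)"
      by (rule rho_compare(1)[OF abs_sign_mean_le _ _ T.abs_mean_le _ ineq]) (use t b in auto)
    then show "real N * T.mean t \<le> real N * rho sign_mean t + 4" using N by (simp add: field_simps)
  qed
  also have "\<dots> \<le> real N * Lam sign_mean b + 1" using b by simp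
  finally have "ln (?Z b) \<le> ln (?Z 0) + (real N * Lam sign_mean b + 1)" by simp
  then have "exp (ln (?Z b)) \<le> exp (ln (?Z 0)) * exp (real N * Lam sign_mean b + 1)"
    unfolding exp_add[symmetric] by simp
  then have "?Z b \<le> ?Z 0 * exp (real N * Lam sign_mean b + 1)" using T.tilt_0_pos by simp
  also have "\<dots> \<le> exp (real N * Lam sign_mean a) * exp (real N * Lam sign_mean b + 1)" using Z0 by (intro mult_right_mono) auto
  also have "\<dots> = exp (real N * (Lam sign_mean a + Lam sign_mean b) + 1)" by (simp add: exp_add[symmetric] algebra_simps)
  finally show ?thesis by (simp add: Z)
qed

end

section \<open>Moments of the partition function\<close>

text \<open>Extensional functions, so that sums over configurations factorise through
  \<open>prod_sum_PiE\<close>.\<close>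

definition spins :: "nat \<Rightarrow> (nat \<Rightarrow> real) set" where
  "spins N = PiE {..<N} (\<lambda>_. {-1, 1})"

definition Zf :: "nat \<Rightarrow> (nat \<Rightarrow> real) \<Rightarrow> real \<Rightarrow> real mat \<Rightarrow> real" where
  "Zf N d \<beta> U = (1 / 2 ^ N) * (\<Sum>x\<in>spins N. exp (\<beta> * qf N d U x x))"

lemma finite_spins [simp]: "finite (spins N)"
  by (simp add: spins_def finite_PiE)

lemma card_spins: "card (spins N) = 2 ^ N"
  by (simp add: spins_def card_PiE numeral_2_eq_2)

lemma spinsD: "x \<in> spins N \<Longrightarrow> i < N \<Longrightarrow> x i = - 1 \<or> x i = 1"
  by (auto simp: spins_def PiE_iff)

lemma spins_square: "x \<in> spins N \<Longrightarrow> i < N \<Longrightarrow> x i * x i = 1"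
  using spinsD by fastforce

lemma ip_spins: "x \<in> spins N \<Longrightarrow> ip N x x = N"
  by (simp add: ip_def spins_square)

lemma Z_ROM_eq_Zf:
  assumes U: "U \<in> carrier_mat N N"
  shows "Z_ROM N \<beta> U (mat_diag N d) = Zf N d \<beta> U"
proof -
  have bij: "bij_betw (\<lambda>x. vec N x) (spins N) (spin_configs N)"
  proof (rule bij_betwI[where g = "\<lambda>v. restrict (vec_index v) {..<N}"])
    show "vec N \<in> spins N \<rightarrow> spin_configs N"
      by (auto simp: spin_configs_def dest: spinsD)
    show "(\<lambda>v. restrict (vec_index v) {..<N}) \<in> spin_configs N \<rightarrow> spins N"
      by (auto simp: spin_configs_def spins_def)
    show "restrict (vec_index (vec N x)) {..<N} = x" if "x \<in> spins N" for x
      using that by (auto simp: spins_def PiE_iff extensional_def restrict_def fun_eq_iff)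
    show "vec N (restrict (vec_index v) {..<N}) = v" if "v \<in> spin_configs N" for v
      using that by (intro eq_vecI) (auto simp: spin_configs_def)
  qed
  have Ut: "transpose_mat U \<in> carrier_mat N N" using U by simp
  have D: "mat_diag N d \<in> carrier_mat N N" by simp
  have UD: "U * mat_diag N d \<in> carrier_mat N N" using U D by (rule mult_carrier_mat)
  have "scalar_prod (vec N x) ((U * mat_diag N d * transpose_mat U) *\<^sub>v vec N x) = qf N d U x x" for x
  proof -
    let ?A = "U * mat_diag N d * transpose_mat U"
    have A: "?A \<in> carrier_mat N N" using UD Ut by (rule mult_carrier_mat)
    have "vec_index (?A *\<^sub>v vec N x) i = mv N ?A x i" if "i < N" for i
      using A that by (auto simp: mult_mat_vec_def scalar_prod_def mv_def row_def atLeast0LessThan intro!: sum.cong)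
    moreover have "scalar_prod (vec N x) w = ip N x (vec_index w)" if "dim_vec w = N" for w
      using that by (simp add: scalar_prod_def ip_def atLeast0LessThan)
    moreover have "dim_vec (?A *\<^sub>v vec N x) = N" using U by simp
    ultimately have "scalar_prod (vec N x) (?A *\<^sub>v vec N x) = ip N x (mv N ?A x)"
      by (simp only:) (rule ip_cong, simp_all only:)
    also have "\<dots> = ip N x (mv N U (\<lambda>i. d i * mv N (transpose_mat U) x i))"
    proof (intro ip_cong refl)
      fix i assume i: "i < N"
      have dm: "mv N (mat_diag N d) y k = d k * y k" if "k < N" for y k
      proof -
        have "mv N (mat_diag N d) y k = (\<Sum>l<N. if l = k then d k * y k else 0)"
          unfolding mv_def mat_diag_def using that by (intro sum.cong) auto
        then show ?thesis using that by (simp add: sum.delta)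
      qed
      show "mv N ?A x i = mv N U (\<lambda>i. d i * mv N (transpose_mat U) x i) i"
        unfolding mv_mult[OF UD Ut i] mv_mult[OF U D i] by (intro mv_cong) (rule dm)
    qed
    also have "\<dots> = ip N (mv N (transpose_mat U) x) (\<lambda>i. d i * mv N (transpose_mat U) x i)"
      using ip_mv_left[OF Ut] by simp
    also have "\<dots> = qf N d U x x" unfolding qf_eq_ip by (rule ip_commute)
    finally show ?thesis .
  qed
  then show ?thesis
    unfolding Z_ROM_def Zf_def using sum.reindex_bij_betw[OF bij] by (simp flip: sum.reindex_bij_betw[OF bij])
qed

section \<open>Averages over spin configurations\<close>

text \<open>Hoeffding's lemma for a fair sign: success probability 1/2 and interval length
  2\<bar>t\<bar>.\<close>

lemma cosh_le_exp_square: "cosh t \<le> exp (t\<^sup>2 / 2)" for t :: real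
proof -
  define h where "h = 2 * \<bar>t\<bar>"
  have "cosh t = cosh \<bar>t\<bar>" by (simp add: cosh_real_abs)
  also have "\<dots> = exp (- h * (1 / 2)) * (1 + (1 / 2) * (exp h - 1))"
  proof -
    have "exp h = exp \<bar>t\<bar> * exp \<bar>t\<bar>" "exp (- h * (1 / 2)) = inverse (exp \<bar>t\<bar>)"
      by (simp_all add: h_def mult_exp_exp exp_minus)
    then show ?thesis by (simp add: cosh_field_def exp_minus field_simps)
  qed
  also have "\<dots> = exp (- h * (1 / 2) + ln (1 + (1 / 2) * (exp h - 1)))"
  proof -
    have "0 < 1 + (1 / 2) * (exp h - 1)" by (simp add: field_simps add_pos_pos)
    then show ?thesis by (simp only: exp_add exp_ln)
  qed
  also have "\<dots> \<le> exp (h\<^sup>2 / 8)"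
    using Hoeffdings_lemma_aux[of h "1 / 2"] by (simp add: h_def)
  also have "h\<^sup>2 / 8 = t\<^sup>2 / 2" by (simp add: h_def power2_eq_square)
  finally show ?thesis .
qed

lemma gaussian_mgf:
  "integrable lborel (\<lambda>z. std_normal_density z * exp (a * z))"
  "(\<integral>z. std_normal_density z * exp (a * z) \<partial>lborel) = exp (a\<^sup>2 / 2)"
proof -
  have e: "std_normal_density z * exp (a * z) = exp (a\<^sup>2 / 2) * normal_density a 1 z" for z
    by (simp add: normal_density_def mult_exp_exp power2_eq_square field_simps)
  show "integrable lborel (\<lambda>z. std_normal_density z * exp (a * z))"
    "(\<integral>z. std_normal_density z * exp (a * z) \<partial>lborel) = exp (a\<^sup>2 / 2)"
    unfolding e by simp_all
qed

lemma spin_average_linear: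
  assumes x: "x \<in> spins N"
  shows "(\<Sum>y\<in>spins N. exp (a * ip N x y)) / 2 ^ N = cosh a ^ N"
proof -
  have "(\<Sum>y\<in>spins N. exp (a * ip N x y)) = (\<Sum>y\<in>spins N. \<Prod>i<N. exp (a * (x i * y i)))"
    by (simp add: ip_def sum_distrib_left exp_sum)
  also have "\<dots> = (\<Prod>i<N. \<Sum>s\<in>{-1, 1}. exp (a * (x i * s)))"
    unfolding spins_def by (rule prod_sum_PiE[symmetric]) auto
  also have "\<dots> = (\<Prod>i<N. 2 * cosh a)"
  proof (intro prod.cong refl)
    fix i assume "i \<in> {..<N}"
    then consider "x i = - 1" | "x i = 1" using spinsD[OF x] by auto
    then show "(\<Sum>s\<in>{-1, 1}. exp (a * (x i * s))) = 2 * cosh a"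
      by cases (simp_all add: cosh_field_def)
  qed
  also have "\<dots> = 2 ^ N * cosh a ^ N" by (simp add: power_mult_distrib)
  finally show ?thesis by simp
qed

text \<open>Gaussian linearisation of the square in the exponent.\<close>
lemma spin_average_square:
  assumes N: "0 < N" and x: "x \<in> spins N" and \<kappa>: "0 \<le> \<kappa>" "\<kappa> \<le> 3 / 8"
  shows "(\<Sum>y\<in>spins N. exp (\<kappa> * (ip N x y)\<^sup>2 / N)) / 2 ^ N \<le> 2"
proof -
  \<comment> \<open>Chosen so that the Gaussian average of exp(l S z), with S the overlap, is
    exp(\<kappa> S^2 / N).\<close>
  define l where "l = sqrt (2 * \<kappa> / N)"
  have l2: "l\<^sup>2 = 2 * \<kappa> / N" using \<kappa> by (simp add: l_def)
  let ?g = "\<lambda>y z. std_normal_density z * exp ((l * ip N x y) * z)"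
  have e: "exp (\<kappa> * (ip N x y)\<^sup>2 / N) = (\<integral>z. ?g y z \<partial>lborel)" for y
    unfolding gaussian_mgf by (simp add: power_mult_distrib l2)
  have "(\<Sum>y\<in>spins N. exp (\<kappa> * (ip N x y)\<^sup>2 / N)) / 2 ^ N = (\<Sum>y\<in>spins N. (\<integral>z. ?g y z \<partial>lborel)) / 2 ^ N"
    by (simp only: e)
  also have "\<dots> = (\<integral>z. (\<Sum>y\<in>spins N. ?g y z) \<partial>lborel) / 2 ^ N"
    by (subst Bochner_Integration.integral_sum[OF gaussian_mgf(1)]) (rule refl)
  also have "\<dots> = (\<integral>z. (\<Sum>y\<in>spins N. ?g y z) / 2 ^ N \<partial>lborel)"
    by (rule integral_divide_zero[symmetric])
  also have "\<dots> \<le> (\<integral>z. 2 * normal_density 0 2 z \<partial>lborel)"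
  proof (rule integral_mono)
    show "integrable lborel (\<lambda>z. (\<Sum>y\<in>spins N. ?g y z) / 2 ^ N)"
      by (intro Bochner_Integration.integrable_divide Bochner_Integration.integrable_sum gaussian_mgf(1))
    fix z :: real
    have "(\<Sum>y\<in>spins N. ?g y z) / 2 ^ N = std_normal_density z * ((\<Sum>y\<in>spins N. exp ((l * z) * ip N x y)) / 2 ^ N)"
      by (simp add: sum_distrib_left algebra_simps)
    also have "\<dots> = std_normal_density z * cosh (l * z) ^ N" by (simp only: spin_average_linear[OF x])
    also have "\<dots> \<le> std_normal_density z * exp ((l * z)\<^sup>2 / 2) ^ N"
      by (intro mult_left_mono power_mono cosh_le_exp_square) auto
    also have "exp ((l * z)\<^sup>2 / 2) ^ N = exp (\<kappa> * z\<^sup>2)"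
      using N by (simp add: exp_of_nat_mult[symmetric] power_mult_distrib l2)
    also have "std_normal_density z * exp (\<kappa> * z\<^sup>2) \<le> std_normal_density z * exp (3 / 8 * z\<^sup>2)"
      using mult_right_mono[OF \<kappa>(2), of "z\<^sup>2"] by (intro mult_left_mono) auto
    \<comment> \<open>Any constant below 1/2 keeps the Gaussian integrable. With 3/8 the exponent
      becomes -z^2/8, that of standard deviation 2, and the ratio of the normalising factors is the
      bound 2.\<close>
    also have "\<dots> = 2 * normal_density 0 2 z"
    proof -
      have "exp (- z\<^sup>2 / 2) * exp (3 / 8 * z\<^sup>2) = exp (- z\<^sup>2 / 8)" by (simp add: mult_exp_exp)
      moreover have "sqrt (2 * pi * 2\<^sup>2) = 2 * sqrt (2 * pi)" by (simp only: real_sqrt_mult real_sqrt_abs)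
      ultimately show ?thesis by (simp add: normal_density_def)
    qed
    finally show "(\<Sum>y\<in>spins N. ?g y z) / 2 ^ N \<le> 2 * normal_density 0 2 z" .
  qed simp
  also have "\<dots> = 2" by simp
  finally show ?thesis .
qed

section \<open>First and second moment of the partition function\<close>

context haar_signs
begin

text \<open>Left multiplication by the matrix of \<open>orthogonal_frame\<close> moves
  \<open>u\<close> and \<open>v\<close> onto the first two axes, so the joint law of their quadratic
  forms depends on the two norms alone.\<close>

lemma integral_frame:
  fixes f :: "real \<Rightarrow> real \<Rightarrow> real"
  assumes N: "2 \<le> N" and uv: "ip N u v = 0"
    and f: "(\<lambda>U. f (ip N u u * q 0 0 U) (ip N v v * q 1 1 U)) \<in> borel_measurable (orthogonal_borel N)"
  shows "(\<integral>U. f (qf N d U u u) (qf N d U v v) \<partial>\<mu>) =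
    (\<integral>U. f (ip N u u * q 0 0 U) (ip N v v * q 1 1 U) \<partial>\<mu>)"
proof -
  obtain V where V: "V \<in> orthogonal_group N" "\<And>i. i < N \<Longrightarrow> mv N V u i = sqrt (ip N u u) * unit_fun 0 i"
    "\<And>i. i < N \<Longrightarrow> mv N V v i = sqrt (ip N v v) * unit_fun 1 i"
    using orthogonal_frame[OF N uv] by blast
  have qq: "qf N d U z z = ip N z z * q j j (V * U)"
    if U: "U \<in> space \<mu>" and z: "\<And>i. i < N \<Longrightarrow> mv N V z i = sqrt (ip N z z) * unit_fun j i" for U z j
  proof -
    have "U \<in> carrier_mat N N" using U orthogonal_groupD(1) by simp
    then have "qf N d U z z = qf N d (V * U) (mv N V z) (mv N V z)" by (simp only: qf_mult_mv[OF V(1)])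
    also have "\<dots> = qf N d (V * U) (\<lambda>i. sqrt (ip N z z) * unit_fun j i) (\<lambda>i. sqrt (ip N z z) * unit_fun j i)"
      by (intro qf_cong z)
    also have "\<dots> = ip N z z * q j j (V * U)"
      unfolding qf_linear q_def using ip_nonneg[of N z] by simp
    finally show ?thesis .
  qed
  have "(\<integral>U. f (qf N d U u u) (qf N d U v v) \<partial>\<mu>) =
      (\<integral>U. f (ip N u u * q 0 0 (V * U)) (ip N v v * q 1 1 (V * U)) \<partial>\<mu>)"
    by (intro Bochner_Integration.integral_cong refl arg_cong2[of _ _ _ _ f] qq V(2,3))
  also have "\<dots> = (\<integral>U. f (ip N u u * q 0 0 U) (ip N v v * q 1 1 U) \<partial>\<mu>)"
    by (rule integral_left[OF V(1) f])
  finally show ?thesis .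
qed

lemma Zf_measurable [measurable]: "Zf N d \<beta> \<in> borel_measurable (orthogonal_borel N)"
  unfolding Zf_def
  by (intro borel_measurable_times borel_measurable_const borel_measurable_sum
    measurable_compose[OF _ borel_measurable_exp] measurable_qf) auto

lemma qf_spin_measurable [measurable]: "(\<lambda>U. qf N d U x y) \<in> borel_measurable (orthogonal_borel N)"
  by (rule measurable_qf) simp_all

lemma abs_qf_spins_le:
  assumes "U \<in> orthogonal_group N" "x \<in> spins N" "y \<in> spins N"
  shows "\<bar>qf N d U x y\<bar> \<le> N"
  using abs_qf_le[OF assms(1) signs, where x = x and y = y] assms by (simp add: ip_spins)

lemma exp_qf_integrable:
  assumes "x \<in> spins N" "y \<in> spins N"
  shows "integrable \<mu> (\<lambda>U. exp (\<beta> * (qf N d U x x + qf N d U y y)))"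
    "integrable \<mu> (\<lambda>U. exp (\<beta> * qf N d U x x))"
proof -
  have 1: "\<bar>\<beta> * qf N d U z z\<bar> \<le> \<bar>\<beta>\<bar> * N" if "U \<in> space \<mu>" "z \<in> spins N" for U z
    unfolding abs_mult using that abs_qf_spins_le[of U z z] by (intro mult_left_mono) auto
  show "integrable \<mu> (\<lambda>U. exp (\<beta> * (qf N d U x x + qf N d U y y)))"
  proof (rule bounded_integrable[OF prob_space_axioms, of _ "exp (2 * \<bar>\<beta>\<bar> * N)"])
    show "\<bar>exp (\<beta> * (qf N d U x x + qf N d U y y))\<bar> \<le> exp (2 * \<bar>\<beta>\<bar> * N)" if "U \<in> space \<mu>" for U
      using abs_le_D1[OF 1[OF that assms(1)]] abs_le_D1[OF 1[OF that assms(2)]] by (simp add: algebra_simps)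
  qed measurable
  show "integrable \<mu> (\<lambda>U. exp (\<beta> * qf N d U x x))"
  proof (rule bounded_integrable[OF prob_space_axioms, of _ "exp (\<bar>\<beta>\<bar> * N)"])
    show "\<bar>exp (\<beta> * qf N d U x x)\<bar> \<le> exp (\<bar>\<beta>\<bar> * N)" if "U \<in> space \<mu>" for U
      using abs_le_D1[OF 1[OF that assms(1)]] by simp
  qed measurable
qed

lemma expectation_Zf:
  fixes \<beta> :: real
  assumes N: "2 \<le> N"
  shows "(\<integral>U. Zf N d \<beta> U \<partial>\<mu>) = (\<integral>U. exp (N * \<beta> * q 0 0 U) \<partial>\<mu>)"
proof -
  have "(\<integral>U. exp (\<beta> * qf N d U x x) \<partial>\<mu>) = (\<integral>U. exp (N * \<beta> * q 0 0 U) \<partial>\<mu>)" if x: "x \<in> spins N" for x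
  proof -
    have "(\<integral>U. exp (\<beta> * qf N d U x x) \<partial>\<mu>) = (\<integral>U. exp (\<beta> * (ip N x x * q 0 0 U)) \<partial>\<mu>)"
      \<comment> \<open>The zero vector serves as the second vector of the frame.\<close>
      by (rule integral_frame[OF N, of x "\<lambda>_. 0" "\<lambda>s t. exp (\<beta> * s)"]) (simp add: ip_def, measurable)
    then show ?thesis by (simp add: ip_spins[OF x] algebra_simps)
  qed
  then show ?thesis unfolding Zf_def
    by (simp add: Bochner_Integration.integral_sum exp_qf_integrable card_spins)
qed

lemma first_moment_Zf:
  fixes \<beta> :: real
  assumes N: "2 \<le> N" and \<beta>: "0 \<le> \<beta>" "\<beta> \<le> 1 / 8"
  shows "(\<integral>U. Zf N d \<beta> U \<partial>\<mu>) \<le> exp (N * Lam sign_mean \<beta>)" "exp (N * Lam sign_mean \<beta> - 1) \<le> (\<integral>U. Zf N d \<beta> U \<partial>\<mu>)"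
  using one_replica_bounds[of 0 \<beta>] N \<beta> by (simp_all add: expectation_Zf)

text \<open>By polarisation the two forms at x, y are half the sum of those at x + y and x - y,
  which are orthogonal because x and y have equal norm. Their squared norms 2(N + S) and 2(N - S)
  give weights \<beta>(1 + S/N) and \<beta>(1 - S/N); the correlation is therefore a second
  difference of \<open>Lam\<close>, quadratic in S/N.\<close>

lemma second_moment_pair:
  fixes \<beta> :: real
  assumes N: "2 \<le> N" and \<beta>: "0 \<le> \<beta>" "\<beta> \<le> 1 / 16" and x: "x \<in> spins N" and y: "y \<in> spins N"
  shows "(\<integral>U. exp (\<beta> * (qf N d U x x + qf N d U y y)) \<partial>\<mu>) \<le>
    exp (2 * N * Lam sign_mean \<beta> + 1) * exp (8 * \<beta>\<^sup>2 * (ip N x y)\<^sup>2 / N)"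
proof -
  let ?u = "\<lambda>i. x i + y i" and ?v = "\<lambda>i. x i - y i"
  define S where "S = ip N x y"
  define s where "s = \<beta> * \<bar>S\<bar> / N"
  define a where "a = \<beta> * (1 + S / N)"
  define b where "b = \<beta> * (1 - S / N)"
  have xx: "ip N x x = N" "ip N y y = N" "ip N x y = S" "ip N y x = S"
    using x y by (simp_all add: ip_spins S_def ip_commute)
  have uv: "ip N ?u ?v = 0" unfolding ip_linear xx by simp
  have uu: "ip N ?u ?u = 2 * (N + S)" and vv: "ip N ?v ?v = 2 * (N - S)" unfolding ip_linear xx by simp_all
  have "0 \<le> 2 * (N + S)" "0 \<le> 2 * (N - S)" using ip_nonneg[of N ?u] ip_nonneg[of N ?v] uu vv by simp_all
  then have S: "\<bar>S\<bar> \<le> N" by simp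
  have "(\<integral>U. exp (\<beta> * (qf N d U x x + qf N d U y y)) \<partial>\<mu>) =
      (\<integral>U. exp (\<beta> / 2 * (qf N d U ?u ?u + qf N d U ?v ?v)) \<partial>\<mu>)"
  proof -
    have "\<beta> * (qf N d U x x + qf N d U y y) = \<beta> / 2 * (qf N d U ?u ?u + qf N d U ?v ?v)" for U
      unfolding qf_linear by (simp add: field_simps)
    then show ?thesis by (simp only:)
  qed
  also have "\<dots> = (\<integral>U. exp (\<beta> / 2 * (ip N ?u ?u * q 0 0 U + ip N ?v ?v * q 1 1 U)) \<partial>\<mu>)"
    by (rule integral_frame[OF N uv, of "\<lambda>s t. exp (\<beta> / 2 * (s + t))"]) measurable
  also have "\<dots> = (\<integral>U. exp (N * (a * q 0 0 U + b * q 1 1 U)) \<partial>\<mu>)"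
  proof -
    have "N * a = \<beta> * (N + S)" "N * b = \<beta> * (N - S)"
      using N by (simp_all add: a_def b_def field_simps)
    moreover have "N * (a * A + b * B) = (N * a) * A + (N * b) * B" for A B
      by (simp add: algebra_simps)
    moreover have "\<beta> / 2 * (2 * (N + S) * A + 2 * (N - S) * B) = (\<beta> * (N + S)) * A + (\<beta> * (N - S)) * B" for A B
      by (simp add: field_simps)
    ultimately have "\<beta> / 2 * (2 * (N + S) * A + 2 * (N - S) * B) = N * (a * A + b * B)" for A B
      by (simp only:)
    then show ?thesis unfolding uu vv by (simp only:)
  qed
  also have "\<dots> \<le> exp (N * (Lam sign_mean a + Lam sign_mean b) + 1)"
  proof (rule two_replica_bound)
    have "S / N \<le> 1" "- 1 \<le> S / N" using S N by (simp_all add: field_simps)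
    then have "0 \<le> 1 + S / N" "1 + S / N \<le> 2" "0 \<le> 1 - S / N" "1 - S / N \<le> 2" by linarith+
    then have "0 \<le> a \<and> a \<le> (1 / 16) * 2 \<and> 0 \<le> b \<and> b \<le> (1 / 16) * 2"
      unfolding a_def b_def using \<beta> by (intro conjI mult_nonneg_nonneg mult_mono) auto
    then show "0 \<le> a" "a \<le> 1 / 8" "0 \<le> b" "b \<le> 1 / 8" by auto
  qed (use N in auto)
  \<comment> \<open>The sign of the overlap only exchanges the two weights.\<close>
  also have "Lam sign_mean a + Lam sign_mean b = Lam sign_mean (\<beta> + s) + Lam sign_mean (\<beta> - s)"
  proof (cases "S \<ge> 0")
    case True
    then have "a = \<beta> + s" "b = \<beta> - s" by (simp_all add: a_def b_def s_def algebra_simps)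
    then show ?thesis by simp
  next
    case False
    then have "b = \<beta> + s" "a = \<beta> - s" by (simp_all add: a_def b_def s_def algebra_simps)
    then show ?thesis by simp
  qed
  also have "exp (N * (Lam sign_mean (\<beta> + s) + Lam sign_mean (\<beta> - s)) + 1) \<le> exp (N * (2 * Lam sign_mean \<beta> + 8 * s\<^sup>2) + 1)"
  proof -
    have "\<beta> * \<bar>S\<bar> \<le> \<beta> * N" using S \<beta> by (intro mult_left_mono) auto
    then have "0 \<le> s" "s \<le> \<beta>" using \<beta> N by (simp_all add: s_def field_simps)
    from Lam_second_difference[OF abs_sign_mean_le this \<beta>(2)]
    have "N * (Lam sign_mean (\<beta> + s) + Lam sign_mean (\<beta> - s)) \<le> N * (2 * Lam sign_mean \<beta> + 8 * s\<^sup>2)"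
      by (intro mult_left_mono) auto
    then show ?thesis by simp
  qed
  also have "N * (2 * Lam sign_mean \<beta> + 8 * s\<^sup>2) + 1 = (2 * N * Lam sign_mean \<beta> + 1) + 8 * \<beta>\<^sup>2 * S\<^sup>2 / N"
    using N by (simp add: s_def power_mult_distrib power_divide field_simps power2_eq_square)
  finally show ?thesis by (simp add: exp_add S_def)
qed

text \<open>For fixed x the overlap with a uniform y is typically of order sqrt N, so the Gaussian
  factor of each pair averages to at most 2.\<close>

lemma second_moment_Zf:
  fixes \<beta> :: real
  assumes N: "2 \<le> N" and \<beta>: "0 \<le> \<beta>" "\<beta> \<le> 1 / 16"
  shows "(\<integral>U. (Zf N d \<beta> U)\<^sup>2 \<partial>\<mu>) \<le> 2 * exp (2 * N * Lam sign_mean \<beta> + 1)"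
proof -
  let ?E = "exp (2 * N * Lam sign_mean \<beta> + 1)"
  have "(Zf N d \<beta> U)\<^sup>2 = (1 / 2 ^ N) * (\<Sum>x\<in>spins N. (1 / 2 ^ N) *
      (\<Sum>y\<in>spins N. exp (\<beta> * (qf N d U x x + qf N d U y y))))" for U
    unfolding Zf_def power2_eq_square
    by (simp add: sum_product exp_add distrib_left sum_distrib_left sum_divide_distrib algebra_simps)
  then have "(\<integral>U. (Zf N d \<beta> U)\<^sup>2 \<partial>\<mu>) = (1 / 2 ^ N) * (\<Sum>x\<in>spins N. (1 / 2 ^ N) *
      (\<Sum>y\<in>spins N. (\<integral>U. exp (\<beta> * (qf N d U x x + qf N d U y y)) \<partial>\<mu>)))"
    by (simp add: Bochner_Integration.integral_sum exp_qf_integrable)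
  also have "\<dots> \<le> (1 / 2 ^ N) * (\<Sum>x\<in>spins N. (1 / 2 ^ N) *
      (\<Sum>y\<in>spins N. ?E * exp (8 * \<beta>\<^sup>2 * (ip N x y)\<^sup>2 / N)))"
    by (intro mult_left_mono sum_mono second_moment_pair N \<beta>) auto
  also have "\<dots> = (1 / 2 ^ N) * (\<Sum>x\<in>spins N. ?E * ((\<Sum>y\<in>spins N. exp (8 * \<beta>\<^sup>2 * (ip N x y)\<^sup>2 / N)) / 2 ^ N))"
    by (simp add: sum_distrib_left[symmetric])
  also have "\<dots> \<le> (1 / 2 ^ N) * (\<Sum>x\<in>spins N. ?E * 2)"
  proof (intro mult_left_mono sum_mono spin_average_square)
    have "\<beta>\<^sup>2 \<le> (1 / 16)\<^sup>2" using \<beta> by (intro power_mono) auto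
    then show "8 * \<beta>\<^sup>2 \<le> 3 / 8" by (simp add: power2_eq_square)
  qed (use N in auto)
  also have "\<dots> = 2 * ?E" by (simp add: card_spins)
  finally show ?thesis .
qed

end

section \<open>Orthogonal groups of trailing coordinates\<close>

text \<open>The copy of O(n) in O(N) fixing the first N - n coordinates. These subgroups are nested,
  and coordinate N - n is the one that is lost in passing from n to n - 1.\<close>

definition embed :: "nat \<Rightarrow> nat \<Rightarrow> real mat \<Rightarrow> real mat" where
  "embed N n V = four_block_mat (1\<^sub>m (N - n)) (0\<^sub>m (N - n) n) (0\<^sub>m n (N - n)) V"

lemma embed_index:
  assumes "n \<le> N" "V \<in> carrier_mat n n" "i < N" "k < N"
  shows "embed N n V $$ (i, k) = (if i < N - n \<or> k < N - n then (if i = k then 1 else 0)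
    else V $$ (i - (N - n), k - (N - n)))"
  using assms unfolding embed_def by (subst index_mat_four_block) auto

lemma embed_carrier: "n \<le> N \<Longrightarrow> V \<in> carrier_mat n n \<Longrightarrow> embed N n V \<in> carrier_mat N N"
  unfolding embed_def
  using four_block_carrier_mat[of "1\<^sub>m (N - n)" "N - n" "N - n" V n n] by simp

lemma embed_mult:
  assumes n: "n \<le> N" and V: "V \<in> carrier_mat n n" and W: "W \<in> carrier_mat n n"
  shows "embed N n (V * W) = embed N n V * embed N n W"
proof -
  have VW: "V * W \<in> carrier_mat n n" using V W by (rule mult_carrier_mat)
  have "embed N n V * embed N n W = four_block_mat
      (1\<^sub>m (N - n) * 1\<^sub>m (N - n) + 0\<^sub>m (N - n) n * 0\<^sub>m n (N - n))
      (1\<^sub>m (N - n) * 0\<^sub>m (N - n) n + 0\<^sub>m (N - n) n * W)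
      (0\<^sub>m n (N - n) * 1\<^sub>m (N - n) + V * 0\<^sub>m n (N - n))
      (0\<^sub>m n (N - n) * 0\<^sub>m (N - n) n + V * W)"
    unfolding embed_def by (rule mult_four_block_mat) (use V W in auto)
  also have "\<dots> = embed N n (V * W)" unfolding embed_def
    by (rule cong_four_block_mat) (use V W VW in auto)
  finally show ?thesis by simp
qed

lemma embed_transpose:
  assumes "V \<in> carrier_mat n n"
  shows "embed N n (transpose_mat V) = transpose_mat (embed N n V)"
  unfolding embed_def
  by (subst transpose_four_block_mat[of _ "N - n" "N - n" _ n _ n]) (use assms in auto)

lemma embed_one: "n \<le> N \<Longrightarrow> embed N n (1\<^sub>m n) = 1\<^sub>m N"
  unfolding embed_def by (subst four_block_one_mat) simp

lemma embed_inj: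
  assumes n: "n \<le> N" and V: "V \<in> carrier_mat n n" and W: "W \<in> carrier_mat n n"
    and e: "embed N n V = embed N n W"
  shows "V = W"
proof (rule eq_matI)
  fix i k assume "i < dim_row W" "k < dim_col W"
  then have ik: "i < n" "k < n" using W by auto
  then have "embed N n V $$ (i + (N - n), k + (N - n)) = V $$ (i, k)"
    "embed N n W $$ (i + (N - n), k + (N - n)) = W $$ (i, k)"
  proof -
    obtain p where p: "N = p + n" using n by (metis le_add_diff_inverse2)
    show "embed N n V $$ (i + (N - n), k + (N - n)) = V $$ (i, k)"
      "embed N n W $$ (i + (N - n), k + (N - n)) = W $$ (i, k)"
      unfolding p using ik V W by (simp_all add: embed_index)
  qed
  then show "V $$ (i, k) = W $$ (i, k)" using e by simp
qed (use V W in auto)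

lemma embed_orthogonal_iff:
  assumes n: "n \<le> N" and V: "V \<in> carrier_mat n n"
  shows "embed N n V \<in> orthogonal_group N \<longleftrightarrow> V \<in> orthogonal_group n"
proof -
  have Vt: "transpose_mat V \<in> carrier_mat n n" using V by simp
  have VV: "transpose_mat V * V \<in> carrier_mat n n" using Vt V by (rule mult_carrier_mat)
  have e: "transpose_mat (embed N n V) * embed N n V = embed N n (transpose_mat V * V)"
    by (simp only: embed_mult[OF n Vt V] embed_transpose[OF V])
  show ?thesis
  proof
    assume "embed N n V \<in> orthogonal_group N"
    from orthogonal_groupD(2)[OF this] have "embed N n (transpose_mat V * V) = embed N n (1\<^sub>m n)"
      by (simp only: e embed_one[OF n])
    then have "transpose_mat V * V = 1\<^sub>m n" by (rule embed_inj[OF n VV one_carrier_mat])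
    then show "V \<in> orthogonal_group n" by (rule orthogonal_groupI[OF V])
  next
    assume "V \<in> orthogonal_group n"
    from orthogonal_groupD(2)[OF this] show "embed N n V \<in> orthogonal_group N"
      by (intro orthogonal_groupI[OF embed_carrier[OF n V]]) (simp only: e embed_one[OF n])
  qed
qed

lemma embed_orthogonal:
  assumes "n \<le> N" "V \<in> orthogonal_group n"
  shows "embed N n V \<in> orthogonal_group N"
  using embed_orthogonal_iff[OF assms(1) orthogonal_groupD(1)[OF assms(2)]] assms(2) by simp

lemma embed_self: "V \<in> carrier_mat N N \<Longrightarrow> embed N N V = V"
  by (rule eq_matI) (auto simp: embed_def)

lemma embed_embed:
  assumes mn: "m \<le> n" "n \<le> N" and V: "V \<in> carrier_mat m m"
  shows "embed N n (embed n m V) = embed N m V"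
proof -
  have c: "embed n m V \<in> carrier_mat n n" "embed N m V \<in> carrier_mat N N"
    using embed_carrier V mn by auto
  have c': "embed N n (embed n m V) \<in> carrier_mat N N" using embed_carrier c mn by auto
  obtain r where r: "n = r + m" using mn(1) by (metis le_add_diff_inverse2)
  obtain p where p: "N = p + (r + m)" using mn(2) unfolding r by (metis le_add_diff_inverse2)
  have d: "N - n = p" "n - m = r" "N - m = p + r" by (simp_all add: p r)
  show ?thesis
  proof (rule eq_matI)
    fix i k assume "i < dim_row (embed N m V)" "k < dim_col (embed N m V)"
    then have ik: "i < N" "k < N" using c by auto
    have "embed N n (embed n m V) $$ (i, k) = (if i < p \<or> k < p then (if i = k then 1 else 0)
        else embed n m V $$ (i - p, k - p))"
      unfolding embed_index[OF mn(2) c(1) ik] d ..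
    also have "\<dots> = (if i < p + r \<or> k < p + r then (if i = k then 1 else 0)
        else V $$ (i - (p + r), k - (p + r)))"
    proof (cases "i < p \<or> k < p")
      case False
      then have ik': "i - p < n" "k - p < n" using ik p r by auto
      have "i - p < r \<longleftrightarrow> i < p + r" "k - p < r \<longleftrightarrow> k < p + r" "i - p = k - p \<longleftrightarrow> i = k"
        using False by auto
      then show ?thesis using False unfolding embed_index[OF mn(1) V ik'] d by simp
    qed auto
    also have "\<dots> = embed N m V $$ (i, k)"
      unfolding embed_index[OF order_trans[OF mn] V ik] d ..
    finally show "embed N n (embed n m V) $$ (i, k) = embed N m V $$ (i, k)" .
  qed (use c c' in auto)
qed

text \<open>Prescribing the first rows is enough: orthogonality of the remaining rows to these unit
  vectors clears the corresponding columns.\<close>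

lemma embed_surj:
  assumes n: "n \<le> N" and A: "A \<in> orthogonal_group N"
    and rows: "\<And>i k. i < N - n \<Longrightarrow> k < N \<Longrightarrow> A $$ (i, k) = unit_fun i k"
  shows "\<exists>V\<in>orthogonal_group n. A = embed N n V"
proof -
  note a = orthogonal_groupD[OF A]
  obtain p where p: "N = p + n" using n by (metis le_add_diff_inverse2)
  define V where "V = mat n n (\<lambda>(i, k). A $$ (i + p, k + p))"
  have V: "V \<in> carrier_mat n n" by (simp add: V_def)
  have z: "A $$ (i, k) = 0" if ik: "i < N" "k < N - n" "\<not> i < N - n" for i k
  proof -
    have "(A * transpose_mat A) $$ (i, k) = (\<Sum>l<N. A $$ (i, l) * A $$ (k, l))"
    proof -
      have At: "transpose_mat A \<in> carrier_mat N N" using a(1) by simp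
      have k: "k < N" using ik by simp
      show ?thesis unfolding mult_mat_index[OF a(1) At ik(1) k]
        using a(1) k by (intro sum.cong refl arg_cong2[of _ _ _ _ "(*)"]) auto
    qed
    also have "\<dots> = ip N (\<lambda>l. A $$ (i, l)) (unit_fun k)"
      unfolding ip_def using ik rows by (intro sum.cong) auto
    also have "\<dots> = A $$ (i, k)" using ik by (simp add: ip_unit_fun_right)
    finally show ?thesis unfolding a(3) using ik by simp
  qed
  have "A = embed N n V"
  proof (rule eq_matI)
    have c: "embed N n V \<in> carrier_mat N N" using embed_carrier[OF n V] .
    fix i k assume "i < dim_row (embed N n V)" "k < dim_col (embed N n V)"
    then have ik: "i < N" "k < N" using c by auto
    show "A $$ (i, k) = embed N n V $$ (i, k)"
    proof -
      have "V $$ (i - p, k - p) = A $$ (i, k)" if "\<not> i < p" "\<not> k < p"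
        using that ik p by (simp add: V_def)
      then show ?thesis unfolding embed_index[OF n V ik]
        using ik rows[of i k] z[of i k]
        by (cases "i < p"; cases "k < p") (auto simp: p unit_fun_def)
    qed
  qed (use a(1) embed_carrier[OF n V] in auto)
  moreover from this have "V \<in> orthogonal_group n" using A embed_orthogonal_iff[OF n V] by simp
  ultimately show ?thesis by blast
qed

lemma embed_measurable:
  assumes n: "n \<le> N" and f: "f \<in> measurable M (orthogonal_borel n)"
  shows "(\<lambda>x. embed N n (f x)) \<in> measurable M (orthogonal_borel N)"
proof (rule measurable_orthogonal_borelI)
  note fx = measurable_orthogonal_in[OF f]
  show "embed N n (f x) \<in> orthogonal_group N" if "x \<in> space M" for x
    using embed_orthogonal[OF n] fx that by blast
  fix i k assume ik: "i < N" "k < N"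
  let ?h = "\<lambda>x. if i < N - n \<or> k < N - n then (if i = k then 1 else 0)
    else f x $$ (i - (N - n), k - (N - n))" and ?g = "\<lambda>x. embed N n (f x) $$ (i, k)"
  have e: "?h x = ?g x" if "x \<in> space M" for x
    unfolding embed_index[OF n orthogonal_groupD(1)[OF fx[OF that]] ik] ..
  have "?h \<in> borel_measurable M"
  proof (cases "i < N - n \<or> k < N - n")
    case False
    then have "i - (N - n) < n" "k - (N - n) < n" using ik n by linarith+
    then show ?thesis unfolding if_not_P[OF False] by (rule measurable_entry[OF _ _ f])
  qed simp
  then show "?g \<in> borel_measurable M" by (rule measurable_cong[THEN iffD1, rotated]) (rule e)
qed

text \<open>The normal of a reflection that takes row \<open>j\<close> of \<open>G\<close> to a multiple \<open>s = \<plusminus>1\<close> of the \<open>j\<close>-th unit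
  vector, with the sign chosen such that the difference of the two vectors has norm at least \<open>\<surd>2\<close>.\<close>
definition row_sign :: "nat \<Rightarrow> real mat \<Rightarrow> real" where
  "row_sign j G = (if G $$ (j, j) > 0 then - 1 else 1)"

definition row_normal :: "nat \<Rightarrow> real mat \<Rightarrow> nat \<Rightarrow> real" where
  "row_normal j G i = (1 / sqrt (2 - 2 * row_sign j G * G $$ (j, j))) *
    (unit_fun j i - row_sign j G * G $$ (j, i))"

lemma unit_fun_self: "unit_fun j j = 1"
  by (simp add: unit_fun_def)

lemma row_sign_square: "row_sign j G * row_sign j G = 1" "(row_sign j G)\<^sup>2 = 1"
  by (auto simp: row_sign_def)

text \<open>The squared length before normalisation stays away from 0, so no degenerate case arises,
  and the normalising factor is at most 1/sqrt 2.\<close>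

lemma row_sign_ge: "2 \<le> 2 - 2 * row_sign j G * G $$ (j, j)"
  by (auto simp: row_sign_def)

lemma ip_row:
  assumes G: "G \<in> orthogonal_group N" and j: "j < N"
  shows "ip N (\<lambda>i. G $$ (j, i)) (\<lambda>i. G $$ (j, i)) = 1"
proof -
  have "ip N (\<lambda>i. G $$ (j, i)) (\<lambda>i. G $$ (j, i)) =
      ip N (mv N (transpose_mat G) (unit_fun j)) (mv N (transpose_mat G) (unit_fun j))"
    using orthogonal_groupD(1)[OF G] j by (intro ip_cong) (auto simp: mv_unit_fun)
  then show ?thesis using ip_mv_mv[OF orthogonal_group_transpose[OF G]] j by (simp add: ip_unit_unit)
qed

lemma row_normal_unit:
  assumes G: "G \<in> orthogonal_group N" and j: "j < N"
  shows "ip N (row_normal j G) (row_normal j G) = 1"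
proof -
  let ?q = "2 - 2 * row_sign j G * G $$ (j, j)"
  have "ip N (\<lambda>i. unit_fun j i - row_sign j G * G $$ (j, i)) (\<lambda>i. unit_fun j i - row_sign j G * G $$ (j, i)) = ?q"
    unfolding ip_linear using j ip_row[OF G j]
    by (simp add: ip_unit_unit ip_unit_fun_left ip_unit_fun_right row_sign_square unit_fun_self algebra_simps)
  then have "ip N (row_normal j G) (row_normal j G) = (1 / sqrt ?q) * ((1 / sqrt ?q) * ?q)"
    unfolding row_normal_def ip_scale_left ip_scale_right by simp
  also have "\<dots> = 1" using row_sign_ge[of j G] by (simp add: field_simps)
  finally show ?thesis .
qed

lemma refl_row_normal:
  assumes G: "G \<in> orthogonal_group N" and j: "j < N" and i: "i < N"
  shows "mv N (refl_mat N (row_normal j G)) (\<lambda>i. G $$ (j, i)) i = row_sign j G * unit_fun j i"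
proof -
  let ?q = "2 - 2 * row_sign j G * G $$ (j, j)" and ?s = "row_sign j G" and ?y = "\<lambda>i. G $$ (j, i)"
  have q: "?q > 0" using row_sign_ge[of j G] by simp
  have "ip N (\<lambda>i. unit_fun j i - ?s * ?y i) ?y = ?y j - ?s"
    unfolding ip_linear using j ip_row[OF G j] by (simp add: ip_unit_fun_left)
  also have "\<dots> = - ?s * ?q / 2" using row_sign_square(1)[of j G] by (simp add: field_simps)
  finally have "ip N (row_normal j G) ?y = (1 / sqrt ?q) * (- ?s * ?q / 2)"
    unfolding row_normal_def ip_scale_left by simp
  then have "2 * ip N (row_normal j G) ?y * row_normal j G i =
      (1 / sqrt ?q * (1 / sqrt ?q)) * ?q * (- ?s * (unit_fun j i - ?s * ?y i))"
    by (simp add: row_normal_def)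
  also have "(1 / sqrt ?q * (1 / sqrt ?q)) * ?q = 1" using q by (simp add: field_simps)
  also have "1 * (- ?s * (unit_fun j i - ?s * ?y i)) = ?y i - ?s * unit_fun j i"
    using row_sign_square(1)[of j G] by (simp add: right_diff_distrib mult.assoc[symmetric])
  finally show ?thesis using i by (simp add: mv_refl)
qed

lemma row_refl_orthogonal: "G \<in> orthogonal_group N \<Longrightarrow> j < N \<Longrightarrow> refl_mat N (row_normal j G) \<in> orthogonal_group N"
  using refl_mat_orthogonal row_normal_unit by blast

lemma refl_mat_index:
  "i < N \<Longrightarrow> k < N \<Longrightarrow> refl_mat N w $$ (i, k) = (if i = k then 1 else 0) - 2 * w i * w k"
  by (simp add: refl_mat_def)

lemma row_refl_measurable:
  assumes j: "j < N" and f: "f \<in> measurable M (orthogonal_borel N)"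
  shows "(\<lambda>x. refl_mat N (row_normal j (f x))) \<in> measurable M (orthogonal_borel N)"
proof (rule measurable_orthogonal_borelI)
  show "refl_mat N (row_normal j (f x)) \<in> orthogonal_group N" if "x \<in> space M" for x
    using row_refl_orthogonal[OF measurable_orthogonal_in[OF f that] j] .
  note [measurable] = measurable_entry[OF j j f]
  have s [measurable]: "(\<lambda>x. row_sign j (f x)) \<in> borel_measurable M" unfolding row_sign_def by measurable
  have r: "(\<lambda>x. row_normal j (f x) i) \<in> borel_measurable M" if i: "i < N" for i
  proof -
    note [measurable] = measurable_entry[OF j i f]
    show ?thesis unfolding row_normal_def by measurable
  qed
  fix i k assume ik: "i < N" "k < N"
  have "(\<lambda>x. (if i = k then 1 else 0) - 2 * row_normal j (f x) i * row_normal j (f x) k) \<in> borel_measurable M"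
    by (rule borel_measurable_diff[OF borel_measurable_const
      borel_measurable_times[OF borel_measurable_times[OF borel_measurable_const r[OF ik(1)]] r[OF ik(2)]]])
  then show "(\<lambda>x. refl_mat N (row_normal j (f x)) $$ (i, k)) \<in> borel_measurable M"
    unfolding refl_mat_index[OF ik] .
qed

text \<open>Conjugation by \<open>W\<close> transports the normal. This is how an average over a
  smaller orthogonal group is carried past a reflection.\<close>

lemma refl_conjugate:
  assumes W: "W \<in> orthogonal_group N" and w: "\<And>i. i < N \<Longrightarrow> w' i = mv N W w i"
  shows "W * refl_mat N w = refl_mat N w' * W"
proof (rule mat_eq_mvI[of _ N])
  note Wc = orthogonal_groupD(1)[OF W]
  show "W * refl_mat N w \<in> carrier_mat N N" "refl_mat N w' * W \<in> carrier_mat N N"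
    using Wc mult_carrier_mat refl_mat_carrier by blast+
  fix i j assume ij: "i < N" "j < N"
  let ?e = "unit_fun j"
  have "mv N (W * refl_mat N w) ?e i = mv N W (mv N (refl_mat N w) ?e) i"
    by (rule mv_mult[OF Wc refl_mat_carrier ij(1)])
  also have "\<dots> = mv N W (\<lambda>i. ?e i - 2 * ip N w ?e * w i) i"
    by (intro mv_cong) (simp add: mv_refl)
  also have "\<dots> = mv N W ?e i - 2 * ip N w ?e * w' i"
    unfolding mv_diff mv_scale w[OF ij(1)] ..
  also have "ip N w ?e = ip N w' (mv N W ?e)"
  proof -
    have "ip N w' (mv N W ?e) = ip N (mv N W w) (mv N W ?e)" by (intro ip_cong) (simp_all add: w)
    then show ?thesis by (simp only: ip_mv_mv[OF W])
  qed
  also have "mv N W ?e i - 2 * ip N w' (mv N W ?e) * w' i = mv N (refl_mat N w' * W) ?e i"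
    unfolding mv_mult[OF refl_mat_carrier Wc ij(1)] using ij by (simp add: mv_refl)
  finally show "mv N (W * refl_mat N w) ?e i = mv N (refl_mat N w' * W) ?e i" .
qed

section \<open>A variance bound on the orthogonal group\<close>

lemma row_mult:
  assumes "G \<in> carrier_mat N N" "R \<in> carrier_mat N N" "i < N" "k < N"
  shows "(G * transpose_mat R) $$ (i, k) = mv N R (\<lambda>l. G $$ (i, l)) k"
proof -
  have Rt: "transpose_mat R \<in> carrier_mat N N" using assms(2) by simp
  show ?thesis unfolding mult_mat_index[OF assms(1) Rt assms(3,4)] mv_def
    using assms(2,4) by (intro sum.cong refl) auto
qed

text \<open>\<open>h n\<close> averages over the orthogonal group of the last \<open>n\<close> coordinates, so \<open>h N, \<dots>, h 1\<close> is a
  martingale from the mean of \<open>F\<close> to \<open>F\<close>, the groups for \<open>n\<close> and \<open>n - 1\<close> being linked by one reflection.\<close>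
locale rotation_chain =
  fixes N :: nat and \<mu> :: "nat \<Rightarrow> real mat measure" and F :: "real mat \<Rightarrow> real" and B :: real
  assumes N: "1 \<le> N"
    and haar_mu: "\<And>n. 1 \<le> n \<Longrightarrow> n \<le> N \<Longrightarrow> is_haar n (\<mu> n)"
    and F_measurable: "F \<in> borel_measurable (orthogonal_borel N)"
    and F_bounded: "\<And>A. A \<in> orthogonal_group N \<Longrightarrow> \<bar>F A\<bar> \<le> B"
    and flip: "\<And>j A. j < N \<Longrightarrow> A \<in> orthogonal_group N \<Longrightarrow> F (refl_mat N (unit_fun j) * A) = F A"
begin

definition h :: "nat \<Rightarrow> real mat \<Rightarrow> real" where
  "h n A = (\<integral>V. F (embed N n V * A) \<partial>\<mu> n)"

text \<open>As n decreases from N to 1 this climbs from the square of the mean of \<open>F\<close>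
  to the mean of its square, so the variance telescopes into increments of \<open>K\<close>.\<close>

definition K :: "nat \<Rightarrow> real" where
  "K n = (\<integral>A. (h n A)\<^sup>2 \<partial>\<mu> N)"

text \<open>The Dirichlet energy of \<open>F\<close> for the one reflection that row
  \<open>j\<close> of \<open>G\<close> prescribes.\<close>

definition D :: "nat \<Rightarrow> real mat \<Rightarrow> real" where
  "D j G = (\<integral>U. (F (refl_mat N (row_normal j G) * U) - F U)\<^sup>2 \<partial>\<mu> N)"

lemma haar_n: "1 \<le> n \<Longrightarrow> n \<le> N \<Longrightarrow> haar (\<mu> n) n"
  using haar_mu haarI by blast

lemma prob_n: "1 \<le> n \<Longrightarrow> n \<le> N \<Longrightarrow> prob_space (\<mu> n)"
  using haar_mu by (simp add: is_haar_def)

lemma space_n: "1 \<le> n \<Longrightarrow> n \<le> N \<Longrightarrow> space (\<mu> n) = orthogonal_group n"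
  using haar.space_haar[OF haar_n] .

lemma measurable_n:
  assumes "1 \<le> n" "n \<le> N"
  shows "measurable (\<mu> n) M = measurable (orthogonal_borel n) M"
    "measurable M (\<mu> n) = measurable M (orthogonal_borel n)"
  using haar.measurable_haar[OF haar_n[OF assms]] by auto

lemma const_n: "1 \<le> n \<Longrightarrow> n \<le> N \<Longrightarrow> (\<integral>x. c \<partial>\<mu> n) = (c :: real)"
  using prob_space.prob_space[OF prob_n] by simp

lemma fst_n: "1 \<le> n \<Longrightarrow> n \<le> N \<Longrightarrow> fst \<in> measurable (\<mu> n \<Otimes>\<^sub>M M) (orthogonal_borel n)"
  using measurable_fst[of "\<mu> n" M] measurable_n(2) by blast

lemma snd_n: "1 \<le> n \<Longrightarrow> n \<le> N \<Longrightarrow> snd \<in> measurable (M \<Otimes>\<^sub>M \<mu> n) (orthogonal_borel n)"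
  using measurable_snd[of M "\<mu> n"] measurable_n(2) by blast

lemma id_n: "1 \<le> n \<Longrightarrow> n \<le> N \<Longrightarrow> (\<lambda>x. x) \<in> measurable (\<mu> n) (orthogonal_borel n)"
  using measurable_n(2)[of n "\<mu> n"] measurable_ident[of "\<mu> n"] by (simp add: id_def)

lemma F_embed_measurable:
  assumes "n \<le> N" "f \<in> measurable M (orthogonal_borel n)" "g \<in> measurable M (orthogonal_borel N)"
  shows "(\<lambda>x. F (embed N n (f x) * g x)) \<in> borel_measurable M"
  using measurable_compose[OF measurable_mat_mult[OF embed_measurable[OF assms(1,2)] assms(3)] F_measurable] .

lemma embed_mult_in:
  "n \<le> N \<Longrightarrow> V \<in> orthogonal_group n \<Longrightarrow> A \<in> orthogonal_group N \<Longrightarrow> embed N n V * A \<in> orthogonal_group N"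
  using embed_orthogonal orthogonal_group_mult by blast

lemma h_measurable:
  assumes n: "1 \<le> n" "n \<le> N"
  shows "h n \<in> borel_measurable (orthogonal_borel N)"
proof -
  have "(\<lambda>(A, V). F (embed N n V * A)) \<in> borel_measurable (\<mu> N \<Otimes>\<^sub>M \<mu> n)"
    unfolding split_beta by (rule F_embed_measurable[OF n(2) snd_n[OF n] fst_n[OF N order_refl]])
  from bounded_Fubini(2)[OF prob_n[OF N order_refl] prob_n[OF n] this, of B]
  have "(\<lambda>A. \<integral>V. F (embed N n V * A) \<partial>\<mu> n) \<in> borel_measurable (\<mu> N)"
    using F_bounded embed_mult_in n by (simp add: space_n N)
  then show ?thesis unfolding h_def measurable_n(1)[OF N order_refl] .
qed

lemma h_bounded:
  assumes n: "1 \<le> n" "n \<le> N" and A: "A \<in> orthogonal_group N"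
  shows "\<bar>h n A\<bar> \<le> B"
  unfolding h_def
proof (rule abs_integral_le[OF prob_n[OF n]])
  show "(\<lambda>V. F (embed N n V * A)) \<in> borel_measurable (\<mu> n)"
    by (rule F_embed_measurable[OF n(2) id_n[OF n]]) (use A in simp)
qed (use F_bounded embed_mult_in n A in \<open>simp add: space_n\<close>)

text \<open>Right invariance of the Haar measure on O(n): \<open>h n\<close> is constant on the
  orbits of the embedded group, as a conditional expectation should be.\<close>

lemma h_right:
  assumes n: "1 \<le> n" "n \<le> N" and G: "G \<in> orthogonal_group n" and A: "A \<in> orthogonal_group N"
  shows "h n (embed N n G * A) = h n A"
proof -
  interpret H: haar "\<mu> n" n by (rule haar_n[OF n])
  have "h n (embed N n G * A) = (\<integral>V. F (embed N n (V * G) * A) \<partial>\<mu> n)"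
    unfolding h_def
  proof (rule Bochner_Integration.integral_cong[OF refl])
    fix V assume "V \<in> space (\<mu> n)"
    then have V: "V \<in> carrier_mat n n" using orthogonal_groupD(1) by simp
    have "embed N n V * (embed N n G * A) = embed N n V * embed N n G * A"
      using assoc_mult_mat[OF embed_carrier[OF n(2) V] embed_carrier[OF n(2) orthogonal_groupD(1)[OF G]]
        orthogonal_groupD(1)[OF A]] by simp
    then show "F (embed N n V * (embed N n G * A)) = F (embed N n (V * G) * A)"
      by (simp only: embed_mult[OF n(2) V orthogonal_groupD(1)[OF G]])
  qed
  also have "\<dots> = h n A" unfolding h_def
  proof (rule H.integral_right[OF G, of "\<lambda>V. F (embed N n V * A)"])
    show "(\<lambda>V. F (embed N n V * A)) \<in> borel_measurable (orthogonal_borel n)"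
      by (rule F_embed_measurable[OF n(2) measurable_ident_sets[OF refl]]) (use A in simp)
    show "\<bar>F (embed N n V * A)\<bar> \<le> B" if "V \<in> orthogonal_group n" for V
      using F_bounded embed_mult_in n that A by blast
  qed
  finally show ?thesis .
qed

text \<open>The martingale property. After Fubini the element \<open>W\<close> of the smaller group
  is absorbed into the average over \<open>g\<close> by left invariance on O(n).\<close>

lemma h_tower:
  assumes n: "2 \<le> n" "n \<le> N" and A: "A \<in> orthogonal_group N"
  shows "(\<integral>g. h (n - 1) (embed N n g * A) \<partial>\<mu> n) = h n A"
proof -
  have n1: "1 \<le> n" "1 \<le> n - 1" "n - 1 \<le> N" "n - 1 \<le> n" using n by auto
  interpret H: haar "\<mu> n" n by (rule haar_n[OF n1(1) n(2)])
  let ?f = "\<lambda>g W. F (embed N (n - 1) W * (embed N n g * A))"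
  have Ac: "(\<lambda>_. A) \<in> measurable M (orthogonal_borel N)" for M :: "'b measure" using A by simp
  have m: "(\<lambda>(g, W). ?f g W) \<in> borel_measurable (\<mu> n \<Otimes>\<^sub>M \<mu> (n - 1))"
    unfolding split_beta
    by (rule F_embed_measurable[OF n1(3) snd_n[OF n1(2,3)]
        measurable_mat_mult[OF embed_measurable[OF n(2) fst_n[OF n1(1) n(2)]] Ac]])
  have "(\<integral>g. h (n - 1) (embed N n g * A) \<partial>\<mu> n) = (\<integral>W. (\<integral>g. ?f g W \<partial>\<mu> n) \<partial>\<mu> (n - 1))"
    unfolding h_def
    by (rule bounded_Fubini(1)[OF prob_n[OF n1(1) n(2)] prob_n[OF n1(2,3)] m, of B])
      (use F_bounded embed_mult_in n n1 A in \<open>simp add: space_n\<close>)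
  also have "\<dots> = (\<integral>W. h n A \<partial>\<mu> (n - 1))"
  proof (rule Bochner_Integration.integral_cong[OF refl])
    fix W assume "W \<in> space (\<mu> (n - 1))"
    then have W: "W \<in> orthogonal_group (n - 1)" using space_n n1 by simp
    have eW: "embed n (n - 1) W \<in> orthogonal_group n" using embed_orthogonal[OF n1(4) W] .
    have "(\<integral>g. ?f g W \<partial>\<mu> n) = (\<integral>g. F (embed N n (embed n (n - 1) W * g) * A) \<partial>\<mu> n)"
    proof (rule Bochner_Integration.integral_cong[OF refl])
      fix g assume "g \<in> space (\<mu> n)"
      then have g: "g \<in> carrier_mat n n" using orthogonal_groupD(1) by simp
      have "embed N (n - 1) W = embed N n (embed n (n - 1) W)"
        using embed_embed[OF n1(4) n(2) orthogonal_groupD(1)[OF W]] by simp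
      then have "embed N (n - 1) W * (embed N n g * A) =
          embed N n (embed n (n - 1) W) * embed N n g * A"
        using assoc_mult_mat[OF embed_carrier[OF n(2) orthogonal_groupD(1)[OF eW]]
          embed_carrier[OF n(2) g] orthogonal_groupD(1)[OF A]] by simp
      then show "?f g W = F (embed N n (embed n (n - 1) W * g) * A)"
        by (simp only: embed_mult[OF n(2) orthogonal_groupD(1)[OF eW] g])
    qed
    also have "\<dots> = h n A" unfolding h_def
      by (rule H.integral_left[OF eW]) (rule F_embed_measurable[OF n(2) measurable_ident_sets[OF refl] Ac])
    finally show "(\<integral>g. ?f g W \<partial>\<mu> n) = h n A" .
  qed
  also have "\<dots> = h n A" by (rule const_n[OF n1(2,3)])
  finally show ?thesis .
qed

lemma h_embed_measurable:
  assumes "1 \<le> m" "m \<le> N" "n \<le> N" "f \<in> measurable M (orthogonal_borel n)" "g \<in> measurable M (orthogonal_borel N)"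
  shows "(\<lambda>x. h m (embed N n (f x) * g x)) \<in> borel_measurable M"
  using measurable_compose[OF measurable_mat_mult[OF embed_measurable[OF assms(3,4)] assms(5)] h_measurable[OF assms(1,2)]] .

lemma B_nonneg: "0 \<le> B"
  using F_bounded[OF orthogonal_group_one] by linarith

lemma abs_mult_le_B2: "\<bar>x\<bar> \<le> B \<Longrightarrow> \<bar>y\<bar> \<le> B \<Longrightarrow> \<bar>x * y\<bar> \<le> B * B"
  unfolding abs_mult using B_nonneg by (intro mult_mono) auto

lemma abs_square_le_B2: "\<bar>x\<bar> \<le> B \<Longrightarrow> \<bar>x\<^sup>2\<bar> \<le> B * B"
  unfolding power2_eq_square by (rule abs_mult_le_B2)

text \<open>The projection property of conditional expectation: replacing U by gU leaves
  \<open>h n\<close> unchanged, while the average over g turns \<open>h (n - 1)\<close> into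
  \<open>h n\<close>.\<close>

lemma h_product:
  assumes n: "2 \<le> n" "n \<le> N"
  shows "(\<integral>U. h n U * h (n - 1) U \<partial>\<mu> N) = K n"
proof -
  have n1: "1 \<le> n" "1 \<le> n - 1" "n - 1 \<le> N" using n by auto
  interpret HN: haar "\<mu> N" N by (rule haar_n[OF N order_refl])
  let ?f = "\<lambda>g U. h n U * h (n - 1) (embed N n g * U)"
  have m: "(\<lambda>(g, U). ?f g U) \<in> borel_measurable (\<mu> n \<Otimes>\<^sub>M \<mu> N)"
    unfolding split_beta
    by (intro borel_measurable_times measurable_compose[OF snd_n[OF N order_refl] h_measurable[OF n1(1) n(2)]]
      h_embed_measurable[OF n1(2,3) n(2) fst_n[OF n1(1) n(2)] snd_n[OF N order_refl]])
  have hh: "(\<lambda>U. h n U * h (n - 1) U) \<in> borel_measurable (orthogonal_borel N)"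
    by (intro borel_measurable_times h_measurable n1 n)
  have "(\<integral>U. h n U * h (n - 1) U \<partial>\<mu> N) = (\<integral>g. (\<integral>U. ?f g U \<partial>\<mu> N) \<partial>\<mu> n)"
  proof -
    have "(\<integral>U. ?f g U \<partial>\<mu> N) = (\<integral>U. h n U * h (n - 1) U \<partial>\<mu> N)" if "g \<in> space (\<mu> n)" for g
    proof -
      have g: "g \<in> orthogonal_group n" using that space_n n1 n by simp
      have "(\<integral>U. ?f g U \<partial>\<mu> N) = (\<integral>U. h n (embed N n g * U) * h (n - 1) (embed N n g * U) \<partial>\<mu> N)"
        by (rule Bochner_Integration.integral_cong[OF refl]) (simp add: h_right[OF n1(1) n(2) g])
      also have "\<dots> = (\<integral>U. h n U * h (n - 1) U \<partial>\<mu> N)"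
        by (rule HN.integral_left[OF embed_orthogonal[OF n(2) g] hh])
      finally show ?thesis .
    qed
    then have "(\<integral>g. (\<integral>U. ?f g U \<partial>\<mu> N) \<partial>\<mu> n) = (\<integral>g. (\<integral>U. h n U * h (n - 1) U \<partial>\<mu> N) \<partial>\<mu> n)"
      by (rule Bochner_Integration.integral_cong[OF refl])
    then show ?thesis by (simp only: const_n[OF n1(1) n(2)])
  qed
  also have "\<dots> = (\<integral>U. (\<integral>g. ?f g U \<partial>\<mu> n) \<partial>\<mu> N)"
  proof (rule bounded_Fubini(1)[OF prob_n[OF n1(1) n(2)] prob_n[OF N order_refl] m, of "B * B"])
    fix g U assume "g \<in> space (\<mu> n)" "U \<in> space (\<mu> N)"
    then show "\<bar>?f g U\<bar> \<le> B * B"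
      using n n1 embed_mult_in[OF n(2)] by (intro abs_mult_le_B2 h_bounded) (simp_all add: space_n)
  qed
  also have "\<dots> = (\<integral>U. (h n U)\<^sup>2 \<partial>\<mu> N)"
  proof (rule Bochner_Integration.integral_cong[OF refl])
    fix U assume "U \<in> space (\<mu> N)"
    then have U: "U \<in> orthogonal_group N" by simp
    show "(\<integral>g. ?f g U \<partial>\<mu> n) = (h n U)\<^sup>2"
      by (simp only: Bochner_Integration.integral_mult_right_zero h_tower[OF n U] power2_eq_square)
  qed
  finally show ?thesis by (simp add: K_def)
qed

text \<open>On one orbit, \<open>h (n - 1)\<close> at U and at gU behave like two conditionally
  independent copies, and the mean squared difference of such copies is twice the conditional
  variance.\<close>

lemma K_difference:
  assumes n: "2 \<le> n" "n \<le> N"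
  shows "(\<integral>g. (\<integral>U. (h (n - 1) (embed N n g * U) - h (n - 1) U)\<^sup>2 \<partial>\<mu> N) \<partial>\<mu> n) = 2 * (K (n - 1) - K n)"
proof -
  have n1: "1 \<le> n" "1 \<le> n - 1" "n - 1 \<le> N" using n by auto
  interpret HN: haar "\<mu> N" N by (rule haar_n[OF N order_refl])
  let ?h = "h (n - 1)"
  let ?f = "\<lambda>g U. ?h U * ?h (embed N n g * U)"
  note idN = id_n[OF N order_refl]
  have m: "(\<lambda>(g, U). ?f g U) \<in> borel_measurable (\<mu> n \<Otimes>\<^sub>M \<mu> N)"
    unfolding split_beta
    by (intro borel_measurable_times measurable_compose[OF snd_n[OF N order_refl] h_measurable[OF n1(2,3)]]
      h_embed_measurable[OF n1(2,3) n(2) fst_n[OF n1(1) n(2)] snd_n[OF N order_refl]])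
  have fB: "\<bar>?f g U\<bar> \<le> B * B" if "g \<in> space (\<mu> n)" "U \<in> space (\<mu> N)" for g U
    using that n n1 embed_mult_in[OF n(2)] by (intro abs_mult_le_B2 h_bounded) (simp_all add: space_n)
  have h2: "(\<lambda>U. (?h U)\<^sup>2) \<in> borel_measurable (orthogonal_borel N)"
    by (intro borel_measurable_power h_measurable n1)
  have inner: "(\<integral>U. (?h (embed N n g * U) - ?h U)\<^sup>2 \<partial>\<mu> N) = 2 * K (n - 1) - 2 * (\<integral>U. ?f g U \<partial>\<mu> N)"
    if "g \<in> space (\<mu> n)" for g
  proof -
    have g: "g \<in> orthogonal_group n" using that space_n n1 n by simp
    note eg = embed_orthogonal[OF n(2) g]
    have mg: "(\<lambda>U. ?h (embed N n g * U)) \<in> borel_measurable (\<mu> N)"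
      by (rule h_embed_measurable[OF n1(2,3) n(2) _ idN]) (use g in simp)
    have mh: "?h \<in> borel_measurable (\<mu> N)" using h_measurable[OF n1(2,3)] HN.measurable_haar by simp
    have i1: "integrable (\<mu> N) (\<lambda>U. (?h (embed N n g * U))\<^sup>2)"
    proof (rule bounded_integrable[OF prob_n[OF N order_refl]])
      show "(\<lambda>U. (?h (embed N n g * U))\<^sup>2) \<in> borel_measurable (\<mu> N)"
        by (rule borel_measurable_power[OF mg])
      show "\<bar>(?h (embed N n g * U))\<^sup>2\<bar> \<le> B * B" if "U \<in> space (\<mu> N)" for U
        using that by (intro abs_square_le_B2 h_bounded[OF n1(2,3)] embed_mult_in[OF n(2) g]) simp
    qed
    have i2: "integrable (\<mu> N) (\<lambda>U. (?h U)\<^sup>2)"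
    proof (rule bounded_integrable[OF prob_n[OF N order_refl]])
      show "(\<lambda>U. (?h U)\<^sup>2) \<in> borel_measurable (\<mu> N)"
        by (rule borel_measurable_power[OF mh])
      show "\<bar>(?h U)\<^sup>2\<bar> \<le> B * B" if "U \<in> space (\<mu> N)" for U
        using that by (intro abs_square_le_B2 h_bounded[OF n1(2,3)]) simp
    qed
    have i3: "integrable (\<mu> N) (\<lambda>U. ?f g U)"
      by (rule bounded_integrable[OF prob_n[OF N order_refl], of _ "B * B"])
        (use mg mh fB[OF that] in auto)
    have "(\<integral>U. (?h (embed N n g * U) - ?h U)\<^sup>2 \<partial>\<mu> N) =
        (\<integral>U. (?h (embed N n g * U))\<^sup>2 + (?h U)\<^sup>2 - 2 * ?f g U \<partial>\<mu> N)"
      by (intro Bochner_Integration.integral_cong refl) (simp add: power2_eq_square algebra_simps)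
    also have "\<dots> = (\<integral>U. (?h (embed N n g * U))\<^sup>2 \<partial>\<mu> N) + K (n - 1) - 2 * (\<integral>U. ?f g U \<partial>\<mu> N)"
      unfolding K_def using i1 i2 i3
      by (simp add: Bochner_Integration.integral_diff Bochner_Integration.integral_add)
    also have "(\<integral>U. (?h (embed N n g * U))\<^sup>2 \<partial>\<mu> N) = K (n - 1)"
      unfolding K_def by (rule HN.integral_left[OF eg h2])
    finally show ?thesis by simp
  qed
  have "(\<integral>g. (\<integral>U. (?h (embed N n g * U) - ?h U)\<^sup>2 \<partial>\<mu> N) \<partial>\<mu> n) =
      (\<integral>g. 2 * K (n - 1) - 2 * (\<integral>U. ?f g U \<partial>\<mu> N) \<partial>\<mu> n)"
    by (rule Bochner_Integration.integral_cong[OF refl inner])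
  also have "\<dots> = 2 * K (n - 1) - 2 * (\<integral>g. (\<integral>U. ?f g U \<partial>\<mu> N) \<partial>\<mu> n)"
  proof -
    have "integrable (\<mu> n) (\<lambda>g. \<integral>U. ?f g U \<partial>\<mu> N)"
    proof (rule bounded_integrable[OF prob_n[OF n1(1) n(2)], of _ "B * B"])
      show "(\<lambda>g. \<integral>U. ?f g U \<partial>\<mu> N) \<in> borel_measurable (\<mu> n)"
        by (rule bounded_Fubini(2)[OF prob_n[OF n1(1) n(2)] prob_n[OF N order_refl] m fB])
      fix g assume g: "g \<in> space (\<mu> n)"
      then have g': "g \<in> orthogonal_group n" using space_n n1 n by simp
      show "\<bar>\<integral>U. ?f g U \<partial>\<mu> N\<bar> \<le> B * B"
      proof (rule abs_integral_le[OF prob_n[OF N order_refl] _ fB[OF g]])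
        show "?f g \<in> borel_measurable (\<mu> N)"
          by (intro borel_measurable_times h_embed_measurable[OF n1(2,3) n(2) _ idN]
            measurable_compose[OF idN h_measurable[OF n1(2,3)]]) (use g' in simp)
      qed
    qed
    then show ?thesis
      by (subst Bochner_Integration.integral_diff)
        (use finite_measure.integrable_const[OF prob_space.finite_measure[OF prob_n[OF n1(1) n(2)]]]
          in \<open>simp_all only: const_n[OF n1(1) n(2)] Bochner_Integration.integral_mult_right_zero
            Bochner_Integration.integrable_mult_right\<close>)
  qed
  also have "(\<integral>g. (\<integral>U. ?f g U \<partial>\<mu> N) \<partial>\<mu> n) = (\<integral>U. (\<integral>g. ?f g U \<partial>\<mu> n) \<partial>\<mu> N)"
    by (rule bounded_Fubini(1)[OF prob_n[OF n1(1) n(2)] prob_n[OF N order_refl] m fB])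
  also have "\<dots> = (\<integral>U. h n U * h (n - 1) U \<partial>\<mu> N)"
  proof (rule Bochner_Integration.integral_cong[OF refl])
    fix U assume "U \<in> space (\<mu> N)"
    then have U: "U \<in> orthogonal_group N" by simp
    show "(\<integral>g. ?f g U \<partial>\<mu> n) = h n U * h (n - 1) U"
      by (simp only: Bochner_Integration.integral_mult_right_zero h_tower[OF n U] mult.commute)
  qed
  also have "\<dots> = K n" by (rule h_product[OF n])
  finally show ?thesis by simp
qed

end

lemma square_integral_le:
  fixes f :: "'a \<Rightarrow> real"
  assumes M: "prob_space M" and f: "f \<in> borel_measurable M" "\<And>x. x \<in> space M \<Longrightarrow> \<bar>f x\<bar> \<le> B"
  shows "(\<integral>x. f x \<partial>M)\<^sup>2 \<le> (\<integral>x. (f x)\<^sup>2 \<partial>M)"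
proof -
  interpret prob_space M by fact
  have "integrable M (\<lambda>x. (f x)\<^sup>2)"
  proof (rule bounded_integrable[OF M])
    show "(\<lambda>x. (f x)\<^sup>2) \<in> borel_measurable M" using f(1) by (rule borel_measurable_power)
    show "\<bar>(f x)\<^sup>2\<bar> \<le> B\<^sup>2" if "x \<in> space M" for x
      using power_mono[OF f(2)[OF that] abs_ge_zero, of 2] by simp
  qed
  from variance_eq[OF bounded_integrable[OF M f] this]
  have "variance f = (\<integral>x. (f x)\<^sup>2 \<partial>M) - (\<integral>x. f x \<partial>M)\<^sup>2" .
  moreover have "0 \<le> variance f" by (rule variance_positive)
  ultimately show ?thesis by linarith
qed

lemma embed_row:
  "n \<le> N \<Longrightarrow> V \<in> carrier_mat n n \<Longrightarrow> i < N - n \<Longrightarrow> k < N \<Longrightarrow> embed N n V $$ (i, k) = unit_fun i k"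
  by (subst embed_index) (auto simp: unit_fun_def)

lemma embed_col:
  "n \<le> N \<Longrightarrow> V \<in> carrier_mat n n \<Longrightarrow> k < N - n \<Longrightarrow> i < N \<Longrightarrow> embed N n V $$ (i, k) = unit_fun k i"
  by (subst embed_index) (auto simp: unit_fun_def)

lemma mv_refl_fixed: "i < N \<Longrightarrow> ip N w x = 0 \<Longrightarrow> mv N (refl_mat N w) x i = x i"
  by (simp add: mv_refl)

text \<open>\<open>W\<close> fixes axis \<open>j\<close> and rotates row \<open>j\<close> of
  \<open>G\<close>, so it commutes with the construction of the normal.\<close>

lemma row_normal_mult:
  assumes G: "G \<in> carrier_mat N N" and W: "W \<in> carrier_mat N N" and j: "j < N"
    and row: "\<And>k. k < N \<Longrightarrow> W $$ (j, k) = unit_fun j k" and col: "\<And>i. i < N \<Longrightarrow> W $$ (i, j) = unit_fun j i"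
    and i: "i < N"
  shows "row_normal j (G * transpose_mat W) i = mv N W (row_normal j G) i"
proof -
  have e: "mv N W (unit_fun j) i = unit_fun j i" using i j col by (simp add: mv_unit_fun)
  have r: "(G * transpose_mat W) $$ (j, k) = mv N W (\<lambda>l. G $$ (j, l)) k" if "k < N" for k
    using row_mult[OF G W j that] .
  have "mv N W (\<lambda>l. G $$ (j, l)) j = ip N (unit_fun j) (\<lambda>l. G $$ (j, l))"
    unfolding mv_def ip_def using row by (intro sum.cong) auto
  then have jj: "(G * transpose_mat W) $$ (j, j) = G $$ (j, j)"
    unfolding r[OF j] ip_unit_fun_left[OF j] .
  have s: "row_sign j (G * transpose_mat W) = row_sign j G" unfolding row_sign_def jj ..
  have "mv N W (row_normal j G) i = mv N W (\<lambda>i. (1 / sqrt (2 - 2 * row_sign j G * G $$ (j, j))) *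
    (unit_fun j i - row_sign j G * G $$ (j, i))) i"
    unfolding row_normal_def ..
  also have "\<dots> = (1 / sqrt (2 - 2 * row_sign j G * G $$ (j, j))) *
    (unit_fun j i - row_sign j G * mv N W (\<lambda>l. G $$ (j, l)) i)"
    unfolding mv_scale mv_diff e ..
  also have "\<dots> = row_normal j (G * transpose_mat W) i"
    unfolding row_normal_def s jj r[OF i] ..
  finally show ?thesis by simp
qed

section \<open>One step of the martingale as one reflection\<close>

context rotation_chain
begin

text \<open>The flip of a coordinate outside the last \<open>m\<close> commutes with the embedded
  group, so the invariance passes from \<open>F\<close> to \<open>h m\<close>. It is needed because
  \<open>row_sign\<close> may be -1.\<close>

lemma h_flip:
  assumes m: "1 \<le> m" "m \<le> N" and j: "j < N - m" and A: "A \<in> orthogonal_group N"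
  shows "h m (refl_mat N (unit_fun j) * A) = h m A"
  unfolding h_def
proof (rule Bochner_Integration.integral_cong[OF refl])
  fix V assume "V \<in> space (\<mu> m)"
  then have V: "V \<in> orthogonal_group m" using space_n m by simp
  note Vc = orthogonal_groupD(1)[OF V]
  note eV = embed_orthogonal[OF m(2) V]
  let ?R = "refl_mat N (unit_fun j)"
  have "embed N m V * ?R = ?R * embed N m V"
  proof (rule refl_conjugate[OF eV])
    fix i assume "i < N"
    then show "unit_fun j i = mv N (embed N m V) (unit_fun j) i"
      using j embed_col[OF m(2) Vc j] by (simp add: mv_unit_fun)
  qed
  note comm = this
  have "embed N m V * (?R * A) = embed N m V * ?R * A"
    by (rule assoc_mult_mat[OF orthogonal_groupD(1)[OF eV] refl_mat_carrier orthogonal_groupD(1)[OF A], symmetric])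
  also have "\<dots> = ?R * embed N m V * A" by (simp only: comm)
  also have "\<dots> = ?R * (embed N m V * A)"
    by (rule assoc_mult_mat[OF refl_mat_carrier orthogonal_groupD(1)[OF eV] orthogonal_groupD(1)[OF A]])
  finally have "embed N m V * (?R * A) = ?R * (embed N m V * A)" .
  then show "F (embed N m V * (?R * A)) = F (embed N m V * A)"
    using flip[of j "embed N m V * A"] j embed_mult_in[OF m(2) V A] by simp
qed

text \<open>Write G = Q R, where R takes row j = N - n of G to plus or minus the unit vector. Then Q
  lies in the embedded O(n - 1) up to a flip of coordinate j, and \<open>h (n - 1)\<close> does not
  see either.\<close>

lemma h_reflect:
  assumes n: "2 \<le> n" "n \<le> N" and g: "g \<in> orthogonal_group n" and U: "U \<in> orthogonal_group N"
  shows "h (n - 1) (embed N n g * U) = h (n - 1) (refl_mat N (row_normal (N - n) (embed N n g)) * U)"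
proof -
  have n1: "1 \<le> n" "1 \<le> n - 1" "n - 1 \<le> N" using n by auto
  define j where "j = N - n"
  have j: "j < N" "N - (n - 1) = Suc j" using n by (auto simp: j_def)
  define G where "G = embed N n g"
  have G: "G \<in> orthogonal_group N" unfolding G_def using embed_orthogonal[OF n(2) g] .
  define R where "R = refl_mat N (row_normal j G)"
  have R: "R \<in> orthogonal_group N" unfolding R_def by (rule row_refl_orthogonal[OF G j(1)])
  define E where "E = refl_mat N (unit_fun j)"
  have E: "E \<in> orthogonal_group N" unfolding E_def using j(1) by (intro refl_mat_orthogonal(1)) (simp add: ip_unit_unit)
  note Gc = orthogonal_groupD(1)[OF G] and Rc = orthogonal_groupD(1)[OF R] and Ec = orthogonal_groupD(1)[OF E]
    and Uc = orthogonal_groupD(1)[OF U]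
  have Rt: "transpose_mat R = R" and Et: "transpose_mat E = E" by (simp_all add: R_def E_def)
  define Q where "Q = G * R"
  have Q: "Q \<in> orthogonal_group N" unfolding Q_def by (rule orthogonal_group_mult[OF G R])
  note Qc = orthogonal_groupD(1)[OF Q]
  have GQ: "G = Q * R" using orthogonal_cancel(4)[OF R Gc] by (simp add: Q_def Rt)
  have Grow: "G $$ (i, k) = unit_fun i k" if "i < j" "k < N" for i k
    unfolding G_def using that embed_row[OF n(2) orthogonal_groupD(1)[OF g]] by (simp add: j_def)
  have Gcol: "G $$ (i, k) = unit_fun k i" if "k < j" "i < N" for i k
    unfolding G_def using that embed_col[OF n(2) orthogonal_groupD(1)[OF g]] by (simp add: j_def)
  have Qrow: "Q $$ (i, k) = unit_fun i k" if i: "i < j" and k: "k < N" for i k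
  proof -
    have iN: "i < N" using i j by simp
    have "Q $$ (i, k) = mv N R (\<lambda>l. G $$ (i, l)) k"
      using row_mult[OF Gc Rc iN k] by (simp add: Q_def Rt)
    also have "\<dots> = mv N R (unit_fun i) k" using Grow[OF i] by (intro mv_cong) simp
    also have "\<dots> = unit_fun i k"
    proof -
      \<comment> \<open>An embedded matrix has zeros in row j left of the diagonal, so the normal
        has no component along the first j axes and R fixes them.\<close>
      have "row_normal j G i = 0" using i Gcol[OF i j(1)] by (simp add: row_normal_def unit_fun_def)
      then show ?thesis unfolding R_def using iN k by (intro mv_refl_fixed) (simp_all add: ip_unit_fun_right)
    qed
    finally show ?thesis .
  qed
  have Qrowj: "Q $$ (j, k) = row_sign j G * unit_fun j k" if k: "k < N" for k
    using row_mult[OF Gc Rc j(1) k] refl_row_normal[OF G j(1) k] by (simp add: Q_def Rt) (simp add: R_def)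
  have RU: "R * U \<in> orthogonal_group N" by (rule orthogonal_group_mult[OF R U])
  have "h (n - 1) (G * U) = h (n - 1) (Q * (R * U))"
    by (subst GQ) (simp only: assoc_mult_mat[OF Qc Rc Uc])
  also have "\<dots> = h (n - 1) (R * U)"
  proof (cases "row_sign j G = 1")
    case True
    have "\<exists>V\<in>orthogonal_group (n - 1). Q = embed N (n - 1) V"
    proof (rule embed_surj[OF n1(3) Q])
      fix i k assume "i < N - (n - 1)" "k < N"
      then show "Q $$ (i, k) = unit_fun i k" using Qrow[of i k] Qrowj[of k] True j
        by (cases "i = j") auto
    qed
    then show ?thesis using h_right[OF n1(2,3) _ RU] by auto
  next
    case False
    then have s: "row_sign j G = - 1" by (auto simp: row_sign_def split: if_splits)
    \<comment> \<open>Row j of \<open>Q\<close> is now minus the unit vector; \<open>E\<close>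
      repairs the sign and is removed again by \<open>h_flip\<close>.\<close>
    define Q' where "Q' = Q * E"
    have Q': "Q' \<in> orthogonal_group N" unfolding Q'_def by (rule orthogonal_group_mult[OF Q E])
    have QQ': "Q = Q' * E" using orthogonal_cancel(4)[OF E Qc] by (simp add: Q'_def Et)
    have "\<exists>V\<in>orthogonal_group (n - 1). Q' = embed N (n - 1) V"
    proof (rule embed_surj[OF n1(3) Q'])
      fix i k assume i: "i < N - (n - 1)" and k: "k < N"
      then have iN: "i < N" using n by simp
      have "Q' $$ (i, k) = mv N E (\<lambda>l. Q $$ (i, l)) k"
        using row_mult[OF Qc Ec iN k] by (simp add: Q'_def Et)
      also have "\<dots> = Q $$ (i, k) - 2 * Q $$ (i, j) * unit_fun j k"
        unfolding E_def using k j by (simp add: mv_refl ip_unit_fun_left)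
      also have "\<dots> = unit_fun i k"
      proof (cases "i = j")
        case True
        then show ?thesis using Qrowj[OF k] Qrowj[OF j(1)] s by (simp add: unit_fun_self)
      next
        case False
        then have "i < j" using i j by simp
        then show ?thesis using Qrow[OF _ k, of i] Qrow[OF _ j(1), of i] by (simp add: unit_fun_def)
      qed
      finally show "Q' $$ (i, k) = unit_fun i k" .
    qed
    then obtain V where V: "V \<in> orthogonal_group (n - 1)" "Q' = embed N (n - 1) V" by blast
    have "h (n - 1) (Q * (R * U)) = h (n - 1) (Q' * (E * (R * U)))"
      by (subst QQ') (simp only: assoc_mult_mat[OF orthogonal_groupD(1)[OF Q'] Ec orthogonal_groupD(1)[OF RU]])
    also have "\<dots> = h (n - 1) (E * (R * U))"
      unfolding V(2) by (rule h_right[OF n1(2,3) V(1) orthogonal_group_mult[OF E RU]])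
    also have "\<dots> = h (n - 1) (R * U)"
      unfolding E_def by (rule h_flip[OF n1(2,3) _ RU]) (use j in simp)
    finally show ?thesis .
  qed
  finally show ?thesis unfolding G_def R_def j_def .
qed

lemma abs_F_diff_square:
  assumes "X \<in> orthogonal_group N" "Y \<in> orthogonal_group N"
  shows "\<bar>(F X - F Y)\<^sup>2\<bar> \<le> (2 * B)\<^sup>2"
proof -
  have "\<bar>F X - F Y\<bar> \<le> 2 * B" using F_bounded[OF assms(1)] F_bounded[OF assms(2)] by linarith
  then show ?thesis using power_mono[of "\<bar>F X - F Y\<bar>" "2 * B" 2] by simp
qed

lemma D_pair_measurable:
  assumes j: "j < N" and f: "f \<in> measurable M (orthogonal_borel N)" and g: "g \<in> measurable M (orthogonal_borel N)"
  shows "(\<lambda>x. (F (refl_mat N (row_normal j (f x)) * g x) - F (g x))\<^sup>2) \<in> borel_measurable M"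
  by (intro borel_measurable_power borel_measurable_diff measurable_compose[OF _ F_measurable]
    measurable_mat_mult row_refl_measurable j f g)

lemma D_measurable:
  assumes j: "j < N"
  shows "D j \<in> borel_measurable (orthogonal_borel N)"
proof -
  have "(\<lambda>(G, U). (F (refl_mat N (row_normal j G) * U) - F U)\<^sup>2) \<in> borel_measurable (\<mu> N \<Otimes>\<^sub>M \<mu> N)"
    unfolding split_beta by (rule D_pair_measurable[OF j fst_n[OF N order_refl] snd_n[OF N order_refl]])
  moreover have "\<bar>(F (refl_mat N (row_normal j G) * U) - F U)\<^sup>2\<bar> \<le> (2 * B)\<^sup>2"
    if "G \<in> space (\<mu> N)" "U \<in> space (\<mu> N)" for G U
    using that by (intro abs_F_diff_square orthogonal_group_mult row_refl_orthogonal j)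
      (simp_all only: space_n[OF N order_refl])
  ultimately have "(\<lambda>G. \<integral>U. (F (refl_mat N (row_normal j G) * U) - F U)\<^sup>2 \<partial>\<mu> N) \<in> borel_measurable (\<mu> N)"
    by (rule bounded_Fubini(2)[OF prob_n[OF N order_refl] prob_n[OF N order_refl]])
  then show ?thesis unfolding D_def measurable_n(1)[OF N order_refl] .
qed

lemma D_bounded:
  assumes j: "j < N" and G: "G \<in> orthogonal_group N"
  shows "\<bar>D j G\<bar> \<le> (2 * B)\<^sup>2"
  unfolding D_def
proof (rule abs_integral_le[OF prob_n[OF N order_refl]])
  show "(\<lambda>U. (F (refl_mat N (row_normal j G) * U) - F U)\<^sup>2) \<in> borel_measurable (\<mu> N)"
    by (rule D_pair_measurable[OF j _ id_n[OF N order_refl]]) (use G in simp)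
  fix U assume "U \<in> space (\<mu> N)"
  then have "U \<in> orthogonal_group N" using space_n[OF N order_refl] by simp
  then show "\<bar>(F (refl_mat N (row_normal j G) * U) - F U)\<^sup>2\<bar> \<le> (2 * B)\<^sup>2"
    by (intro abs_F_diff_square orthogonal_group_mult row_refl_orthogonal G j)
qed

text \<open>Jensen moves the square inside the average over O(n - 1). Conjugation then carries the
  reflection past \<open>W\<close>, which changes its normal to that of G times the transpose of
  \<open>W\<close>, and left invariance in U absorbs the remaining \<open>W\<close>.\<close>

lemma reflection_energy_le:
  assumes n: "2 \<le> n" "n \<le> N" and g: "g \<in> orthogonal_group n"
  defines "R \<equiv> refl_mat N (row_normal (N - n) (embed N n g))"
  shows "(\<integral>U. (h (n - 1) (R * U) - h (n - 1) U)\<^sup>2 \<partial>\<mu> N) \<le>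
    (\<integral>W. D (N - n) (embed N n g * transpose_mat (embed N (n - 1) W)) \<partial>\<mu> (n - 1))"
proof -
  have n1: "1 \<le> n" "1 \<le> n - 1" "n - 1 \<le> N" "N - n < N" using n by auto
  interpret HN: haar "\<mu> N" N by (rule haar_n[OF N order_refl])
  let ?G = "embed N n g" and ?E = "embed N (n - 1)"
  have G: "?G \<in> orthogonal_group N" by (rule embed_orthogonal[OF n(2) g])
  have R: "R \<in> orthogonal_group N" unfolding R_def by (rule row_refl_orthogonal[OF G n1(4)])
  have Rm: "(\<lambda>_. R) \<in> measurable M (orthogonal_borel N)" for M :: "'b measure" using R by simp
  let ?f = "\<lambda>U W. (F (?E W * (R * U)) - F (?E W * U))\<^sup>2"
  have m: "(\<lambda>(U, W). ?f U W) \<in> borel_measurable (\<mu> N \<Otimes>\<^sub>M \<mu> (n - 1))"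
    unfolding split_beta
    by (intro borel_measurable_power borel_measurable_diff F_embed_measurable[OF n1(3) snd_n[OF n1(2,3)]]
      measurable_mat_mult Rm fst_n[OF N order_refl])
  have fB: "\<bar>?f U W\<bar> \<le> (2 * B)\<^sup>2" if "U \<in> space (\<mu> N)" "W \<in> space (\<mu> (n - 1))" for U W
    using that by (intro abs_F_diff_square embed_mult_in[OF n1(3)] orthogonal_group_mult R)
      (simp_all only: space_n[OF n1(2,3)] space_n[OF N order_refl])
  have mh: "(\<lambda>U. (h (n - 1) (R * U) - h (n - 1) U)\<^sup>2) \<in> borel_measurable (\<mu> N)"
    by (intro borel_measurable_power borel_measurable_diff measurable_compose[OF _ h_measurable[OF n1(2,3)]]
      measurable_mat_mult Rm id_n[OF N order_refl])
  have jensen: "(h (n - 1) (R * U) - h (n - 1) U)\<^sup>2 \<le> (\<integral>W. ?f U W \<partial>\<mu> (n - 1))" if "U \<in> space (\<mu> N)" for U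
  proof -
    have U: "U \<in> orthogonal_group N" using that by simp
    note RU = orthogonal_group_mult[OF R U]
    have mA: "(\<lambda>W. F (?E W * A)) \<in> borel_measurable (\<mu> (n - 1))" if "A \<in> orthogonal_group N" for A
      by (rule F_embed_measurable[OF n1(3) id_n[OF n1(2,3)]]) (use that in simp)
    have bA: "\<bar>F (?E W * A)\<bar> \<le> B" if "W \<in> space (\<mu> (n - 1))" "A \<in> orthogonal_group N" for W A
      using that by (intro F_bounded embed_mult_in[OF n1(3)]) (simp_all only: space_n[OF n1(2,3)])
    have "h (n - 1) (R * U) - h (n - 1) U = (\<integral>W. F (?E W * (R * U)) - F (?E W * U) \<partial>\<mu> (n - 1))"
      unfolding h_def
      by (rule Bochner_Integration.integral_diff[symmetric])
        (rule bounded_integrable[OF prob_n[OF n1(2,3)] mA bA]; use U RU in simp)+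
    also have "(\<dots>)\<^sup>2 \<le> (\<integral>W. ?f U W \<partial>\<mu> (n - 1))"
    proof (rule square_integral_le[OF prob_n[OF n1(2,3)]])
      show "(\<lambda>W. F (?E W * (R * U)) - F (?E W * U)) \<in> borel_measurable (\<mu> (n - 1))"
        by (intro borel_measurable_diff mA U RU)
      show "\<bar>F (?E W * (R * U)) - F (?E W * U)\<bar> \<le> 2 * B" if "W \<in> space (\<mu> (n - 1))" for W
        using bA[OF that U] bA[OF that RU] by linarith
    qed
    finally show ?thesis .
  qed
  have "(\<integral>U. (h (n - 1) (R * U) - h (n - 1) U)\<^sup>2 \<partial>\<mu> N) \<le> (\<integral>U. (\<integral>W. ?f U W \<partial>\<mu> (n - 1)) \<partial>\<mu> N)"
  proof (rule integral_mono[OF _ _ jensen])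
    have bW: "\<bar>\<integral>W. ?f U W \<partial>\<mu> (n - 1)\<bar> \<le> (2 * B)\<^sup>2" if "U \<in> space (\<mu> N)" for U
    proof (rule abs_integral_le[OF prob_n[OF n1(2,3)] _ fB[OF that]])
      show "?f U \<in> borel_measurable (\<mu> (n - 1))"
        by (intro borel_measurable_power borel_measurable_diff F_embed_measurable[OF n1(3) id_n[OF n1(2,3)]])
          (use that in \<open>simp_all add: orthogonal_group_mult[OF R]\<close>)
    qed
    show "integrable (\<mu> N) (\<lambda>U. \<integral>W. ?f U W \<partial>\<mu> (n - 1))"
      by (rule bounded_integrable[OF prob_n[OF N order_refl]
          bounded_Fubini(2)[OF prob_n[OF N order_refl] prob_n[OF n1(2,3)] m fB] bW])
    show "integrable (\<mu> N) (\<lambda>U. (h (n - 1) (R * U) - h (n - 1) U)\<^sup>2)"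
    proof (rule bounded_integrable[OF prob_n[OF N order_refl] mh])
      fix U assume "U \<in> space (\<mu> N)"
      from jensen[OF this] bW[OF this]
      show "\<bar>(h (n - 1) (R * U) - h (n - 1) U)\<^sup>2\<bar> \<le> (2 * B)\<^sup>2" by simp
    qed
  qed
  also have "\<dots> = (\<integral>W. (\<integral>U. ?f U W \<partial>\<mu> N) \<partial>\<mu> (n - 1))"
    by (rule bounded_Fubini(1)[OF prob_n[OF N order_refl] prob_n[OF n1(2,3)] m fB])
  also have "\<dots> = (\<integral>W. D (N - n) (?G * transpose_mat (?E W)) \<partial>\<mu> (n - 1))"
  proof (rule Bochner_Integration.integral_cong[OF refl])
    fix W assume "W \<in> space (\<mu> (n - 1))"
    then have W: "W \<in> orthogonal_group (n - 1)" using space_n[OF n1(2,3)] by simp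
    note Wc = orthogonal_groupD(1)[OF W]
    have EW: "?E W \<in> orthogonal_group N" by (rule embed_orthogonal[OF n1(3) W])
    note EWc = orthogonal_groupD(1)[OF EW]
    have j: "N - n < N - (n - 1)" using n by simp
    let ?R' = "refl_mat N (row_normal (N - n) (?G * transpose_mat (?E W)))"
    have GE: "?G * transpose_mat (?E W) \<in> orthogonal_group N"
      by (rule orthogonal_group_mult[OF G orthogonal_group_transpose[OF EW]])
    \<comment> \<open>\<open>W\<close> fixes axis N - n, as it acts on the last n - 1 coordinates
      only.\<close>
    have ER: "?E W * R = ?R' * ?E W" unfolding R_def
    proof (rule refl_conjugate[OF EW])
      fix i assume "i < N"
      then show "row_normal (N - n) (?G * transpose_mat (?E W)) i = mv N (?E W) (row_normal (N - n) ?G) i"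
        by (intro row_normal_mult[OF orthogonal_groupD(1)[OF G] EWc n1(4)]
          embed_row[OF n1(3) Wc j] embed_col[OF n1(3) Wc j])
    qed
    have "(\<integral>U. ?f U W \<partial>\<mu> N) = (\<integral>U. (F (?R' * (?E W * U)) - F (?E W * U))\<^sup>2 \<partial>\<mu> N)"
    proof (rule Bochner_Integration.integral_cong[OF refl])
      fix U assume "U \<in> space (\<mu> N)"
      then have U: "U \<in> carrier_mat N N" using orthogonal_groupD(1) by simp
      have "?E W * (R * U) = ?R' * (?E W * U)"
        using assoc_mult_mat[OF EWc orthogonal_groupD(1)[OF R] U]
          assoc_mult_mat[OF refl_mat_carrier EWc U] by (simp only: ER)
      then show "?f U W = (F (?R' * (?E W * U)) - F (?E W * U))\<^sup>2" by simp
    qed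
    also have "\<dots> = D (N - n) (?G * transpose_mat (?E W))" unfolding D_def
      by (rule HN.integral_left[OF EW])
        (rule D_pair_measurable[OF n1(4) _ measurable_ident_sets[OF refl]], use GE in simp)
    finally show "(\<integral>U. ?f U W \<partial>\<mu> N) = D (N - n) (?G * transpose_mat (?E W))" .
  qed
  finally show ?thesis .
qed

text \<open>The average over \<open>W\<close> left by \<open>reflection_energy_le\<close>
  disappears: \<open>W\<close> also embeds in O(n), where right invariance of the law of
  \<open>g\<close> absorbs it. The factor 1/2 is the one of \<open>K_difference\<close>.\<close>

lemma K_step:
  assumes n: "2 \<le> n" "n \<le> N"
  shows "K (n - 1) - K n \<le> (1 / 2) * (\<integral>g. D (N - n) (embed N n g) \<partial>\<mu> n)"
proof -
  have n1: "1 \<le> n" "1 \<le> n - 1" "n - 1 \<le> N" "N - n < N" "n - 1 \<le> n" using n by auto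
  interpret HN: haar "\<mu> N" N by (rule haar_n[OF N order_refl])
  interpret Hn: haar "\<mu> n" n by (rule haar_n[OF n1(1) n(2)])
  let ?R = "\<lambda>g. refl_mat N (row_normal (N - n) (embed N n g))"
  let ?e = "\<lambda>g. \<integral>U. (h (n - 1) (?R g * U) - h (n - 1) U)\<^sup>2 \<partial>\<mu> N"
  let ?d = "\<lambda>g W. D (N - n) (embed N n g * transpose_mat (embed N (n - 1) W))"
  have R: "?R g \<in> orthogonal_group N" if "g \<in> space (\<mu> n)" for g
    using that by (intro row_refl_orthogonal embed_orthogonal n n1) simp
  have md: "(\<lambda>(g, W). ?d g W) \<in> borel_measurable (\<mu> n \<Otimes>\<^sub>M \<mu> (n - 1))"
    unfolding split_beta
    by (intro measurable_compose[OF _ D_measurable[OF n1(4)]] measurable_mat_mult measurable_mat_transpose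
      embed_measurable n n1 fst_n snd_n)
  have dB: "\<bar>?d g W\<bar> \<le> (2 * B)\<^sup>2" if "g \<in> space (\<mu> n)" "W \<in> space (\<mu> (n - 1))" for g W
    using that by (intro D_bounded n1 orthogonal_group_mult orthogonal_group_transpose embed_orthogonal n)
      (simp_all only: space_n[OF n1(2,3)] Hn.space_haar)
  have "2 * (K (n - 1) - K n) = (\<integral>g. ?e g \<partial>\<mu> n)"
    unfolding K_difference[OF n, symmetric]
    by (intro Bochner_Integration.integral_cong refl) (simp only: h_reflect[OF n] Hn.space_haar HN.space_haar)
  also have "\<dots> \<le> (\<integral>g. (\<integral>W. ?d g W \<partial>\<mu> (n - 1)) \<partial>\<mu> n)"
  proof (rule integral_mono)
    have hm: "(\<lambda>(g, U). (h (n - 1) (?R g * U) - h (n - 1) U)\<^sup>2) \<in> borel_measurable (\<mu> n \<Otimes>\<^sub>M \<mu> N)"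
      unfolding split_beta
      by (intro borel_measurable_power borel_measurable_diff measurable_compose[OF _ h_measurable[OF n1(2,3)]]
        measurable_mat_mult row_refl_measurable embed_measurable n n1 N order_refl fst_n snd_n)
    have hB: "\<bar>(h (n - 1) (?R g * U) - h (n - 1) U)\<^sup>2\<bar> \<le> (2 * B)\<^sup>2" if "g \<in> space (\<mu> n)" "U \<in> space (\<mu> N)" for g U
    proof -
      have U: "U \<in> orthogonal_group N" using that by simp
      have "\<bar>h (n - 1) (?R g * U) - h (n - 1) U\<bar> \<le> 2 * B"
        using h_bounded[OF n1(2,3) U] h_bounded[OF n1(2,3) orthogonal_group_mult[OF R[OF that(1)] U]] by linarith
      from power_mono[OF this abs_ge_zero, of 2] show ?thesis by simp
    qed
    show "integrable (\<mu> n) ?e"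
    proof (rule bounded_integrable[OF prob_n[OF n1(1) n(2)]
        bounded_Fubini(2)[OF prob_n[OF n1(1) n(2)] prob_n[OF N order_refl] hm hB]])
      fix g assume g: "g \<in> space (\<mu> n)"
      show "\<bar>?e g\<bar> \<le> (2 * B)\<^sup>2"
      proof (rule abs_integral_le[OF prob_n[OF N order_refl] _ hB[OF g]])
        show "(\<lambda>U. (h (n - 1) (?R g * U) - h (n - 1) U)\<^sup>2) \<in> borel_measurable (\<mu> N)"
          by (intro borel_measurable_power borel_measurable_diff measurable_compose[OF _ h_measurable[OF n1(2,3)]]
            measurable_mat_mult id_n[OF N order_refl]) (use R[OF g] in simp)
      qed
    qed
    show "integrable (\<mu> n) (\<lambda>g. \<integral>W. ?d g W \<partial>\<mu> (n - 1))"
    proof (rule bounded_integrable[OF prob_n[OF n1(1) n(2)]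
        bounded_Fubini(2)[OF prob_n[OF n1(1) n(2)] prob_n[OF n1(2,3)] md dB]])
      fix g assume g: "g \<in> space (\<mu> n)"
      then have g': "embed N n g \<in> orthogonal_group N" using embed_orthogonal[OF n(2)] by simp
      show "\<bar>\<integral>W. ?d g W \<partial>\<mu> (n - 1)\<bar> \<le> (2 * B)\<^sup>2"
      proof (rule abs_integral_le[OF prob_n[OF n1(2,3)] _ dB[OF g]])
        show "?d g \<in> borel_measurable (\<mu> (n - 1))"
          by (rule measurable_compose[OF measurable_mat_mult[OF _ measurable_mat_transpose[OF
            embed_measurable[OF n1(3) id_n[OF n1(2,3)]]]] D_measurable[OF n1(4)]]) (use g' in simp)
      qed
    qed
    show "?e g \<le> (\<integral>W. ?d g W \<partial>\<mu> (n - 1))" if "g \<in> space (\<mu> n)" for g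
      using reflection_energy_le[OF n] that by simp
  qed
  also have "\<dots> = (\<integral>W. (\<integral>g. ?d g W \<partial>\<mu> n) \<partial>\<mu> (n - 1))"
    by (rule bounded_Fubini(1)[OF prob_n[OF n1(1) n(2)] prob_n[OF n1(2,3)] md dB])
  also have "\<dots> = (\<integral>W. (\<integral>g. D (N - n) (embed N n g) \<partial>\<mu> n) \<partial>\<mu> (n - 1))"
  proof (rule Bochner_Integration.integral_cong[OF refl])
    fix W assume "W \<in> space (\<mu> (n - 1))"
    then have W: "W \<in> orthogonal_group (n - 1)" using space_n[OF n1(2,3)] by simp
    let ?W = "transpose_mat (embed n (n - 1) W)"
    have EW: "?W \<in> orthogonal_group n"
      by (rule orthogonal_group_transpose[OF embed_orthogonal[OF n1(5) W]])
    have "(\<integral>g. ?d g W \<partial>\<mu> n) = (\<integral>g. D (N - n) (embed N n (g * ?W)) \<partial>\<mu> n)"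
    proof (rule Bochner_Integration.integral_cong[OF refl])
      fix g assume "g \<in> space (\<mu> n)"
      then have g: "g \<in> carrier_mat n n" using orthogonal_groupD(1) by simp
      have "transpose_mat (embed N (n - 1) W) = embed N n ?W"
        using embed_embed[OF n1(5) n(2) orthogonal_groupD(1)[OF W]]
          embed_transpose[OF embed_carrier[OF n1(5) orthogonal_groupD(1)[OF W]], of N] by simp
      then show "?d g W = D (N - n) (embed N n (g * ?W))"
        by (simp only: embed_mult[OF n(2) g orthogonal_groupD(1)[OF EW]])
    qed
    also have "\<dots> = (\<integral>g. D (N - n) (embed N n g) \<partial>\<mu> n)"
    proof (rule Hn.integral_right[OF EW, of "\<lambda>g. D (N - n) (embed N n g)"])
      show "(\<lambda>g. D (N - n) (embed N n g)) \<in> borel_measurable (orthogonal_borel n)"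
        by (rule measurable_compose[OF embed_measurable[OF n(2) measurable_ident_sets[OF refl]] D_measurable[OF n1(4)]])
      show "\<bar>D (N - n) (embed N n A)\<bar> \<le> (2 * B)\<^sup>2" if "A \<in> orthogonal_group n" for A
        by (rule D_bounded[OF n1(4) embed_orthogonal[OF n(2) that]])
    qed
    finally show "(\<integral>g. ?d g W \<partial>\<mu> n) = (\<integral>g. D (N - n) (embed N n g) \<partial>\<mu> n)" .
  qed
  also have "\<dots> = (\<integral>g. D (N - n) (embed N n g) \<partial>\<mu> n)" by (rule const_n[OF n1(2,3)])
  finally show ?thesis by simp
qed

text \<open>O(1) consists of 1 and -1, and -1 embeds as the flip of the last coordinate, under which
  \<open>F\<close> is invariant. The chain can therefore stop at n = 1.\<close>

lemma K_1: "K 1 = (\<integral>A. (F A)\<^sup>2 \<partial>\<mu> N)"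
  unfolding K_def
proof (rule Bochner_Integration.integral_cong[OF refl])
  fix A assume "A \<in> space (\<mu> N)"
  then have A: "A \<in> orthogonal_group N" using space_n[OF N order_refl] by simp
  have "F (embed N 1 V * A) = F A" if "V \<in> space (\<mu> 1)" for V
  proof -
    have V: "V \<in> orthogonal_group 1" using that space_n[of 1] N by simp
    note Vc = orthogonal_groupD(1)[OF V]
    define v where "v = V $$ (0, 0)"
    have "(transpose_mat V * V) $$ (0, 0) = v * v"
      using Vc by (simp add: scalar_prod_def v_def)
    then have "v * v = 1" unfolding orthogonal_groupD(2)[OF V] by simp
    then consider "v = 1" | "v = - 1" by (auto simp: square_eq_1_iff)
    then show ?thesis
    proof cases
      case 1
      have "embed N 1 V = 1\<^sub>m N"
      proof (rule eq_matI)
        fix i k assume "i < dim_row (1\<^sub>m N)" "k < dim_col (1\<^sub>m N)"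
        then have ik: "i < N" "k < N" by simp_all
        have "i - (N - 1) = 0" "k - (N - 1) = 0" using ik by auto
        then show "embed N 1 V $$ (i, k) = 1\<^sub>m N $$ (i, k)"
          unfolding embed_index[OF N Vc ik] using ik 1 by (auto simp: v_def)
      qed (use embed_carrier[OF N Vc] in auto)
      then show ?thesis using orthogonal_groupD(1)[OF A] by simp
    next
      case 2
      have "embed N 1 V = refl_mat N (unit_fun (N - 1))"
      proof (rule eq_matI)
        fix i k assume "i < dim_row (refl_mat N (unit_fun (N - 1)))" "k < dim_col (refl_mat N (unit_fun (N - 1)))"
        then have ik: "i < N" "k < N" by (simp_all add: refl_mat_def)
        have "i - (N - 1) = 0" "k - (N - 1) = 0" using ik by auto
        then show "embed N 1 V $$ (i, k) = refl_mat N (unit_fun (N - 1)) $$ (i, k)"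
          unfolding embed_index[OF N Vc ik] refl_mat_index[OF ik] using ik 2 by (auto simp: v_def unit_fun_def)
      qed (use embed_carrier[OF N Vc] in \<open>auto simp: refl_mat_def\<close>)
      then show ?thesis using flip[OF _ A, of "N - 1"] N by simp
    qed
  qed
  then have "h 1 A = (\<integral>V. F A \<partial>\<mu> 1)"
    unfolding h_def by (rule Bochner_Integration.integral_cong[OF refl])
  then show "(h 1 A)\<^sup>2 = (F A)\<^sup>2" by (simp only: const_n[OF order_refl N])
qed

lemma K_N: "K N = (\<integral>A. F A \<partial>\<mu> N)\<^sup>2"
proof -
  interpret HN: haar "\<mu> N" N by (rule haar_n[OF N order_refl])
  have "h N A = (\<integral>A. F A \<partial>\<mu> N)" if "A \<in> space (\<mu> N)" for A
  proof -
    have A: "A \<in> orthogonal_group N" using that by simp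
    have "h N A = (\<integral>V. F (V * A) \<partial>\<mu> N)" unfolding h_def
    proof (rule Bochner_Integration.integral_cong[OF refl])
      fix V assume "V \<in> space (\<mu> N)"
      then have "V \<in> carrier_mat N N" using orthogonal_groupD(1) by simp
      then show "F (embed N N V * A) = F (V * A)" by (simp only: embed_self)
    qed
    also have "\<dots> = (\<integral>A. F A \<partial>\<mu> N)" by (rule HN.integral_right[OF A F_measurable F_bounded])
    finally show ?thesis .
  qed
  then have "K N = (\<integral>A. (\<integral>A. F A \<partial>\<mu> N)\<^sup>2 \<partial>\<mu> N)"
    unfolding K_def by (intro Bochner_Integration.integral_cong refl) (simp only:)
  then show ?thesis by (simp only: const_n[OF N order_refl])
qed

theorem variance_le:
  "(\<integral>A. (F A)\<^sup>2 \<partial>\<mu> N) - (\<integral>A. F A \<partial>\<mu> N)\<^sup>2 \<le>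
    (\<Sum>n = 2..N. (1 / 2) * (\<integral>g. D (N - n) (embed N n g) \<partial>\<mu> n))"
proof -
  have "K 1 - K M \<le> (\<Sum>n = 2..M. (1 / 2) * (\<integral>g. D (N - n) (embed N n g) \<partial>\<mu> n))"
    if "1 \<le> M" "M \<le> N" for M
    using that
  proof (induction M rule: dec_induct)
    case (step M)
    have "K M - K (Suc M) \<le> (1 / 2) * (\<integral>g. D (N - Suc M) (embed N (Suc M) g) \<partial>\<mu> (Suc M))"
      using K_step[of "Suc M"] step by simp
    then show ?case using step by (simp add: sum.cl_ivl_Suc)
  qed simp
  from this[OF N order_refl] show ?thesis unfolding K_1 K_N .
qed

end

section \<open>Gibbs averages and moments of a random row\<close>

context haar
begin

text \<open>A reflection taking \<open>a\<close> to a multiple of a unit vector, absorbed by right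
  invariance, reduces any linear functional of row 0 to a single entry.\<close>

lemma row_frame:
  fixes f :: "real \<Rightarrow> real"
  assumes N: "0 < N" and j: "j < N" and f: "f \<in> borel_measurable borel"
    and B: "\<And>A. A \<in> orthogonal_group N \<Longrightarrow> \<bar>f (sqrt (ip N a a) * A $$ (0, j))\<bar> \<le> B"
  shows "(\<integral>A. f (mv N A a 0) \<partial>\<mu>) = (\<integral>A. f (sqrt (ip N a a) * A $$ (0, j)) \<partial>\<mu>)"
proof -
  have "ip N (\<lambda>i. sqrt (ip N a a) * unit_fun j i) (\<lambda>i. sqrt (ip N a a) * unit_fun j i) = ip N a a"
    unfolding ip_linear using j ip_nonneg[of N a] by (simp add: ip_unit_unit)
  from householder[OF this[symmetric]] obtain V where V: "V \<in> orthogonal_group N"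
    "\<And>i. i < N \<Longrightarrow> mv N V a i = sqrt (ip N a a) * unit_fun j i" by blast
  have m: "(\<lambda>A. f (sqrt (ip N a a) * A $$ (0, j))) \<in> borel_measurable (orthogonal_borel N)"
    by (intro measurable_compose[OF _ f] borel_measurable_times borel_measurable_const
        measurable_entry[OF N j measurable_ident_sets[OF refl]])
  have e: "mv N A (\<lambda>i. c * unit_fun j i) 0 = c * A $$ (0, j)" for A c
    unfolding mv_scale using j by (simp add: mv_unit_fun)
  have "(\<integral>A. f (mv N A a 0) \<partial>\<mu>) = (\<integral>A. f (sqrt (ip N a a) * (A * transpose_mat V) $$ (0, j)) \<partial>\<mu>)"
  proof (rule Bochner_Integration.integral_cong[OF refl])
    fix A assume "A \<in> space \<mu>"
    then have A: "A \<in> carrier_mat N N" using orthogonal_groupD(1) by simp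
    note Vt = orthogonal_group_transpose[OF V(1)]
    have "sqrt (ip N a a) * (A * transpose_mat V) $$ (0, j) =
        mv N (A * transpose_mat V) (\<lambda>i. sqrt (ip N a a) * unit_fun j i) 0" by (simp only: e)
    also have "\<dots> = mv N A (mv N (transpose_mat V) (\<lambda>i. sqrt (ip N a a) * unit_fun j i)) 0"
      by (rule mv_mult[OF A orthogonal_groupD(1)[OF Vt] N])
    also have "\<dots> = mv N A (mv N (transpose_mat V) (mv N V a)) 0"
      by (intro mv_cong) (simp add: V(2))
    also have "\<dots> = mv N A a 0" by (intro mv_cong) (simp add: mv_transpose_cancel[OF V(1)])
    finally show "f (mv N A a 0) = f (sqrt (ip N a a) * (A * transpose_mat V) $$ (0, j))" by simp
  qed
  also have "\<dots> = (\<integral>A. f (sqrt (ip N a a) * A $$ (0, j)) \<partial>\<mu>)"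
    by (rule integral_right[OF orthogonal_group_transpose[OF V(1)] m B])
  finally show ?thesis .
qed

lemma abs_entry_le: "A \<in> orthogonal_group N \<Longrightarrow> i < N \<Longrightarrow> j < N \<Longrightarrow> \<bar>A $$ (i, j)\<bar> \<le> 1"
proof -
  assume A: "A \<in> orthogonal_group N" and ij: "i < N" "j < N"
  have "A $$ (i, j) * A $$ (i, j) \<le> (\<Sum>k<N. A $$ (i, k) * A $$ (i, k))"
    using ij by (intro member_le_sum) auto
  also have "\<dots> = 1" using ip_row[OF A ij(1)] by (simp add: ip_def)
  finally show ?thesis by (simp add: abs_square_le_1[symmetric] power2_eq_square)
qed

lemma entry_power_integrable:
  assumes "i < N" "j < N" "k < N"
  shows "integrable \<mu> (\<lambda>A. A $$ (i, j) ^ a * A $$ (i, k) ^ b)"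
proof (rule bounded_integrable[OF prob_space_axioms])
  show "(\<lambda>A. A $$ (i, j) ^ a * A $$ (i, k) ^ b) \<in> borel_measurable \<mu>"
    unfolding measurable_haar
    by (intro borel_measurable_times borel_measurable_power
      measurable_entry[OF assms(1,2) measurable_ident_sets[OF refl]]
      measurable_entry[OF assms(1,3) measurable_ident_sets[OF refl]])
  fix A assume "A \<in> space \<mu>"
  then have A: "A \<in> orthogonal_group N" by simp
  show "\<bar>A $$ (i, j) ^ a * A $$ (i, k) ^ b\<bar> \<le> 1 * 1"
    unfolding abs_mult power_abs using abs_entry_le[OF A] assms
    by (intro mult_mono power_le_one) auto
qed

lemma row_power:
  assumes N: "0 < N" and j: "j < N"
  shows "(\<integral>A. mv N A a 0 ^ k \<partial>\<mu>) = sqrt (ip N a a) ^ k * (\<integral>A. A $$ (0, j) ^ k \<partial>\<mu>)"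
proof -
  have "(\<integral>A. mv N A a 0 ^ k \<partial>\<mu>) = (\<integral>A. (sqrt (ip N a a) * A $$ (0, j)) ^ k \<partial>\<mu>)"
  proof (rule row_frame[OF N j, of "\<lambda>t. t ^ k"])
    show "\<bar>(sqrt (ip N a a) * A $$ (0, j)) ^ k\<bar> \<le> sqrt (ip N a a) ^ k" if "A \<in> orthogonal_group N" for A
      unfolding power_mult_distrib abs_mult power_abs using abs_entry_le[OF that N j] ip_nonneg[of N a]
      by (simp add: mult_left_le power_le_one)
  qed measurable
  then show ?thesis by (simp add: power_mult_distrib)
qed

text \<open>The squared entries of a row have equal means and add up to 1.\<close>

lemma row_second_moment:
  assumes N: "0 < N"
  shows "(\<integral>A. (mv N A a 0)\<^sup>2 \<partial>\<mu>) = ip N a a / N"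
proof -
  define m2 where "m2 = (\<integral>A. (A $$ (0, 0))\<^sup>2 \<partial>\<mu>)"
  have m: "(\<integral>A. (A $$ (0, j))\<^sup>2 \<partial>\<mu>) = m2" if j: "j < N" for j
    using row_power[OF N N, of "unit_fun j" 2] j by (simp add: ip_unit_unit mv_unit_fun m2_def)
  have "1 = (\<integral>A. (\<Sum>j<N. (A $$ (0, j))\<^sup>2) \<partial>\<mu>)"
  proof -
    have "(\<integral>A. (\<Sum>j<N. (A $$ (0, j))\<^sup>2) \<partial>\<mu>) = (\<integral>A. 1 \<partial>\<mu>)"
      by (rule Bochner_Integration.integral_cong[OF refl])
        (use ip_row[OF _ N] in \<open>simp add: ip_def power2_eq_square\<close>)
    then show ?thesis using prob_space by simp
  qed
  also have "\<dots> = (\<Sum>j<N. (\<integral>A. (A $$ (0, j))\<^sup>2 \<partial>\<mu>))"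
    using entry_power_integrable[OF N, of _ _ 2 0] by (intro Bochner_Integration.integral_sum) simp
  also have "\<dots> = N * m2" using m by simp
  finally have "m2 = 1 / N" using N by (simp add: field_simps)
  then show ?thesis using row_power[OF N N, of a 2] ip_nonneg[of N a] by (simp add: m2_def)
qed

text \<open>Rotating by 45 degrees relates the mixed fourth moments of a row to the pure ones.\<close>
lemma row_fourth_moment:
  assumes N: "0 < N"
  shows "(\<integral>A. (mv N A a 0) ^ 4 \<partial>\<mu>) \<le> 3 * (ip N a a)\<^sup>2 / (real N)\<^sup>2"
proof -
  define m4 where "m4 = (\<integral>A. (A $$ (0, 0)) ^ 4 \<partial>\<mu>)"
  have m: "(\<integral>A. (A $$ (0, j)) ^ 4 \<partial>\<mu>) = m4" if j: "j < N" for j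
    using row_power[OF N N, of "unit_fun j" 4] j by (simp add: ip_unit_unit mv_unit_fun m4_def)
  have mixed: "(\<integral>A. (A $$ (0, i))\<^sup>2 * (A $$ (0, j))\<^sup>2 \<partial>\<mu>) = m4 / 3" if ij: "i < N" "j < N" "i \<noteq> j" for i j
  proof -
    let ?p = "\<lambda>l. unit_fun i l + unit_fun j l" and ?m = "\<lambda>l. unit_fun i l - unit_fun j l"
    have pp: "ip N ?p ?p = 2" "ip N ?m ?m = 2" unfolding ip_linear using ij by (simp_all add: ip_unit_unit)
    have s4: "sqrt 2 ^ 4 = 4" by (simp add: power4_eq_xxxx)
    note int = entry_power_integrable[OF N ij(1,2)]
    \<comment> \<open>Both vectors e_i + e_j and e_i - e_j have norm sqrt 2, contributing 4
      \<open>m4\<close> each. In the sum the odd products cancel, leaving 4 \<open>m4\<close> plus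
      12 mixed moments.\<close>
    have "8 * m4 = (\<integral>A. mv N A ?p 0 ^ 4 \<partial>\<mu>) + (\<integral>A. mv N A ?m 0 ^ 4 \<partial>\<mu>)"
      using row_power[OF N N, of ?p 4] row_power[OF N N, of ?m 4] unfolding pp s4 m4_def by simp
    also have "\<dots> = (\<integral>A. (A $$ (0, i) + A $$ (0, j)) ^ 4 \<partial>\<mu>) + (\<integral>A. (A $$ (0, i) - A $$ (0, j)) ^ 4 \<partial>\<mu>)"
      using ij by (simp add: mv_add mv_diff mv_unit_fun)
    also have "\<dots> = (\<integral>A. A $$ (0, i) ^ 4 * A $$ (0, j) ^ 0 + 4 * (A $$ (0, i) ^ 3 * A $$ (0, j) ^ 1)
        + 6 * (A $$ (0, i) ^ 2 * A $$ (0, j) ^ 2) + 4 * (A $$ (0, i) ^ 1 * A $$ (0, j) ^ 3)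
        + A $$ (0, i) ^ 0 * A $$ (0, j) ^ 4 \<partial>\<mu>) +
      (\<integral>A. A $$ (0, i) ^ 4 * A $$ (0, j) ^ 0 - 4 * (A $$ (0, i) ^ 3 * A $$ (0, j) ^ 1)
        + 6 * (A $$ (0, i) ^ 2 * A $$ (0, j) ^ 2) - 4 * (A $$ (0, i) ^ 1 * A $$ (0, j) ^ 3)
        + A $$ (0, i) ^ 0 * A $$ (0, j) ^ 4 \<partial>\<mu>)"
      by (intro arg_cong2[of _ _ _ _ "(+)"] Bochner_Integration.integral_cong refl)
        (simp_all add: power4_eq_xxxx power3_eq_cube power2_eq_square algebra_simps)
    also have "\<dots> = 2 * (\<integral>A. A $$ (0, i) ^ 4 * A $$ (0, j) ^ 0 \<partial>\<mu>) + 12 * (\<integral>A. A $$ (0, i) ^ 2 * A $$ (0, j) ^ 2 \<partial>\<mu>)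
      + 2 * (\<integral>A. A $$ (0, i) ^ 0 * A $$ (0, j) ^ 4 \<partial>\<mu>)"
      using int[of 4 0] int[of 3 1] int[of 2 2] int[of 1 3] int[of 0 4]
      by (simp add: Bochner_Integration.integral_add Bochner_Integration.integral_diff del: power_0 power_one_right One_nat_def)
    also have "\<dots> = 4 * m4 + 12 * (\<integral>A. A $$ (0, i) ^ 2 * A $$ (0, j) ^ 2 \<partial>\<mu>)"
      using m[OF ij(1)] m[OF ij(2)] by simp
    finally show ?thesis by simp
  qed
  have m40: "0 \<le> m4" unfolding m4_def by (rule Bochner_Integration.integral_nonneg) simp
  have pure: "(\<integral>A. (A $$ (0, i))\<^sup>2 * (A $$ (0, i))\<^sup>2 \<partial>\<mu>) = m4" if "i < N" for i
    using m[OF that] by (simp add: power4_eq_xxxx power2_eq_square mult.assoc)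
  have "1 = (\<integral>A. (\<Sum>i<N. \<Sum>j<N. (A $$ (0, i))\<^sup>2 * (A $$ (0, j))\<^sup>2) \<partial>\<mu>)"
  proof -
    have "(\<integral>A. (\<Sum>i<N. \<Sum>j<N. (A $$ (0, i))\<^sup>2 * (A $$ (0, j))\<^sup>2) \<partial>\<mu>) = (\<integral>A. 1 \<partial>\<mu>)"
    proof (rule Bochner_Integration.integral_cong[OF refl])
      fix A assume "A \<in> space \<mu>"
      then have "(\<Sum>i<N. (A $$ (0, i))\<^sup>2) = 1" using ip_row[OF _ N] by (simp add: ip_def power2_eq_square)
      then show "(\<Sum>i<N. \<Sum>j<N. (A $$ (0, i))\<^sup>2 * (A $$ (0, j))\<^sup>2) = 1"
        by (simp add: sum_product[symmetric])
    qed
    then show ?thesis using prob_space by simp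
  qed
  also have "\<dots> = (\<Sum>i<N. \<Sum>j<N. (\<integral>A. (A $$ (0, i))\<^sup>2 * (A $$ (0, j))\<^sup>2 \<partial>\<mu>))"
  proof -
    have int: "integrable \<mu> (\<lambda>A. (A $$ (0, i))\<^sup>2 * (A $$ (0, j))\<^sup>2)" if "i < N" "j < N" for i j
      using entry_power_integrable[OF N that] .
    then have "integrable \<mu> (\<lambda>A. \<Sum>j<N. (A $$ (0, i))\<^sup>2 * (A $$ (0, j))\<^sup>2)" if "i < N" for i
      using that by (intro Bochner_Integration.integrable_sum) auto
    then have "(\<integral>A. (\<Sum>i<N. \<Sum>j<N. (A $$ (0, i))\<^sup>2 * (A $$ (0, j))\<^sup>2) \<partial>\<mu>) =
        (\<Sum>i<N. (\<integral>A. (\<Sum>j<N. (A $$ (0, i))\<^sup>2 * (A $$ (0, j))\<^sup>2) \<partial>\<mu>))"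
      by (intro Bochner_Integration.integral_sum) auto
    also have "\<dots> = (\<Sum>i<N. \<Sum>j<N. (\<integral>A. (A $$ (0, i))\<^sup>2 * (A $$ (0, j))\<^sup>2 \<partial>\<mu>))"
      by (intro sum.cong refl Bochner_Integration.integral_sum) (use int in auto)
    finally show ?thesis .
  qed
  \<comment> \<open>The diagonal terms, equal to \<open>m4\<close>, are only bounded below by
    \<open>m4 / 3\<close>; the slight loss gives the simple bound 3/N^2.\<close>
  also have "\<dots> \<ge> (\<Sum>i<N. \<Sum>j<N. m4 / 3)"
  proof (intro sum_mono)
    fix i j assume "i \<in> {..<N}" "j \<in> {..<N}"
    then show "m4 / 3 \<le> (\<integral>A. (A $$ (0, i))\<^sup>2 * (A $$ (0, j))\<^sup>2 \<partial>\<mu>)"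
      using mixed[of i j] pure[of i] m40 by (cases "i = j") auto
  qed
  finally have "real N * real N * m4 \<le> 3" by (simp add: mult.assoc)
  then have m4: "m4 \<le> 3 / (real N)\<^sup>2" using N by (simp add: field_simps power2_eq_square)
  have "sqrt (ip N a a) ^ 4 = (ip N a a)\<^sup>2"
    using ip_nonneg[of N a] power_mult[of "sqrt (ip N a a)" 2 2] by simp
  then have "(\<integral>A. (mv N A a 0) ^ 4 \<partial>\<mu>) = (ip N a a)\<^sup>2 * m4"
    using row_power[OF N N, of a 4] by (simp add: m4_def)
  also have "\<dots> \<le> (ip N a a)\<^sup>2 * (3 / (real N)\<^sup>2)" using m4 by (rule mult_left_mono) simp
  finally show ?thesis by (simp add: mult.commute)
qed

end

text \<open>Jensen's inequality, proved with the tangent line of exp at the weighted mean of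
  \<open>a\<close>.\<close>

lemma ln_weighted_exp_ge:
  fixes p a :: "'a \<Rightarrow> real"
  assumes S: "finite S" and p: "\<And>x. x \<in> S \<Longrightarrow> 0 \<le> p x" and Z: "0 < (\<Sum>x\<in>S. p x)"
  shows "(\<Sum>x\<in>S. p x * a x) / (\<Sum>x\<in>S. p x) \<le> ln (\<Sum>x\<in>S. p x * exp (a x)) - ln (\<Sum>x\<in>S. p x)"
proof -
  let ?Z = "\<Sum>x\<in>S. p x"
  define m where "m = (\<Sum>x\<in>S. p x * a x) / ?Z"
  have "(\<Sum>x\<in>S. p x * (1 + (a x - m))) = ?Z + ((\<Sum>x\<in>S. p x * a x) - ?Z * m)"
    by (simp add: distrib_left right_diff_distrib sum.distrib sum_subtractf sum_distrib_right)
  also have "?Z * m = (\<Sum>x\<in>S. p x * a x)" using Z by (simp add: m_def)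
  finally have "(\<Sum>x\<in>S. p x * (1 + (a x - m))) = ?Z" by simp
  then have "exp m * ?Z = exp m * (\<Sum>x\<in>S. p x * (1 + (a x - m)))" by simp
  also have "\<dots> \<le> exp m * (\<Sum>x\<in>S. p x * exp (a x - m))"
    by (intro mult_left_mono sum_mono p exp_ge_add_one_self) auto
  also have "\<dots> = (\<Sum>x\<in>S. p x * exp (a x))"
    by (simp add: sum_distrib_left exp_diff field_simps)
  finally have le: "exp m * ?Z \<le> (\<Sum>x\<in>S. p x * exp (a x))" .
  then have "ln (exp m * ?Z) \<le> ln (\<Sum>x\<in>S. p x * exp (a x))"
    using Z by (intro ln_mono) (auto intro: mult_pos_pos less_le_trans)
  then show ?thesis using Z by (simp add: ln_mult m_def)
qed

section \<open>Gibbs averages and the effect of one reflection on ln Z\<close>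

definition gibbs :: "nat \<Rightarrow> (nat \<Rightarrow> real) \<Rightarrow> real \<Rightarrow> real mat \<Rightarrow> ((nat \<Rightarrow> real) \<Rightarrow> real) \<Rightarrow> real" where
  "gibbs N d \<beta> U f = (\<Sum>x\<in>spins N. exp (\<beta> * qf N d U x x) * f x) / (\<Sum>x\<in>spins N. exp (\<beta> * qf N d U x x))"

lemma spins_nonempty: "spins N \<noteq> {}"
  using card_spins[of N] by force

lemma gibbs_norm_pos: "0 < (\<Sum>x\<in>spins N. exp (\<beta> * qf N d U x x))"
  using spins_nonempty by (intro sum_pos) auto

lemma gibbs_mono: "(\<And>x. x \<in> spins N \<Longrightarrow> f x \<le> g x) \<Longrightarrow> gibbs N d \<beta> U f \<le> gibbs N d \<beta> U g"
  unfolding gibbs_def using gibbs_norm_pos[of \<beta> N d U]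
  by (intro divide_right_mono sum_mono mult_left_mono) auto

lemma gibbs_const: "gibbs N d \<beta> U (\<lambda>_. c) = c"
  unfolding gibbs_def using gibbs_norm_pos[of \<beta> N d U] by (simp add: sum_distrib_right[symmetric])

lemma gibbs_add: "gibbs N d \<beta> U (\<lambda>x. f x + g x) = gibbs N d \<beta> U f + gibbs N d \<beta> U g"
  by (simp add: gibbs_def distrib_left sum.distrib add_divide_distrib)

lemma gibbs_scale: "gibbs N d \<beta> U (\<lambda>x. c * f x) = c * gibbs N d \<beta> U f"
  by (simp add: gibbs_def sum_distrib_left mult.left_commute)

lemma gibbs_cong: "(\<And>x. x \<in> spins N \<Longrightarrow> f x = g x) \<Longrightarrow> gibbs N d \<beta> U f = gibbs N d \<beta> U g"
  by (simp add: gibbs_def)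

lemma gibbs_square_le: "(gibbs N d \<beta> U f)\<^sup>2 \<le> gibbs N d \<beta> U (\<lambda>x. (f x)\<^sup>2)"
proof -
  let ?m = "gibbs N d \<beta> U f"
  have "0 = gibbs N d \<beta> U (\<lambda>_. 0)" by (rule gibbs_const[symmetric])
  also have "\<dots> \<le> gibbs N d \<beta> U (\<lambda>x. (f x - ?m)\<^sup>2)" by (rule gibbs_mono) simp
  also have "\<dots> = gibbs N d \<beta> U (\<lambda>x. (f x)\<^sup>2 + ((- 2 * ?m) * f x + ?m\<^sup>2))"
    by (rule gibbs_cong) (simp add: power2_eq_square algebra_simps)
  also have "\<dots> = gibbs N d \<beta> U (\<lambda>x. (f x)\<^sup>2) - ?m\<^sup>2"
    unfolding gibbs_add gibbs_scale gibbs_const by (simp add: power2_eq_square)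
  finally show ?thesis by simp
qed

lemma Zf_pos: "0 < Zf N d \<beta> U"
  unfolding Zf_def using gibbs_norm_pos by simp

text \<open>Flipping row \<open>j\<close> of U amounts to flipping spin \<open>j\<close>, a
  bijection of the configurations. This supplies the assumption \<open>flip\<close> of the
  martingale estimate.\<close>

lemma Zf_flip:
  assumes j: "j < N" and U: "U \<in> carrier_mat N N"
  shows "Zf N d \<beta> (refl_mat N (unit_fun j) * U) = Zf N d \<beta> U"
proof -
  let ?f = "\<lambda>x. x(j := - x j)"
  have "qf N d (refl_mat N (unit_fun j) * U) x x = qf N d U (?f x) (?f x)" for x
    unfolding qf_refl[OF U] using j by (intro qf_cong) (auto simp: unit_fun_def ip_unit_fun_left)
  moreover have "(\<Sum>x\<in>spins N. exp (\<beta> * qf N d U (?f x) (?f x))) = (\<Sum>x\<in>spins N. exp (\<beta> * qf N d U x x))"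
  proof (rule sum.reindex_bij_witness[of _ ?f ?f])
    show "?f x \<in> spins N" if "x \<in> spins N" for x
      using that j by (auto simp: spins_def PiE_iff extensional_def)
    then show "?f x \<in> spins N" if "x \<in> spins N" for x using that .
  qed auto
  ultimately show ?thesis by (simp add: Zf_def)
qed

context haar_signs
begin

lemma abs_ln_Zf_le:
  assumes U: "U \<in> orthogonal_group N" and \<beta>: "0 \<le> \<beta>"
  shows "\<bar>ln (Zf N d \<beta> U)\<bar> \<le> \<beta> * N"
proof -
  have b: "\<bar>\<beta> * qf N d U x x\<bar> \<le> \<beta> * N" if "x \<in> spins N" for x
    unfolding abs_mult using abs_qf_spins_le[OF U that that] \<beta> by (simp add: mult_left_mono)
  have "(\<Sum>x\<in>spins N. exp (\<beta> * qf N d U x x)) \<le> (\<Sum>x\<in>spins N. exp (\<beta> * N))"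
    using abs_le_D1[OF b] by (intro sum_mono) simp
  then have up: "Zf N d \<beta> U \<le> exp (\<beta> * N)" by (simp add: Zf_def card_spins field_simps)
  have "(\<Sum>x\<in>spins N. exp (- (\<beta> * N))) \<le> (\<Sum>x\<in>spins N. exp (\<beta> * qf N d U x x))"
    using abs_le_D2[OF b] by (intro sum_mono) (simp add: minus_le_iff)
  then have lo: "exp (- (\<beta> * N)) \<le> Zf N d \<beta> U" by (simp add: Zf_def card_spins field_simps)
  have "ln (Zf N d \<beta> U) \<le> \<beta> * N" using up Zf_pos by (metis ln_exp ln_mono)
  moreover have "- (\<beta> * N) \<le> ln (Zf N d \<beta> U)" using lo by (simp add: ln_ge_iff Zf_pos)
  ultimately show ?thesis by simp
qed

definition delta :: "(nat \<Rightarrow> real) \<Rightarrow> real mat \<Rightarrow> (nat \<Rightarrow> real) \<Rightarrow> real" where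
  "delta w U x = qf N d (refl_mat N w * U) x x - qf N d U x x"

lemma ln_Zf_reflect_ge:
  "\<beta> * gibbs N d \<beta> U (delta w U) \<le> ln (Zf N d \<beta> (refl_mat N w * U)) - ln (Zf N d \<beta> U)"
proof -
  let ?p = "\<lambda>x. exp (\<beta> * qf N d U x x)"
  have 1: "(\<Sum>x\<in>spins N. ?p x * exp (\<beta> * delta w U x)) =
      (\<Sum>x\<in>spins N. exp (\<beta> * qf N d (refl_mat N w * U) x x))"
    by (intro sum.cong refl) (simp add: delta_def mult_exp_exp algebra_simps)
  have 2: "(\<Sum>x\<in>spins N. ?p x * (\<beta> * delta w U x)) / (\<Sum>x\<in>spins N. ?p x) = \<beta> * gibbs N d \<beta> U (delta w U)"
    by (simp add: gibbs_def sum_distrib_left mult.left_commute)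
  have 3: "ln (Zf N d \<beta> V) = ln (1 / 2 ^ N) + ln (\<Sum>x\<in>spins N. exp (\<beta> * qf N d V x x))" for V
    unfolding Zf_def by (rule ln_mult_pos[OF _ gibbs_norm_pos]) simp
  have "(\<Sum>x\<in>spins N. ?p x * (\<beta> * delta w U x)) / (\<Sum>x\<in>spins N. ?p x) \<le>
      ln (\<Sum>x\<in>spins N. ?p x * exp (\<beta> * delta w U x)) - ln (\<Sum>x\<in>spins N. ?p x)"
    by (rule ln_weighted_exp_ge[OF finite_spins _ gibbs_norm_pos]) simp
  then show ?thesis unfolding 1 2 3 by linarith
qed

text \<open>Convexity gives a lower bound for the change of ln Z. Applied at U and, since the
  reflection is an involution, at its image, it encloses the change between \<open>a\<close> and
  \<open>- b\<close>. Gibbs averages of squares thus suffice and no exponential of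
  \<open>delta\<close> has to be controlled.\<close>

lemma ln_Zf_reflect_square:
  assumes U: "U \<in> orthogonal_group N" and w: "ip N w w = 1"
  shows "(ln (Zf N d \<beta> (refl_mat N w * U)) - ln (Zf N d \<beta> U))\<^sup>2 \<le>
    \<beta>\<^sup>2 * (gibbs N d \<beta> U (\<lambda>x. (delta w U x)\<^sup>2) +
      gibbs N d \<beta> (refl_mat N w * U) (\<lambda>x. (delta w (refl_mat N w * U) x)\<^sup>2))"
proof -
  let ?R = "refl_mat N w"
  let ?D = "ln (Zf N d \<beta> (?R * U)) - ln (Zf N d \<beta> U)"
  define a where "a = \<beta> * gibbs N d \<beta> U (delta w U)"
  define b where "b = \<beta> * gibbs N d \<beta> (?R * U) (delta w (?R * U))"
  have "?R * (?R * U) = U"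
    using orthogonal_cancel(1)[OF refl_mat_orthogonal(1)[OF w] orthogonal_groupD(1)[OF U]] by simp
  then have "a \<le> ?D" "b \<le> - ?D"
    using ln_Zf_reflect_ge[of \<beta> U w] ln_Zf_reflect_ge[of \<beta> "?R * U" w] by (simp_all add: a_def b_def)
  then have "?D\<^sup>2 \<le> a\<^sup>2 + b\<^sup>2"
  proof (cases "0 \<le> ?D")
    case True
    then have "?D\<^sup>2 \<le> b\<^sup>2" using \<open>b \<le> - ?D\<close> by (simp add: abs_le_square_iff[symmetric])
    then show ?thesis using zero_le_power2[of a] by linarith
  next
    case False
    then have "?D\<^sup>2 \<le> a\<^sup>2" using \<open>a \<le> ?D\<close> by (simp add: abs_le_square_iff[symmetric])
    then show ?thesis using zero_le_power2[of b] by linarith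
  qed
  also have "\<dots> \<le> \<beta>\<^sup>2 * gibbs N d \<beta> U (\<lambda>x. (delta w U x)\<^sup>2) +
      \<beta>\<^sup>2 * gibbs N d \<beta> (?R * U) (\<lambda>x. (delta w (?R * U) x)\<^sup>2)"
    unfolding a_def b_def power_mult_distrib by (intro add_mono mult_left_mono gibbs_square_le) auto
  finally show ?thesis by (simp add: distrib_left)
qed

lemma abs_delta_le:
  assumes U: "U \<in> orthogonal_group N" and w: "ip N w w = 1" and x: "x \<in> spins N"
  shows "\<bar>delta w U x\<bar> \<le> 2 * N"
  using abs_qf_spins_le[OF U x x]
    abs_qf_spins_le[OF orthogonal_group_mult[OF refl_mat_orthogonal(1)[OF w] U] x x]
  unfolding delta_def by linarith

lemma gibbs_delta_bounded:
  assumes U: "U \<in> orthogonal_group N" and w: "ip N w w = 1"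
  shows "\<bar>gibbs N d \<beta> U (\<lambda>x. (delta w U x)\<^sup>2)\<bar> \<le> (2 * N)\<^sup>2"
proof -
  have "gibbs N d \<beta> U (\<lambda>_. 0) \<le> gibbs N d \<beta> U (\<lambda>x. (delta w U x)\<^sup>2)" by (rule gibbs_mono) simp
  moreover have "gibbs N d \<beta> U (\<lambda>x. (delta w U x)\<^sup>2) \<le> gibbs N d \<beta> U (\<lambda>_. (2 * N)\<^sup>2)"
  proof (rule gibbs_mono)
    show "(delta w U x)\<^sup>2 \<le> (2 * N)\<^sup>2" if "x \<in> spins N" for x
      using power_mono[OF abs_delta_le[OF U w that] abs_ge_zero, of 2] by simp
  qed
  ultimately show ?thesis unfolding gibbs_const by simp
qed

lemma delta_measurable:
  assumes R: "(\<lambda>t. refl_mat N (w t)) \<in> measurable M (orthogonal_borel N)"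
    and f: "f \<in> measurable M (orthogonal_borel N)"
  shows "(\<lambda>t. delta (w t) (f t) x) \<in> borel_measurable M"
  unfolding delta_def
  by (intro borel_measurable_diff measurable_qf measurable_mat_mult R f borel_measurable_const)

lemma gibbs_delta_measurable:
  assumes R: "(\<lambda>t. refl_mat N (w t)) \<in> measurable M (orthogonal_borel N)"
    and f: "f \<in> measurable M (orthogonal_borel N)"
  shows "(\<lambda>t. gibbs N d \<beta> (f t) (\<lambda>x. (delta (w t) (f t) x)\<^sup>2)) \<in> borel_measurable M"
  unfolding gibbs_def
  by (intro borel_measurable_divide borel_measurable_sum borel_measurable_times borel_measurable_power
    delta_measurable R f measurable_compose[OF _ borel_measurable_exp] measurable_qf borel_measurable_const)

text \<open>For a fixed normal the contributions of U and of its reflected image have the same mean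
  by left invariance, hence the factor 2.\<close>

lemma reflection_energy_gibbs:
  assumes w: "ip N w w = 1" and \<beta>: "0 \<le> \<beta>"
  shows "(\<integral>U. (ln (Zf N d \<beta> (refl_mat N w * U)) - ln (Zf N d \<beta> U))\<^sup>2 \<partial>\<mu>) \<le>
    2 * \<beta>\<^sup>2 * (\<integral>U. gibbs N d \<beta> U (\<lambda>x. (delta w U x)\<^sup>2) \<partial>\<mu>)"
proof -
  let ?R = "refl_mat N w"
  let ?g = "\<lambda>U. gibbs N d \<beta> U (\<lambda>x. (delta w U x)\<^sup>2)"
  have R: "?R \<in> orthogonal_group N" by (rule refl_mat_orthogonal(1)[OF w])
  have Rm: "(\<lambda>_. ?R) \<in> measurable M (orthogonal_borel N)" for M :: "'b measure" using R by simp
  have g: "?g \<in> borel_measurable (orthogonal_borel N)"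
    by (rule gibbs_delta_measurable[OF Rm measurable_ident_sets[OF refl]])
  have i1: "integrable \<mu> ?g"
    by (rule bounded_integrable[OF prob_space_axioms, of _ "(2 * N)\<^sup>2"])
      (use g gibbs_delta_bounded[OF _ w] in \<open>auto simp: measurable_haar\<close>)
  have i2: "integrable \<mu> (\<lambda>U. ?g (?R * U))"
    by (rule bounded_integrable[OF prob_space_axioms, of _ "(2 * N)\<^sup>2"])
      (use measurable_compose[OF measurable_mult_const(1)[OF R] g] gibbs_delta_bounded[OF orthogonal_group_mult[OF R] w] in auto)
  have "(\<integral>U. (ln (Zf N d \<beta> (?R * U)) - ln (Zf N d \<beta> U))\<^sup>2 \<partial>\<mu>) \<le> (\<integral>U. \<beta>\<^sup>2 * (?g U + ?g (?R * U)) \<partial>\<mu>)"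
  proof (rule integral_mono)
    show "integrable \<mu> (\<lambda>U. \<beta>\<^sup>2 * (?g U + ?g (?R * U)))" using i1 i2 by simp
    show "integrable \<mu> (\<lambda>U. (ln (Zf N d \<beta> (?R * U)) - ln (Zf N d \<beta> U))\<^sup>2)"
    proof (rule bounded_integrable[OF prob_space_axioms])
      have z: "(\<lambda>U. ln (Zf N d \<beta> U)) \<in> borel_measurable (orthogonal_borel N)" by measurable
      show "(\<lambda>U. (ln (Zf N d \<beta> (?R * U)) - ln (Zf N d \<beta> U))\<^sup>2) \<in> borel_measurable \<mu>"
        by (intro borel_measurable_power borel_measurable_diff
          measurable_compose[OF measurable_mult_const(1)[OF R] z]) (use z in \<open>simp add: measurable_haar\<close>)
      fix U assume "U \<in> space \<mu>"
      then have U: "U \<in> orthogonal_group N" by simp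
      have "\<bar>ln (Zf N d \<beta> (?R * U)) - ln (Zf N d \<beta> U)\<bar> \<le> 2 * (\<beta> * N)"
        using abs_ln_Zf_le[OF U \<beta>] abs_ln_Zf_le[OF orthogonal_group_mult[OF R U] \<beta>] by linarith
      from power_mono[OF this abs_ge_zero, of 2]
      show "\<bar>(ln (Zf N d \<beta> (?R * U)) - ln (Zf N d \<beta> U))\<^sup>2\<bar> \<le> (2 * (\<beta> * N))\<^sup>2" by simp
    qed
    show "(ln (Zf N d \<beta> (?R * U)) - ln (Zf N d \<beta> U))\<^sup>2 \<le> \<beta>\<^sup>2 * (?g U + ?g (?R * U))" if "U \<in> space \<mu>" for U
      using that by (intro ln_Zf_reflect_square w) simp
  qed
  also have "\<dots> = \<beta>\<^sup>2 * ((\<integral>U. ?g U \<partial>\<mu>) + (\<integral>U. ?g (?R * U) \<partial>\<mu>))"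
    using i1 i2 by (simp add: Bochner_Integration.integral_add)
  also have "(\<integral>U. ?g (?R * U) \<partial>\<mu>) = (\<integral>U. ?g U \<partial>\<mu>)" by (rule integral_left[OF R g])
  finally show ?thesis by (simp add: mult.assoc)
qed

end

section \<open>Variance of the free energy\<close>

lemma mv_power_integrable:
  assumes H: "haar \<nu> n" and n: "0 < n"
  shows "integrable \<nu> (\<lambda>A. mv n A a 0 ^ k)"
proof -
  interpret haar \<nu> n by fact
  show ?thesis
  proof (rule bounded_integrable[OF prob_space_axioms])
    show "(\<lambda>A. mv n A a 0 ^ k) \<in> borel_measurable \<nu>"
      unfolding measurable_haar mv_def
      by (intro borel_measurable_power borel_measurable_sum borel_measurable_times borel_measurable_const
          measurable_entry[OF n _ measurable_ident_sets[OF refl]]) simp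
    fix A assume "A \<in> space \<nu>"
    then have A: "A \<in> orthogonal_group n" by simp
    have "\<bar>mv n A a 0\<bar> \<le> (\<Sum>l<n. \<bar>a l\<bar>)" unfolding mv_def
    proof (rule order_trans[OF sum_abs], rule sum_mono)
      fix l assume "l \<in> {..<n}"
      then show "\<bar>A $$ (0, l) * a l\<bar> \<le> \<bar>a l\<bar>"
        unfolding abs_mult using abs_entry_le[OF A n, of l] by (simp add: mult_left_le_one_le)
    qed
    from power_mono[OF this abs_ge_zero, of k]
    show "\<bar>mv n A a 0 ^ k\<bar> \<le> (\<Sum>l<n. \<bar>a l\<bar>) ^ k" by (simp add: power_abs)
  qed
qed

text \<open>Here \<open>k\<close> is the squared length in \<open>row_normal\<close>; being at least
  2, it absorbs the factor 2 lost in squaring a difference.\<close>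

lemma scaled_difference_square_le:
  fixes p r s k :: real
  assumes k: "2 \<le> k" and s: "s\<^sup>2 = 1"
  shows "((1 / sqrt k) * (p - s * r))\<^sup>2 \<le> p\<^sup>2 + r\<^sup>2"
proof -
  have "((1 / sqrt k) * (p - s * r))\<^sup>2 = (p - s * r)\<^sup>2 / k"
    using k by (simp add: power_mult_distrib power_divide)
  also have "\<dots> \<le> (p - s * r)\<^sup>2 / 2" using k by (intro divide_left_mono) auto
  also have "\<dots> \<le> p\<^sup>2 + (s * r)\<^sup>2"
    using zero_le_power2[of "p + s * r"] by (simp add: power2_eq_square algebra_simps)
  also have "(s * r)\<^sup>2 = r\<^sup>2" using s by (simp add: power_mult_distrib)
  finally show ?thesis .
qed

lemma qf_expand:
  assumes U: "U \<in> carrier_mat N N"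
  shows "qf N d U y x = ip N y (\<lambda>i. qf N d U (unit_fun i) x)"
proof -
  define z where "z = (\<lambda>i. d i * mv N (transpose_mat U) x i)"
  have Ut: "transpose_mat U \<in> carrier_mat N N" using U by simp
  have e: "mv N U z i = qf N d U (unit_fun i) x" if "i < N" for i
    unfolding qf_def mv_def[of N U] z_def using that U by (intro sum.cong refl) (auto simp: mv_unit_fun)
  have "qf N d U y x = ip N (mv N (transpose_mat U) y) z"
    unfolding qf_def ip_def z_def by (intro sum.cong refl) (simp add: algebra_simps)
  also have "\<dots> = ip N y (mv N U z)" unfolding ip_mv_left[OF Ut] by simp
  also have "\<dots> = ip N y (\<lambda>i. qf N d U (unit_fun i) x)" by (intro ip_cong) (simp_all add: e)
  finally show ?thesis .
qed

definition row_fun :: "real mat \<Rightarrow> nat \<Rightarrow> nat \<Rightarrow> real" where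
  "row_fun G j i = G $$ (j, i)"

lemma row_normal_scaled:
  "row_normal j G = (\<lambda>i. (1 / sqrt (2 - 2 * row_sign j G * G $$ (j, j))) *
    (unit_fun j i - row_sign j G * row_fun G j i))"
  by (simp add: row_normal_def row_fun_def fun_eq_iff)

text \<open>Row N - n of the embedded matrix is row 0 of \<open>g\<close> padded with zeros, so the
  moments of the first row of a Haar matrix of size n apply.\<close>

lemma ip_row_embed:
  assumes n: "1 \<le> n" "n \<le> N" and g: "g \<in> carrier_mat n n"
  shows "ip N (row_fun (embed N n g) (N - n)) a = mv n g (\<lambda>l. a (l + (N - n))) 0"
proof -
  define p where "p = N - n"
  have p: "N = n + p" using n by (simp add: p_def)
  have jN: "p < N" using n p by simp
  have "ip N (row_fun (embed N n g) p) a = (\<Sum>i<p + n. embed N n g $$ (p, i) * a i)"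
    by (simp add: ip_def row_fun_def p add.commute)
  also have "\<dots> = (\<Sum>i<p. embed N n g $$ (p, i) * a i) + (\<Sum>l<n. embed N n g $$ (p, l + p) * a (l + p))"
  proof -
    have "(\<Sum>i<p + m. f i) = (\<Sum>i<p. f i) + (\<Sum>l<m. f (l + p))" for f :: "nat \<Rightarrow> real" and m
      by (induction m) (simp_all add: add.commute add.assoc)
    then show ?thesis .
  qed
  also have "(\<Sum>i<p. embed N n g $$ (p, i) * a i) = 0"
    using jN embed_col[OF n(2) g] by (intro sum.neutral ballI) (auto simp: p_def unit_fun_def)
  also have "(\<Sum>l<n. embed N n g $$ (p, l + p) * a (l + p)) = mv n g (\<lambda>l. a (l + p)) 0"
    unfolding mv_def
  proof (intro sum.cong refl)
    fix l assume "l \<in> {..<n}"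
    then have l: "l + p < N" using p by simp
    have "embed N n g $$ (p, l + p) = g $$ (0, l)"
      unfolding embed_index[OF n(2) g jN l] by (simp add: p_def)
    then show "embed N n g $$ (p, l + p) * a (l + p) = g $$ (0, l) * a (l + p)" by simp
  qed
  finally show ?thesis by (simp add: p_def)
qed

lemma ip_shift_le:
  assumes "n \<le> N"
  shows "ip n (\<lambda>l. a (l + (N - n))) (\<lambda>l. a (l + (N - n))) \<le> ip N a a"
proof -
  have "ip n (\<lambda>l. a (l + (N - n))) (\<lambda>l. a (l + (N - n))) = (\<Sum>i\<in>(\<lambda>l. l + (N - n)) ` {..<n}. a i * a i)"
    unfolding ip_def by (subst sum.reindex) (auto simp: inj_on_def)
  also have "\<dots> \<le> (\<Sum>i<N. a i * a i)" using assms by (intro sum_mono2) auto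
  finally show ?thesis by (simp add: ip_def)
qed

lemma ip_shift_spins:
  assumes "n \<le> N" "x \<in> spins N"
  shows "ip n (\<lambda>l. x (l + (N - n))) (\<lambda>l. x (l + (N - n))) = n"
proof -
  have "ip n (\<lambda>l. x (l + (N - n))) (\<lambda>l. x (l + (N - n))) = (\<Sum>l<n. 1)"
    unfolding ip_def using assms by (intro sum.cong refl spins_square[OF assms(2)]) auto
  then show ?thesis by simp
qed

context haar_signs
begin

lemma delta_eq:
  assumes U: "U \<in> carrier_mat N N"
  shows "delta w U x = 4 * (ip N w x)\<^sup>2 * qf N d U w w - 4 * ip N w x * qf N d U w x"
  unfolding delta_def qf_refl[OF U] qf_linear qf_commute[of N d U x w]
  by (simp add: power2_eq_square algebra_simps)

text \<open>The energy change is a polynomial in <w, x>, <w, Jx> and <w, Jw>. The last is at most 1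
  in size; as the normal combines e_j with row j of G, the others split into fixed parts x_j,
  \<open>v j\<close> and random parts \<open>X\<close>, \<open>Y\<close>, and x_j is a sign.\<close>

lemma delta_square_le:
  assumes U: "U \<in> orthogonal_group N" and G: "G \<in> orthogonal_group N" and j: "j < N" and x: "x \<in> spins N"
  defines "X \<equiv> ip N (row_fun G j) x" and "v \<equiv> (\<lambda>i. qf N d U (unit_fun i) x)"
  defines "Y \<equiv> ip N (row_fun G j) v"
  shows "(delta (row_normal j G) U x)\<^sup>2 \<le> 32 * ((1 + X\<^sup>2) * ((v j)\<^sup>2 + Y\<^sup>2) + (1 + X\<^sup>2)\<^sup>2)"
proof -
  note Uc = orthogonal_groupD(1)[OF U]
  let ?w = "row_normal j G"
  define a where "a = ip N ?w x"
  define b where "b = qf N d U ?w x"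
  define c where "c = qf N d U ?w ?w"
  note k = row_sign_ge[of j G] and s = row_sign_square(2)[of j G]
  have "\<bar>c\<bar> \<le> 1"
    using abs_qf_le[OF U signs, where x = ?w and y = ?w] row_normal_unit[OF G j] by (simp add: c_def)
  then have c2: "c\<^sup>2 \<le> 1" by (simp add: abs_square_le_1)
  have "a\<^sup>2 \<le> (x j)\<^sup>2 + X\<^sup>2"
    unfolding a_def row_normal_scaled ip_scale_left ip_diff_left ip_unit_fun_left[OF j] X_def
    by (rule scaled_difference_square_le[OF k s])
  also have "(x j)\<^sup>2 = 1" using spins_square[OF x j] by (simp add: power2_eq_square)
  finally have a2: "a\<^sup>2 \<le> 1 + X\<^sup>2" .
  have "b\<^sup>2 \<le> (v j)\<^sup>2 + Y\<^sup>2"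
    unfolding b_def row_normal_scaled qf_scale_left qf_diff_left v_def Y_def
    by (subst qf_expand[OF Uc, of d "row_fun G j" x]) (rule scaled_difference_square_le[OF k s])
  then have ab: "a\<^sup>2 * b\<^sup>2 \<le> (1 + X\<^sup>2) * ((v j)\<^sup>2 + Y\<^sup>2)" using a2 by (intro mult_mono) auto
  have aa: "(a\<^sup>2)\<^sup>2 \<le> (1 + X\<^sup>2)\<^sup>2" using a2 by (intro power_mono) auto
  have "(a\<^sup>2)\<^sup>2 * c\<^sup>2 \<le> (a\<^sup>2)\<^sup>2 * 1" using c2 by (intro mult_left_mono) auto
  then have aac: "(a\<^sup>2 * c)\<^sup>2 \<le> (a\<^sup>2)\<^sup>2" by (simp add: power_mult_distrib)
  have "(delta ?w U x)\<^sup>2 = 16 * (a\<^sup>2 * c - a * b)\<^sup>2"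
    unfolding delta_eq[OF Uc] a_def b_def c_def by (simp add: power2_eq_square algebra_simps)
  also have "\<dots> \<le> 16 * (2 * (a\<^sup>2 * c)\<^sup>2 + 2 * (a * b)\<^sup>2)"
    using zero_le_power2[of "a\<^sup>2 * c + a * b"] by (simp add: power2_eq_square algebra_simps)
  also have "\<dots> \<le> 32 * ((1 + X\<^sup>2) * ((v j)\<^sup>2 + Y\<^sup>2) + (1 + X\<^sup>2)\<^sup>2)"
    using ab aa aac by (simp add: power_mult_distrib)
  finally show ?thesis .
qed

text \<open>The last n coordinates of x have squared norm exactly n, so X has moments of order 1.
  Those of v = Jx have squared norm at most N, so Y^2 has mean at most c = N/n and Y^4 at most 3c^2.
  Inserting these gives 4c + 6 next to the fixed term.\<close>

lemma delta_average_le: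
  assumes n: "1 \<le> n" "n \<le> N" and H: "haar \<nu> n" and U: "U \<in> orthogonal_group N" and x: "x \<in> spins N"
  shows "(\<integral>g. (delta (row_normal (N - n) (embed N n g)) U x)\<^sup>2 \<partial>\<nu>) \<le>
    32 * (2 * (qf N d U (unit_fun (N - n)) x)\<^sup>2 + 4 * N / n + 6)"
proof -
  interpret Hn: haar \<nu> n by fact
  define v where "v = (\<lambda>i. qf N d U (unit_fun i) x)"
  define j where "j = N - n"
  define X where "X = (\<lambda>g. mv n g (\<lambda>l. x (l + (N - n))) 0)"
  define Y where "Y = (\<lambda>g. mv n g (\<lambda>l. v (l + (N - n))) 0)"
  define b where "b = ip n (\<lambda>l. v (l + (N - n))) (\<lambda>l. v (l + (N - n)))"
  define c where "c = real N / real n"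
  have n0: "0 < n" and jN: "j < N" using n by (auto simp: j_def)
  have c0: "c > 0" using n by (simp add: c_def)
  have "ip N v v = ip N x x"
    using sum_qf_unit_square[OF U signs, where x = x] by (simp add: ip_def v_def power2_eq_square)
  then have b: "0 \<le> b" "b \<le> N"
    using ip_nonneg ip_shift_le[OF n(2), of v] ip_spins[OF x] by (auto simp: b_def)
  have iX: "integrable \<nu> (\<lambda>g. X g ^ k)" and iY: "integrable \<nu> (\<lambda>g. Y g ^ k)" for k
    unfolding X_def Y_def by (rule mv_power_integrable[OF H n0])+
  have X2: "(\<integral>g. (X g)\<^sup>2 \<partial>\<nu>) = 1"
    unfolding X_def Hn.row_second_moment[OF n0] ip_shift_spins[OF n(2) x] using n by simp
  have X4: "(\<integral>g. (X g) ^ 4 \<partial>\<nu>) \<le> 3"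
    using Hn.row_fourth_moment[OF n0, of "\<lambda>l. x (l + (N - n))"] n
    unfolding X_def ip_shift_spins[OF n(2) x] by simp
  have "b / n \<le> c" using b unfolding c_def by (intro divide_right_mono) auto
  then have Y2: "(\<integral>g. (Y g)\<^sup>2 \<partial>\<nu>) \<le> c"
    unfolding Y_def Hn.row_second_moment[OF n0] b_def by simp
  have Y4: "(\<integral>g. (Y g) ^ 4 \<partial>\<nu>) \<le> 3 * c\<^sup>2"
  proof -
    have "(\<integral>g. (Y g) ^ 4 \<partial>\<nu>) \<le> 3 * b\<^sup>2 / (real n)\<^sup>2"
      unfolding Y_def b_def by (rule Hn.row_fourth_moment[OF n0])
    also have "\<dots> \<le> 3 * (real N)\<^sup>2 / (real n)\<^sup>2"
      using power_mono[OF b(2,1), of 2] by (intro divide_right_mono) auto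
    finally show ?thesis by (simp add: c_def power_divide)
  qed
  let ?p = "\<lambda>g. 1 + (v j)\<^sup>2 + ((v j)\<^sup>2 + 2) * (X g)\<^sup>2 + (Y g)\<^sup>2 + (c / 2 + 1) * (X g) ^ 4 + (1 / (2 * c)) * (Y g) ^ 4"
  have pt: "(delta (row_normal j (embed N n g)) U x)\<^sup>2 \<le> 32 * ?p g" if "g \<in> space \<nu>" for g
  proof -
    have g: "g \<in> orthogonal_group n" using that by simp
    note gc = orthogonal_groupD(1)[OF g]
    have XY: "ip N (row_fun (embed N n g) j) x = X g" "ip N (row_fun (embed N n g) j) v = Y g"
      unfolding j_def X_def Y_def by (rule ip_row_embed[OF n gc])+
    \<comment> \<open>Young's inequality with weight \<open>c\<close>, which balances the fourth
      moments: both terms have mean at most 3c/2.\<close>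
    have "(X g)\<^sup>2 * (Y g)\<^sup>2 \<le> (c / 2) * (X g) ^ 4 + (1 / (2 * c)) * (Y g) ^ 4"
    proof -
      have "0 \<le> (c * (X g)\<^sup>2 - (Y g)\<^sup>2)\<^sup>2 / (2 * c)" using c0 by simp
      also have "\<dots> = (c / 2) * (X g) ^ 4 + (1 / (2 * c)) * (Y g) ^ 4 - (X g)\<^sup>2 * (Y g)\<^sup>2"
        using c0 by (simp add: field_simps power2_eq_square power4_eq_xxxx)
      finally show ?thesis by simp
    qed
    then have le: "(1 + (X g)\<^sup>2) * ((v j)\<^sup>2 + (Y g)\<^sup>2) + (1 + (X g)\<^sup>2)\<^sup>2 \<le> ?p g"
      by (simp add: power2_eq_square power4_eq_xxxx algebra_simps)
    have vi: "qf N d U (unit_fun i) x = v i" for i by (simp add: v_def)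
    have "(delta (row_normal j (embed N n g)) U x)\<^sup>2 \<le>
        32 * ((1 + (X g)\<^sup>2) * ((v j)\<^sup>2 + (Y g)\<^sup>2) + (1 + (X g)\<^sup>2)\<^sup>2)"
      using delta_square_le[OF U embed_orthogonal[OF n(2) g] jN x] unfolding vi XY .
    also have "\<dots> \<le> 32 * ?p g" by (rule mult_left_mono[OF le]) simp
    finally show ?thesis .
  qed
  have "(\<integral>g. (delta (row_normal j (embed N n g)) U x)\<^sup>2 \<partial>\<nu>) \<le> (\<integral>g. 32 * ?p g \<partial>\<nu>)"
  proof (rule integral_mono)
    show "integrable \<nu> (\<lambda>g. 32 * ?p g)"
      by (intro integrable_mult_right Bochner_Integration.integrable_add iX iY) simp_all
    show "integrable \<nu> (\<lambda>g. (delta (row_normal j (embed N n g)) U x)\<^sup>2)"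
    proof (rule bounded_integrable[OF Hn.prob_space_axioms])
      have m: "(\<lambda>g. embed N n g) \<in> measurable \<nu> (orthogonal_borel N)"
        unfolding Hn.measurable_haar by (rule embed_measurable[OF n(2) measurable_ident_sets[OF refl]])
      show "(\<lambda>g. (delta (row_normal j (embed N n g)) U x)\<^sup>2) \<in> borel_measurable \<nu>"
        by (intro borel_measurable_power delta_measurable row_refl_measurable[OF jN m]) (use U in simp)
      fix g assume "g \<in> space \<nu>"
      then have "g \<in> orthogonal_group n" by simp
      then have "ip N (row_normal j (embed N n g)) (row_normal j (embed N n g)) = 1"
        by (intro row_normal_unit[OF embed_orthogonal[OF n(2)] jN])
      from power_mono[OF abs_delta_le[OF U this x] abs_ge_zero, of 2]
      show "\<bar>(delta (row_normal j (embed N n g)) U x)\<^sup>2\<bar> \<le> (2 * N)\<^sup>2" by simp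
    qed
  qed (rule pt)
  also have "\<dots> = 32 * (1 + (v j)\<^sup>2 + ((v j)\<^sup>2 + 2) * (\<integral>g. (X g)\<^sup>2 \<partial>\<nu>) + (\<integral>g. (Y g)\<^sup>2 \<partial>\<nu>)
      + (c / 2 + 1) * (\<integral>g. (X g) ^ 4 \<partial>\<nu>) + (1 / (2 * c)) * (\<integral>g. (Y g) ^ 4 \<partial>\<nu>))"
    using iX[of 2] iX[of 4] iY[of 2] iY[of 4] Hn.prob_space
    by (simp add: Bochner_Integration.integral_add)
  also have "\<dots> \<le> 32 * (1 + (v j)\<^sup>2 + ((v j)\<^sup>2 + 2) * 1 + c + (c / 2 + 1) * 3 + (1 / (2 * c)) * (3 * c\<^sup>2))"
    unfolding X2 using c0 X4 Y2 Y4 by (intro mult_left_mono add_mono order_refl) auto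
  also have "\<dots> = 32 * (2 * (v j)\<^sup>2 + 4 * c + 6)"
    using c0 by (simp add: field_simps power2_eq_square)
  finally show ?thesis by (simp add: v_def j_def c_def)
qed

end

text \<open>The chain uses a Haar measure on every O(n) with n up to N; the theorem supplies one in
  each dimension, so all members of the chain come from the same sequence.\<close>

locale haar_sequence =
  fixes N :: nat and \<mu> :: "nat \<Rightarrow> real mat measure" and d :: "nat \<Rightarrow> real" and \<beta> :: real
  assumes N: "1 \<le> N" and haar_mu: "\<And>n. 1 \<le> n \<Longrightarrow> n \<le> N \<Longrightarrow> is_haar n (\<mu> n)"
    and signs: "\<And>i. i < N \<Longrightarrow> d i \<in> {-1, 1}" and \<beta>: "0 \<le> \<beta>"

sublocale haar_sequence \<subseteq> haar_signs "\<mu> N" N d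
  using haarI[OF haar_mu[OF N order_refl]] signs by (simp add: haar_signs_def haar_signs_axioms_def)

sublocale haar_sequence \<subseteq> rotation_chain N \<mu> "\<lambda>U. ln (Zf N d \<beta> U)" "\<beta> * N"
proof
  show "(\<lambda>U. ln (Zf N d \<beta> U)) \<in> borel_measurable (orthogonal_borel N)"
    by (rule measurable_compose[OF Zf_measurable]) simp
  show "\<bar>ln (Zf N d \<beta> A)\<bar> \<le> \<beta> * N" if "A \<in> orthogonal_group N" for A
    by (rule abs_ln_Zf_le[OF that \<beta>])
  show "ln (Zf N d \<beta> (refl_mat N (unit_fun j) * A)) = ln (Zf N d \<beta> A)"
    if "j < N" "A \<in> orthogonal_group N" for j A
    using Zf_flip[OF that(1) orthogonal_groupD(1)[OF that(2)]] by simp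
qed (use N haar_mu in auto)

context haar_sequence
begin

lemma gibbs_field_integrable:
  assumes i: "i < N"
  shows "integrable (\<mu> N) (\<lambda>U. gibbs N d \<beta> U (\<lambda>x. (qf N d U (unit_fun i) x)\<^sup>2))"
proof (rule bounded_integrable[OF prob_n[OF N order_refl]])
  show "(\<lambda>U. gibbs N d \<beta> U (\<lambda>x. (qf N d U (unit_fun i) x)\<^sup>2)) \<in> borel_measurable (\<mu> N)"
    unfolding gibbs_def measurable_n[OF N order_refl]
    by (intro borel_measurable_divide borel_measurable_sum borel_measurable_times borel_measurable_power
      measurable_compose[OF _ borel_measurable_exp] borel_measurable_const qf_spin_measurable)
  fix U assume "U \<in> space (\<mu> N)"
  then have U: "U \<in> orthogonal_group N" by simp
  have "gibbs N d \<beta> U (\<lambda>x. (qf N d U (unit_fun i) x)\<^sup>2) \<le> gibbs N d \<beta> U (\<lambda>_. N)"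
  proof (rule gibbs_mono)
    fix x assume x: "x \<in> spins N"
    have "(qf N d U (unit_fun i) x)\<^sup>2 \<le> (\<Sum>j<N. (qf N d U (unit_fun j) x)\<^sup>2)"
      using i by (intro member_le_sum) auto
    also have "\<dots> = N" using sum_qf_unit_square[OF U signs] ip_spins[OF x] by simp
    finally show "(qf N d U (unit_fun i) x)\<^sup>2 \<le> N" .
  qed
  moreover have "gibbs N d \<beta> U (\<lambda>_. 0) \<le> gibbs N d \<beta> U (\<lambda>x. (qf N d U (unit_fun i) x)\<^sup>2)"
    by (rule gibbs_mono) simp
  ultimately show "\<bar>gibbs N d \<beta> U (\<lambda>x. (qf N d U (unit_fun i) x)\<^sup>2)\<bar> \<le> N"
    unfolding gibbs_const by simp
qed

text \<open>J preserves the norm, so the squared fields of a configuration sum to N. Only this total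
  matters, since each stage of the chain uses a different coordinate.\<close>

lemma sum_gibbs_field:
  "(\<Sum>i<N. (\<integral>U. gibbs N d \<beta> U (\<lambda>x. (qf N d U (unit_fun i) x)\<^sup>2) \<partial>\<mu> N)) = N"
proof -
  have "(\<Sum>i<N. (\<integral>U. gibbs N d \<beta> U (\<lambda>x. (qf N d U (unit_fun i) x)\<^sup>2) \<partial>\<mu> N)) =
      (\<integral>U. (\<Sum>i<N. gibbs N d \<beta> U (\<lambda>x. (qf N d U (unit_fun i) x)\<^sup>2)) \<partial>\<mu> N)"
    by (rule Bochner_Integration.integral_sum[symmetric]) (use gibbs_field_integrable in simp)
  also have "\<dots> = (\<integral>U. real N \<partial>\<mu> N)"
  proof (rule Bochner_Integration.integral_cong[OF refl])
    fix U assume "U \<in> space (\<mu> N)"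
    then have U: "U \<in> orthogonal_group N" by simp
    have "(\<Sum>i<N. gibbs N d \<beta> U (\<lambda>x. (qf N d U (unit_fun i) x)\<^sup>2)) =
        gibbs N d \<beta> U (\<lambda>x. \<Sum>i<N. (qf N d U (unit_fun i) x)\<^sup>2)"
      unfolding gibbs_def sum_divide_distrib[symmetric] sum_distrib_left by (subst sum.swap) (rule refl)
    also have "\<dots> = gibbs N d \<beta> U (\<lambda>_. real N)"
      by (rule gibbs_cong) (simp add: sum_qf_unit_square[OF U signs] ip_spins)
    finally show "(\<Sum>i<N. gibbs N d \<beta> U (\<lambda>x. (qf N d U (unit_fun i) x)\<^sup>2)) = real N"
      unfolding gibbs_const .
  qed
  also have "\<dots> = real N" by (rule const_n[OF N order_refl])
  finally show ?thesis .
qed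

text \<open>Integrating first over \<open>g\<close> at fixed U is what makes the average over the
  random row available for each configuration separately.\<close>

lemma D_average_le:
  assumes n: "1 \<le> n" "n \<le> N"
  shows "(\<integral>g. D (N - n) (embed N n g) \<partial>\<mu> n) \<le> 64 * \<beta>\<^sup>2 *
    (2 * (\<integral>U. gibbs N d \<beta> U (\<lambda>x. (qf N d U (unit_fun (N - n)) x)\<^sup>2) \<partial>\<mu> N) + 4 * N / n + 6)"
proof -
  note Hn = haar_n[OF n] and pn = prob_n[OF n] and pN = prob_n[OF N order_refl]
  have jN: "N - n < N" using n by simp
  let ?w = "\<lambda>g. row_normal (N - n) (embed N n g)"
  let ?f = "\<lambda>g U. gibbs N d \<beta> U (\<lambda>x. (delta (?w g) U x)\<^sup>2)"
  have sp: "embed N n g \<in> orthogonal_group N" if "g \<in> space (\<mu> n)" for g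
    using that by (intro embed_orthogonal[OF n(2)]) (simp only: space_n[OF n])
  have w1: "ip N (?w g) (?w g) = 1" if "g \<in> space (\<mu> n)" for g
    using row_normal_unit[OF sp[OF that] jN] .
  have m: "(\<lambda>(g, U). ?f g U) \<in> borel_measurable (\<mu> n \<Otimes>\<^sub>M \<mu> N)"
    unfolding split_beta
    by (intro gibbs_delta_measurable row_refl_measurable jN embed_measurable n fst_n snd_n N order_refl)
  have fB: "\<bar>?f g U\<bar> \<le> (2 * N)\<^sup>2" if "g \<in> space (\<mu> n)" "U \<in> space (\<mu> N)" for g U
    using that by (intro gibbs_delta_bounded w1) simp_all
  have eid: "(\<lambda>g. embed N n g) \<in> measurable (\<mu> n) (orthogonal_borel N)"
    by (rule embed_measurable[OF n(2) id_n[OF n]])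
  have fg: "\<bar>\<integral>U. ?f g U \<partial>\<mu> N\<bar> \<le> (2 * N)\<^sup>2" if "g \<in> space (\<mu> n)" for g
  proof (rule abs_integral_le[OF pN _ fB[OF that]])
    show "?f g \<in> borel_measurable (\<mu> N)"
      by (rule gibbs_delta_measurable[OF _ id_n[OF N order_refl]])
        (use row_refl_orthogonal[OF sp[OF that] jN] in simp)
  qed
  have "(\<integral>g. D (N - n) (embed N n g) \<partial>\<mu> n) \<le> (\<integral>g. 2 * \<beta>\<^sup>2 * (\<integral>U. ?f g U \<partial>\<mu> N) \<partial>\<mu> n)"
  proof (rule integral_mono)
    show "integrable (\<mu> n) (\<lambda>g. D (N - n) (embed N n g))"
      by (rule bounded_integrable[OF pn measurable_compose[OF eid D_measurable[OF jN]] D_bounded[OF jN sp]])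
    show "integrable (\<mu> n) (\<lambda>g. 2 * \<beta>\<^sup>2 * (\<integral>U. ?f g U \<partial>\<mu> N))"
      by (intro integrable_mult_right bounded_integrable[OF pn bounded_Fubini(2)[OF pn pN m fB] fg])
    show "D (N - n) (embed N n g) \<le> 2 * \<beta>\<^sup>2 * (\<integral>U. ?f g U \<partial>\<mu> N)" if "g \<in> space (\<mu> n)" for g
      unfolding D_def by (rule reflection_energy_gibbs[OF w1[OF that] \<beta>])
  qed
  also have "\<dots> = 2 * \<beta>\<^sup>2 * (\<integral>U. (\<integral>g. ?f g U \<partial>\<mu> n) \<partial>\<mu> N)"
    by (simp only: Bochner_Integration.integral_mult_right_zero bounded_Fubini(1)[OF pn pN m fB])
  finally have outer: "(\<integral>g. D (N - n) (embed N n g) \<partial>\<mu> n) \<le> 2 * \<beta>\<^sup>2 * (\<integral>U. (\<integral>g. ?f g U \<partial>\<mu> n) \<partial>\<mu> N)" .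
  have "(\<integral>U. (\<integral>g. ?f g U \<partial>\<mu> n) \<partial>\<mu> N) \<le>
      (\<integral>U. 32 * (2 * gibbs N d \<beta> U (\<lambda>x. (qf N d U (unit_fun (N - n)) x)\<^sup>2) + (4 * N / n + 6)) \<partial>\<mu> N)"
  proof (rule integral_mono)
    have fU: "\<bar>\<integral>g. ?f g U \<partial>\<mu> n\<bar> \<le> (2 * N)\<^sup>2" if "U \<in> space (\<mu> N)" for U
    proof (rule abs_integral_le[OF pn _ fB[OF _ that]])
      show "(\<lambda>g. ?f g U) \<in> borel_measurable (\<mu> n)"
        by (rule gibbs_delta_measurable[OF row_refl_measurable[OF jN eid]]) (use that in simp)
    qed
    show "integrable (\<mu> N) (\<lambda>U. \<integral>g. ?f g U \<partial>\<mu> n)"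
      by (rule bounded_integrable[OF pN bounded_Fubini(3)[OF pn pN m fB] fU])
    show "integrable (\<mu> N) (\<lambda>U. 32 * (2 * gibbs N d \<beta> U (\<lambda>x. (qf N d U (unit_fun (N - n)) x)\<^sup>2) + (4 * N / n + 6)))"
      by (intro integrable_mult_right Bochner_Integration.integrable_add gibbs_field_integrable[OF jN]
        finite_measure.integrable_const[OF prob_space.finite_measure[OF pN]])
    fix U assume "U \<in> space (\<mu> N)"
    then have U: "U \<in> orthogonal_group N" by simp
    have int: "integrable (\<mu> n) (\<lambda>g. (delta (?w g) U x)\<^sup>2)" if x: "x \<in> spins N" for x
    proof (rule bounded_integrable[OF pn])
      show "(\<lambda>g. (delta (?w g) U x)\<^sup>2) \<in> borel_measurable (\<mu> n)"
        by (intro borel_measurable_power delta_measurable row_refl_measurable[OF jN eid]) (use U in simp)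
      show "\<bar>(delta (?w g) U x)\<^sup>2\<bar> \<le> (2 * N)\<^sup>2" if "g \<in> space (\<mu> n)" for g
        using power_mono[OF abs_delta_le[OF U w1[OF that] x] abs_ge_zero, of 2] by simp
    qed
    \<comment> \<open>The Gibbs weights depend on U but not on \<open>g\<close>, so the integral
      passes inside.\<close>
    have "(\<integral>g. ?f g U \<partial>\<mu> n) = gibbs N d \<beta> U (\<lambda>x. \<integral>g. (delta (?w g) U x)\<^sup>2 \<partial>\<mu> n)"
      unfolding gibbs_def Bochner_Integration.integral_divide_zero
      by (subst Bochner_Integration.integral_sum) (use int in auto)
    also have "\<dots> \<le> gibbs N d \<beta> U (\<lambda>x. 32 * (2 * (qf N d U (unit_fun (N - n)) x)\<^sup>2 + (4 * N / n + 6)))"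
      by (rule gibbs_mono) (use delta_average_le[OF n Hn U] in \<open>simp add: add.assoc\<close>)
    also have "\<dots> = 32 * (2 * gibbs N d \<beta> U (\<lambda>x. (qf N d U (unit_fun (N - n)) x)\<^sup>2) + (4 * N / n + 6))"
      unfolding gibbs_scale gibbs_add gibbs_const ..
    finally show "(\<integral>g. ?f g U \<partial>\<mu> n) \<le>
      32 * (2 * gibbs N d \<beta> U (\<lambda>x. (qf N d U (unit_fun (N - n)) x)\<^sup>2) + (4 * N / n + 6))" .
  qed
  also have "\<dots> = 32 * (2 * (\<integral>U. gibbs N d \<beta> U (\<lambda>x. (qf N d U (unit_fun (N - n)) x)\<^sup>2) \<partial>\<mu> N) + (4 * N / n + 6))"
    using gibbs_field_integrable[OF jN] const_n[OF N order_refl, of "4 * N / n + 6"]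
    by (simp only: Bochner_Integration.integral_mult_right_zero Bochner_Integration.integral_add
      Bochner_Integration.integrable_mult_right finite_measure.integrable_const[OF prob_space.finite_measure[OF pN]])
  finally have "2 * \<beta>\<^sup>2 * (\<integral>U. (\<integral>g. ?f g U \<partial>\<mu> n) \<partial>\<mu> N) \<le> 2 * \<beta>\<^sup>2 *
      (32 * (2 * (\<integral>U. gibbs N d \<beta> U (\<lambda>x. (qf N d U (unit_fun (N - n)) x)\<^sup>2) \<partial>\<mu> N) + (4 * N / n + 6)))"
    by (rule mult_left_mono) simp
  from order_trans[OF outer this] show ?thesis by (simp add: algebra_simps)
qed

text \<open>Summing the stages: the fields contribute 2N, the constants 6N, and the terms 4N/n the
  harmonic number.\<close>

theorem variance_ln_Zf:
  "(\<integral>U. (ln (Zf N d \<beta> U))\<^sup>2 \<partial>\<mu> N) - (\<integral>U. ln (Zf N d \<beta> U) \<partial>\<mu> N)\<^sup>2 \<le> 32 * \<beta>\<^sup>2 * (N * (8 + 4 * harm N))"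
proof -
  define e where "e = (\<lambda>i. \<integral>U. gibbs N d \<beta> U (\<lambda>x. (qf N d U (unit_fun i) x)\<^sup>2) \<partial>\<mu> N)"
  have e0: "0 \<le> e i" for i
    unfolding e_def
  proof (rule Bochner_Integration.integral_nonneg)
    show "0 \<le> gibbs N d \<beta> U (\<lambda>x. (qf N d U (unit_fun i) x)\<^sup>2)" for U
      using gibbs_mono[of N "\<lambda>_. 0" "\<lambda>x. (qf N d U (unit_fun i) x)\<^sup>2" d \<beta> U] by (simp add: gibbs_const)
  qed
  define t where "t = (\<lambda>n. 32 * \<beta>\<^sup>2 * (2 * e (N - n) + 4 * real N * inverse (real n) + 6))"
  have t0: "0 \<le> t n" for n
    unfolding t_def by (intro mult_nonneg_nonneg add_nonneg_nonneg e0) simp_all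
  have "(\<integral>U. (ln (Zf N d \<beta> U))\<^sup>2 \<partial>\<mu> N) - (\<integral>U. ln (Zf N d \<beta> U) \<partial>\<mu> N)\<^sup>2 \<le>
      (\<Sum>n = 2..N. (1 / 2) * (\<integral>g. D (N - n) (embed N n g) \<partial>\<mu> n))"
    by (rule variance_le)
  also have "\<dots> \<le> (\<Sum>n = 2..N. t n)"
  proof (rule sum_mono)
    fix n assume "n \<in> {2..N}"
    then have n: "1 \<le> n" "n \<le> N" by simp_all
    let ?d = "\<integral>g. D (N - n) (embed N n g) \<partial>\<mu> n"
    have "?d \<le> 64 * \<beta>\<^sup>2 * (2 * e (N - n) + 4 * N / n + 6)"
      unfolding e_def by (rule D_average_le[OF n])
    also have "\<dots> = 2 * t n" unfolding t_def by (simp add: divide_inverse)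
    finally show "(1 / 2) * ?d \<le> t n" by linarith
  qed
  \<comment> \<open>The nonnegative term for n = 1 is added so that N - n runs through all
    coordinates and the reciprocals form \<open>harm N\<close>.\<close>
  also have "\<dots> \<le> sum t {1..N}" by (rule sum_mono2) (simp_all add: t0)
  also have "\<dots> = 32 * \<beta>\<^sup>2 * (2 * (\<Sum>n = 1..N. e (N - n)) + 4 * N * harm N + 6 * N)"
    unfolding t_def harm_def by (simp add: sum_distrib_left[symmetric] sum.distrib)
  also have "(\<Sum>n = 1..N. e (N - n)) = (\<Sum>i<N. e i)"
    by (rule sum.reindex_bij_witness[of _ "\<lambda>i. N - i" "\<lambda>n. N - n"]) auto
  also have "\<dots> = N" unfolding e_def by (rule sum_gibbs_field)
  finally show ?thesis by (simp add: algebra_simps)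
qed

end

section \<open>Convergence in probability\<close>

context haar_sequence
begin

text \<open>Chebyshev locates ln Z near its mean, the moments locate that mean near N
  \<open>Lam\<close>. The constant exp(-3)/8 is a lower bound for M^2/(4S), the Paley-Zygmund
  probability, from the bounds on the first moment M and the second moment S; a smaller exceptional
  set cannot cover the event Z at least M/2.\<close>

lemma ln_Zf_concentration:
  fixes \<epsilon> :: real
  assumes N2: "2 \<le> N" and \<beta>16: "\<beta> \<le> 1 / 16" and \<epsilon>: "0 < \<epsilon>" "8 \<le> \<epsilon> * N"
    and v: "512 * \<beta>\<^sup>2 * ((8 + 4 * harm N) / N) / \<epsilon>\<^sup>2 < exp (- 3) / 8"
    and A: "A \<subseteq> space (\<mu> N)" "\<And>U. U \<in> A \<Longrightarrow> \<epsilon> < \<bar>(1 / N) * ln (Zf N d \<beta> U) - Lam sign_mean \<beta>\<bar>"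
  shows "measure (\<mu> N) A \<le> 512 * \<beta>\<^sup>2 * ((8 + 4 * harm N) / N) / \<epsilon>\<^sup>2"
proof -
  let ?v = "512 * \<beta>\<^sup>2 * ((8 + 4 * harm N) / N) / \<epsilon>\<^sup>2"
  let ?Z = "Zf N d \<beta>" and ?L = "N * Lam sign_mean \<beta>"
  define F where "F = (\<lambda>U. ln (?Z U))"
  define m where "m = (\<integral>U. F U \<partial>\<mu> N)"
  \<comment> \<open>A quarter of the allowed deviation for the fluctuation; the rest leaves room for
    the distance of the mean from N \<open>Lam\<close>, at most a + 2.\<close>
  define a where "a = \<epsilon> * N / 4"
  define bad where "bad = {U \<in> space (\<mu> N). a \<le> \<bar>F U - m\<bar>}"
  define M where "M = (\<integral>U. ?Z U \<partial>\<mu> N)"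
  define S where "S = (\<integral>U. (?Z U)\<^sup>2 \<partial>\<mu> N)"
  have a: "2 \<le> a" "0 < a" using \<epsilon>(2) by (simp_all add: a_def)
  have Zm: "?Z \<in> borel_measurable (\<mu> N)" unfolding measurable_n[OF N order_refl] by (rule Zf_measurable)
  have Fm: "F \<in> borel_measurable (\<mu> N)" unfolding F_def using Zm by measurable
  have FB: "\<bar>F U\<bar> \<le> \<beta> * N" if "U \<in> space (\<mu> N)" for U
    unfolding F_def using that by (intro abs_ln_Zf_le \<beta>) simp
  have ZB: "\<bar>?Z U\<bar> \<le> exp (\<beta> * N)" if "U \<in> space (\<mu> N)" for U
  proof -
    have "exp (F U) \<le> exp (\<beta> * N)" using abs_le_D1[OF FB[OF that]] by simp
    then show ?thesis using Zf_pos[of N d \<beta> U] by (simp add: F_def)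
  qed
  note pN = prob_space_axioms
  have iF: "integrable (\<mu> N) F" by (rule bounded_integrable[OF pN Fm FB])
  have iF2: "integrable (\<mu> N) (\<lambda>U. (F U)\<^sup>2)"
  proof (rule bounded_integrable[OF pN borel_measurable_power[OF Fm]])
    show "\<bar>(F U)\<^sup>2\<bar> \<le> (\<beta> * N)\<^sup>2" if "U \<in> space (\<mu> N)" for U
      using power_mono[OF FB[OF that] abs_ge_zero, of 2] by simp
  qed
  have iZ: "integrable (\<mu> N) ?Z" by (rule bounded_integrable[OF pN Zm ZB])
  have iZ2: "integrable (\<mu> N) (\<lambda>U. (?Z U)\<^sup>2)"
  proof (rule bounded_integrable[OF pN borel_measurable_power[OF Zm]])
    show "\<bar>(?Z U)\<^sup>2\<bar> \<le> (exp (\<beta> * N))\<^sup>2" if "U \<in> space (\<mu> N)" for U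
      using power_mono[OF ZB[OF that] abs_ge_zero, of 2] by simp
  qed
  have bad: "bad \<in> sets (\<mu> N)" unfolding bad_def using Fm by measurable
  have P: "measure (\<mu> N) bad \<le> ?v"
  proof -
    have "measure (\<mu> N) bad \<le> variance F / a\<^sup>2"
      unfolding bad_def m_def by (rule Chebyshev_inequality[OF Fm iF2 a(2)])
    also have "variance F = (\<integral>U. (F U)\<^sup>2 \<partial>\<mu> N) - (\<integral>U. F U \<partial>\<mu> N)\<^sup>2"
      by (rule variance_eq[OF iF iF2])
    also have "\<dots> / a\<^sup>2 \<le> 32 * \<beta>\<^sup>2 * (N * (8 + 4 * harm N)) / a\<^sup>2"
      unfolding F_def by (rule divide_right_mono[OF variance_ln_Zf]) simp
    also have "\<dots> = ?v" using N2 \<epsilon>(1) by (simp add: a_def field_simps power2_eq_square)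
    finally show ?thesis .
  qed
  have M_le: "M \<le> exp ?L" and M_ge: "exp (?L - 1) \<le> M"
    unfolding M_def using first_moment_Zf[OF N2 \<beta>] \<beta>16 by auto
  have S_le: "S \<le> 2 * exp (2 * ?L + 1)"
    unfolding S_def using second_moment_Zf[OF N2 \<beta> \<beta>16] by (simp add: mult.assoc)
  have M0: "0 < M" using M_ge exp_gt_zero[of "?L - 1"] by linarith
  \<comment> \<open>Jensen for the logarithm, in the form 1 + y \<le> exp y with y = ln Z -
    m.\<close>
  have upper: "m \<le> ?L"
  proof -
    have "1 = (\<integral>U. 1 + (F U - m) \<partial>\<mu> N)"
      using iF prob_space by (simp add: Bochner_Integration.integral_add Bochner_Integration.integral_diff m_def)
    also have "\<dots> \<le> (\<integral>U. exp (- m) * ?Z U \<partial>\<mu> N)"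
    proof (rule integral_mono)
      show "integrable (\<mu> N) (\<lambda>U. 1 + (F U - m))" using iF by simp
      show "integrable (\<mu> N) (\<lambda>U. exp (- m) * ?Z U)" using iZ by simp
      fix U
      have "1 + (F U - m) \<le> exp (F U - m)" by (rule exp_ge_add_one_self)
      also have "\<dots> = exp (- m) * ?Z U" using Zf_pos[of N d \<beta> U] by (simp add: exp_diff exp_minus F_def field_simps)
      finally show "1 + (F U - m) \<le> exp (- m) * ?Z U" .
    qed
    also have "\<dots> = exp (- m) * M" by (simp add: M_def)
    also have "\<dots> \<le> exp (- m) * exp ?L" using M_le by (intro mult_left_mono) auto
    finally have "exp 0 \<le> exp (?L - m)" by (simp add: exp_diff exp_minus field_simps)
    then show ?thesis by simp
  qed
  text \<open>Paley-Zygmund, with \<open>Z \<le> l Z\<^sup>2 / 2 + 1 / (2 l)\<close> in place of the Cauchy-Schwarz inequality.\<close>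
  have "\<exists>U\<in>space (\<mu> N) - bad. M / 2 \<le> ?Z U"
  proof (rule ccontr)
    assume neg: "\<not> (\<exists>U\<in>space (\<mu> N) - bad. M / 2 \<le> ?Z U)"
    have "0 < M\<^sup>2" using M0 by simp
    also have "M\<^sup>2 \<le> S" unfolding M_def S_def by (rule square_integral_le[OF pN Zm ZB])
    finally have S0: "0 < S" .
    \<comment> \<open>Makes the term with the second moment equal to M/4, so that M/4 is left to be
      paid by the exceptional set.\<close>
    define l where "l = M / (2 * S)"
    have l: "0 < l" using M0 S0 by (simp add: l_def)
    have "M \<le> (\<integral>U. M / 2 + (l / 2 * (?Z U)\<^sup>2 + 1 / (2 * l) * indicator bad U) \<partial>\<mu> N)"
    proof -
      have "(\<integral>U. ?Z U \<partial>\<mu> N) \<le> (\<integral>U. M / 2 + (l / 2 * (?Z U)\<^sup>2 + 1 / (2 * l) * indicator bad U) \<partial>\<mu> N)"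
      proof (rule integral_mono[OF iZ])
        show "integrable (\<mu> N) (\<lambda>U. M / 2 + (l / 2 * (?Z U)\<^sup>2 + 1 / (2 * l) * indicator bad U))"
          using iZ2 bad by (intro Bochner_Integration.integrable_add integrable_mult_right integrable_real_indicator)
            (auto simp: emeasure_eq_measure)
        fix U assume U: "U \<in> space (\<mu> N)"
        show "?Z U \<le> M / 2 + (l / 2 * (?Z U)\<^sup>2 + 1 / (2 * l) * indicator bad U)"
        proof (cases "U \<in> bad")
          case True
          have "0 \<le> (l * ?Z U - 1)\<^sup>2 / (2 * l)" using l by simp
          also have "\<dots> = l / 2 * (?Z U)\<^sup>2 + 1 / (2 * l) - ?Z U"
            using l by (simp add: field_simps power2_eq_square)
          finally show ?thesis using True M0 by simp
        next
          case False
          then have "\<not> M / 2 \<le> ?Z U" using neg U by blast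
          then have "?Z U \<le> M / 2" by simp
          moreover have "0 \<le> l / 2 * (?Z U)\<^sup>2" using l by simp
          ultimately show ?thesis using False by simp
        qed
      qed
      then show "M \<le> (\<integral>U. M / 2 + (l / 2 * (?Z U)\<^sup>2 + 1 / (2 * l) * indicator bad U) \<partial>\<mu> N)"
        by (simp only: M_def[symmetric])
    qed
    also have "\<dots> = M / 2 + (l / 2 * S + 1 / (2 * l) * measure (\<mu> N) bad)"
    proof -
      have ib: "integrable (\<mu> N) (\<lambda>U. indicator bad U :: real)"
        using bad by (intro integrable_real_indicator) (auto simp: emeasure_eq_measure)
      have "bad \<inter> orthogonal_group N = bad" by (auto simp: bad_def)
      then have "(\<integral>U. indicator bad U \<partial>\<mu> N) = measure (\<mu> N) bad" using bad by simp
      then show ?thesis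
        using iZ2 ib by (simp add: Bochner_Integration.integral_add S_def const_n[OF N order_refl] prob_group)
    qed
    also have "l / 2 * S = M / 4" using S0 by (simp add: l_def)
    also have "1 / (2 * l) * measure (\<mu> N) bad = S / M * measure (\<mu> N) bad" by (simp add: l_def)
    finally have "M / 4 \<le> S / M * measure (\<mu> N) bad" by linarith
    then have "M * M \<le> 4 * S * measure (\<mu> N) bad" using M0 by (simp add: field_simps)
    also have "\<dots> \<le> 4 * S * ?v" using P S0 by (intro mult_left_mono) auto
    also have "\<dots> < 4 * S * (exp (- 3) / 8)" using v S0 by (intro mult_strict_left_mono) auto
    also have "\<dots> \<le> 4 * (2 * exp (2 * ?L + 1)) * (exp (- 3) / 8)"
      using S_le by (intro mult_right_mono mult_left_mono) auto
    also have "\<dots> = exp (?L - 1) * exp (?L - 1)" by (simp add: mult_exp_exp)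
    also have "\<dots> \<le> M * M" using M_ge by (intro mult_mono) (auto intro: order_trans[OF exp_ge_zero])
    finally show False by simp
  qed
  then obtain U where U: "U \<in> space (\<mu> N)" "U \<notin> bad" "M / 2 \<le> ?Z U" by blast
  \<comment> \<open>One point outside the exceptional set is enough, because there ln Z differs from
    the deterministic number \<open>m\<close> by less than \<open>a\<close>.\<close>
  have "?L - 2 \<le> F U"
  proof -
    have e: "2 \<le> exp (1 :: real)" using exp_ge_add_one_self[of 1] by simp
    have "exp (?L - 2) * 2 \<le> exp (?L - 2) * exp 1" using e by (intro mult_left_mono) auto
    also have "\<dots> = exp (?L - 1)" by (simp add: mult_exp_exp)
    also have "\<dots> \<le> M" by (rule M_ge)
    finally have "exp (?L - 2) \<le> ?Z U" using U(3) by simp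
    then show ?thesis unfolding F_def by (simp add: ln_ge_iff Zf_pos)
  qed
  moreover have "\<bar>F U - m\<bar> < a" using U by (simp add: bad_def)
  ultimately have lower: "?L - 2 - a \<le> m" by linarith
  have "A \<subseteq> bad"
  proof
    fix U assume U: "U \<in> A"
    have "N * \<epsilon> < N * \<bar>(1 / N) * F U - Lam sign_mean \<beta>\<bar>"
      using A(2)[OF U] N2 by (intro mult_strict_left_mono) (auto simp: F_def)
    also have "\<dots> = \<bar>N * ((1 / N) * F U - Lam sign_mean \<beta>)\<bar>" by (simp add: abs_mult)
    also have "N * ((1 / N) * F U - Lam sign_mean \<beta>) = F U - ?L" using N2 by (simp add: field_simps)
    finally have "4 * a < \<bar>F U - ?L\<bar>" by (simp add: a_def mult.commute)
    then have "a \<le> \<bar>F U - m\<bar>" using upper lower a by linarith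
    then show "U \<in> bad" using U A(1) by (auto simp: bad_def)
  qed
  then have "measure (\<mu> N) A \<le> measure (\<mu> N) bad" by (rule finite_measure_mono[OF _ bad])
  with P show ?thesis by linarith
qed

end

text \<open>\<open>harm n - ln n\<close> converges to the Euler-Mascheroni constant, and ln n / n
  tends to 0.\<close>

lemma harm_over_n: "(\<lambda>n. (8 + 4 * harm n) / real n) \<longlonglongrightarrow> 0"
proof -
  have "(\<lambda>n. 8 / real n + 4 * ((harm n - ln (real n)) * (1 / real n) + ln (real n) / real n)) \<longlonglongrightarrow>
      0 + 4 * (euler_mascheroni * 0 + 0)"
    by (intro tendsto_intros euler_mascheroni_LIMSEQ)
  moreover have "8 / real n + 4 * ((harm n - ln (real n)) * (1 / real n) + ln (real n) / real n) =
      (8 + 4 * harm n) / real n" for n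
    by (simp add: add_divide_distrib diff_divide_distrib)
  ultimately show ?thesis by simp
qed

section \<open>The limit of the mean of the signs and the limiting integral\<close>

lemma cdf_two_point_measure:
  assumes "0 < p" "p < 1" "- 1 < x" "x < 1"
  shows "cdf (two_point_measure p) x = 1 - p"
proof -
  have "cdf (two_point_measure p) x = measure (measure_pmf (bernoulli_pmf p)) ((\<lambda>b. if b then 1 else - 1 :: real) -` {..x})"
    unfolding cdf_def two_point_measure_def by (subst measure_distr) auto
  also have "(\<lambda>b. if b then 1 else - 1 :: real) -` {..x} = {False}"
    using assms by (auto split: if_splits)
  also have "measure (measure_pmf (bernoulli_pmf p)) {False} = 1 - p"
    using assms by (simp add: measure_pmf_single)
  finally show ?thesis .
qed

lemma cdf_empirical_measure:
  assumes N: "1 \<le> N" and d: "\<And>i. i < N \<Longrightarrow> d i \<in> {-1, 1}"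
  shows "(\<Sum>i<N. d i) / N = 1 - 2 * cdf (empirical_measure N d) 0"
proof -
  let ?S = "{i\<in>{..<N}. d i \<le> 0}"
  have "cdf (empirical_measure N d) 0 = measure (uniform_count_measure {..<N}) ?S"
    unfolding cdf_def empirical_measure_def
    by (subst measure_distr)
      (auto simp: measurable_def space_uniform_count_measure sets_uniform_count_measure intro!: arg_cong2[of _ _ _ _ measure])
  also have "\<dots> = card ?S / N" by (subst measure_uniform_count_measure) auto
  finally have c: "cdf (empirical_measure N d) 0 = card ?S / N" .
  have "(\<Sum>i<N. d i) = (\<Sum>i<N. 1 - 2 * (if d i \<le> 0 then 1 else 0))"
    by (intro sum.cong refl) (use d in fastforce)
  also have "\<dots> = N - 2 * real (card ?S)"
    by (simp add: sum_subtractf sum_distrib_left[symmetric] sum.If_cases Int_def)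
  finally show ?thesis using N unfolding c by (simp add: field_simps)
qed

text \<open>Weak convergence is evaluated at the single point 0. The limiting distribution function
  is constant near it, hence continuous there, and the empirical one gives the fraction of signs
  -1.\<close>

lemma mean_tendsto:
  assumes p: "0 < p" "p < 1" and d: "\<And>N i. i < N \<Longrightarrow> d N i \<in> {-1, 1}"
    and w: "weak_conv_m (\<lambda>N. empirical_measure N (d N)) (two_point_measure p)"
  shows "(\<lambda>N. (\<Sum>i<N. d N i) / N) \<longlonglongrightarrow> 2 * p - 1"
proof -
  have "eventually (\<lambda>x. x \<in> {-1<..<1 :: real}) (nhds 0)"
    by (rule eventually_nhds_in_open) auto
  then have "eventually (\<lambda>x. cdf (two_point_measure p) x = 1 - p) (nhds 0)"
    by eventually_elim (use cdf_two_point_measure[OF p] in auto)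
  then have "isCont (cdf (two_point_measure p)) 0" by (subst isCont_cong) auto
  then have "(\<lambda>N. cdf (empirical_measure N (d N)) 0) \<longlonglongrightarrow> cdf (two_point_measure p) 0"
    using w unfolding weak_conv_m_def weak_conv_def by blast
  then have "(\<lambda>N. 1 - 2 * cdf (empirical_measure N (d N)) 0) \<longlonglongrightarrow> 1 - 2 * (1 - p)"
    using cdf_two_point_measure[OF p, of 0] by (intro tendsto_intros) auto
  moreover have "eventually (\<lambda>N. 1 - 2 * cdf (empirical_measure N (d N)) 0 = (\<Sum>i<N. d N i) / N) sequentially"
    using eventually_ge_at_top[of 1] by eventually_elim (use cdf_empirical_measure d in metis)
  ultimately show ?thesis by (simp add: tendsto_cong)
qed

lemma Lam_eq_integral:
  assumes m: "\<bar>m\<bar> \<le> 1" and \<beta>: "0 \<le> \<beta>"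
  shows "(1 / 2) * integral {0..2 * \<beta>} (\<lambda>z. (sqrt (1 + 4 * z * (m + z)) - 1) / (2 * z)) = Lam m \<beta>"
proof -
  have im: "(\<lambda>x. x / (1 / 2)) ` {0..\<beta>} = {0..2 * \<beta>}"
  proof -
    have "x \<in> (\<lambda>x. x / (1 / 2)) ` {0..\<beta>}" if "x \<in> {0..2 * \<beta>}" for x
      using that by (intro image_eqI[of _ _ "x / 2"]) auto
    then show ?thesis using \<beta> by auto
  qed
  have "((\<lambda>x. rho m (1 / 2 * x)) has_integral (1 / \<bar>1 / 2\<bar>) *\<^sub>R Lam m \<beta>) ((\<lambda>x. x / (1 / 2)) ` {0..\<beta>})"
    by (rule has_integral_stretch_real[OF rho_has_integral[OF m]]) simp
  then have h: "((\<lambda>x. rho m (1 / 2 * x)) has_integral 2 * Lam m \<beta>) {0..2 * \<beta>}"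
    unfolding im by simp
  have "((\<lambda>z. (sqrt (1 + 4 * z * (m + z)) - 1) / (2 * z)) has_integral 2 * Lam m \<beta>) {0..2 * \<beta>}"
  \<comment> \<open>At z = 0 the quotient has the value 0 by division by zero, whereas
    \<open>rho\<close> has the value m; one point does not affect the integral.\<close>
  proof (rule has_integral_spike_finite[of "{0}", OF _ _ h])
    fix z assume "z \<in> {0..2 * \<beta>} - {0}"
    then have z: "0 < z" by auto
    define s where "s = sqrt (1 + 4 * z * (m + z))"
    have d: "0 \<le> 1 + 4 * z * (m + z)" using rho_disc_nonneg[OF m, of "z / 2"] z by simp
    then have s0: "0 \<le> s" and s2: "s * s = 1 + 4 * z * (m + z)" by (simp_all add: s_def)
    have "rho m (1 / 2 * z) = 2 * (m + z) / (1 + s)" by (simp add: rho_def s_def)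
    moreover have "(s - 1) * (1 + s) = 2 * (m + z) * (2 * z)" using s2 by (simp add: algebra_simps)
    then have "(s - 1) / (2 * z) = 2 * (m + z) / (1 + s)" using z s0 by (simp add: frac_eq_eq)
    ultimately show "(sqrt (1 + 4 * z * (m + z)) - 1) / (2 * z) = rho m (1 / 2 * z)" by (simp add: s_def)
  qed simp
  then show ?thesis by (simp add: integral_unique)
qed

lemma tendsto_in_probability_ln_Z_ROM:
  fixes d :: "nat \<Rightarrow> nat \<Rightarrow> real" and \<mu> :: "nat \<Rightarrow> real mat measure"
  assumes d: "\<And>N i. i < N \<Longrightarrow> d N i \<in> {-1, 1}" and mean: "(\<lambda>N. (\<Sum>i<N. d N i) / N) \<longlonglongrightarrow> m"
    and m: "\<bar>m\<bar> \<le> 1" and haar: "\<And>N. 1 \<le> N \<Longrightarrow> is_haar N (\<mu> N)" and \<beta>: "0 \<le> \<beta>" "\<beta> \<le> 1 / 16"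
  shows "tendsto_in_probability \<mu> (\<lambda>N U. (1 / real N) * ln (Z_ROM N \<beta> U (mat_diag N (d N)))) (Lam m \<beta>)"
  unfolding tendsto_in_probability_def
proof (intro allI impI)
  fix \<epsilon> :: real assume \<epsilon>: "0 < \<epsilon>"
  let ?A = "\<lambda>N. {U \<in> space (\<mu> N). \<epsilon> < \<bar>(1 / real N) * ln (Z_ROM N \<beta> U (mat_diag N (d N))) - Lam m \<beta>\<bar>}"
  define v where "v = (\<lambda>N. 512 * \<beta>\<^sup>2 * ((8 + 4 * harm N) / real N) / (\<epsilon> / 2)\<^sup>2)"
  have v0: "v \<longlonglongrightarrow> 0"
  proof -
    have "v \<longlonglongrightarrow> 512 * \<beta>\<^sup>2 * 0 / (\<epsilon> / 2)\<^sup>2"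
      unfolding v_def using \<epsilon> by (intro tendsto_intros harm_over_n) auto
    then show ?thesis by simp
  qed
  have "eventually (\<lambda>N. v N < exp (- 3) / 8) sequentially"
    by (rule order_tendstoD(2)[OF v0]) simp
  moreover have "eventually (\<lambda>N. dist ((\<Sum>i<N. d N i) / N) m < \<epsilon> / 2) sequentially"
    by (rule tendstoD[OF mean]) (use \<epsilon> in simp)
  moreover have "eventually (\<lambda>N. 2 \<le> N) sequentially" by (rule eventually_ge_at_top)
  moreover have "eventually (\<lambda>N. 16 / \<epsilon> \<le> real N) sequentially"
    by (rule eventually_sequentiallyI[of "nat \<lceil>16 / \<epsilon>\<rceil>"]) linarith
  ultimately have bound: "eventually (\<lambda>N. measure (\<mu> N) (?A N) \<le> v N) sequentially"
  proof eventually_elim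
    case (elim N)
    interpret S: haar_sequence N \<mu> "d N" \<beta>
      by unfold_locales (use elim haar d \<beta> in auto)
    have sign_mean: "S.sign_mean = (\<Sum>i<N. d N i) / N" by (rule S.sign_mean_def)
    \<comment> \<open>Half of \<epsilon> goes to replacing the finite-N mean of the signs by m, the
      other half to the concentration of ln Z.\<close>
    have L: "\<bar>Lam S.sign_mean \<beta> - Lam m \<beta>\<bar> \<le> \<epsilon> / 2"
      using Lam_Lipschitz_m[OF m S.abs_sign_mean_le \<beta>(1)] \<beta>(2) elim(2) unfolding sign_mean dist_real_def by simp
    show "measure (\<mu> N) (?A N) \<le> v N" unfolding v_def
    proof (rule S.ln_Zf_concentration)
      show "512 * \<beta>\<^sup>2 * ((8 + 4 * harm N) / real N) / (\<epsilon> / 2)\<^sup>2 < exp (- 3) / 8"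
        using elim(1) unfolding v_def .
      show "8 \<le> \<epsilon> / 2 * N" using elim(4) \<epsilon> by (simp add: field_simps)
      fix U assume U: "U \<in> ?A N"
      then have "U \<in> carrier_mat N N" using orthogonal_groupD(1) by simp
      then have "Z_ROM N \<beta> U (mat_diag N (d N)) = Zf N (d N) \<beta> U" by (rule Z_ROM_eq_Zf)
      then have "\<epsilon> < \<bar>(1 / N) * ln (Zf N (d N) \<beta> U) - Lam m \<beta>\<bar>" using U by simp
      then show "\<epsilon> / 2 < \<bar>(1 / N) * ln (Zf N (d N) \<beta> U) - Lam S.sign_mean \<beta>\<bar>" using L by linarith
    qed (use elim(3) \<beta> \<epsilon> in auto)
  qed
  show "(\<lambda>N. measure (\<mu> N) (?A N)) \<longlonglongrightarrow> 0"
    by (rule tendsto_sandwich[OF _ bound tendsto_const v0]) simp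
qed

theorem proposition2p2:
  fixes p m :: real
  assumes "0 < p" and "p < 1" and "m = 2 * p - 1"
  shows "\<exists>\<beta>\<^sub>m>0. \<forall>(d :: nat \<Rightarrow> nat \<Rightarrow> real) (\<mu> :: nat \<Rightarrow> real mat measure).
     (\<forall>N. \<forall>i<N. d N i \<in> {-1, 1}) \<longrightarrow>
     weak_conv_m (\<lambda>N. empirical_measure N (d N)) (two_point_measure p) \<longrightarrow>
     (\<forall>N\<ge>1. is_haar N (\<mu> N)) \<longrightarrow>
     (\<forall>\<beta>. 0 < \<beta> \<and> \<beta> < \<beta>\<^sub>m \<longrightarrow>
        tendsto_in_probability \<mu>
          (\<lambda>N U. (1 / real N) * ln (Z_ROM N \<beta> U (mat_diag N (d N))))
          ((1 / 2) * integral {0..2 * \<beta>} (\<lambda>z. (sqrt (1 + 4 * z * (m + z)) - 1) / (2 * z))))"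
\<comment> \<open>With \<beta> below 1/16 the weights of two replicas, at most 2\<beta>, stay in the
  range of \<open>rho_compare\<close>.\<close>
proof (intro exI[of _ "1 / 16"] conjI allI impI)
  fix d :: "nat \<Rightarrow> nat \<Rightarrow> real" and \<mu> :: "nat \<Rightarrow> real mat measure" and \<beta> :: real
  assume d: "\<forall>N. \<forall>i<N. d N i \<in> {-1, 1}"
    and w: "weak_conv_m (\<lambda>N. empirical_measure N (d N)) (two_point_measure p)"
    and haar: "\<forall>N\<ge>1. is_haar N (\<mu> N)" and \<beta>: "0 < \<beta> \<and> \<beta> < 1 / 16"
  have m: "\<bar>m\<bar> \<le> 1" using assms by (simp add: abs_le_iff)
  have "tendsto_in_probability \<mu> (\<lambda>N U. (1 / real N) * ln (Z_ROM N \<beta> U (mat_diag N (d N)))) (Lam m \<beta>)"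
  proof (rule tendsto_in_probability_ln_Z_ROM[OF _ _ m])
    show "(\<lambda>N. (\<Sum>i<N. d N i) / N) \<longlonglongrightarrow> m"
      unfolding assms(3) by (rule mean_tendsto[OF assms(1,2) _ w]) (use d in blast)
  qed (use d haar \<beta> in auto)
  also have "Lam m \<beta> = (1 / 2) * integral {0..2 * \<beta>} (\<lambda>z. (sqrt (1 + 4 * z * (m + z)) - 1) / (2 * z))"
    by (rule Lam_eq_integral[symmetric]) (use m \<beta> in auto)
  finally show "tendsto_in_probability \<mu> (\<lambda>N U. (1 / real N) * ln (Z_ROM N \<beta> U (mat_diag N (d N))))
      ((1 / 2) * integral {0..2 * \<beta>} (\<lambda>z. (sqrt (1 + 4 * z * (m + z)) - 1) / (2 * z)))" .
qed simp

end
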